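(* Let $R$ be a commutative ring of Krull dimension $0$ which is integral over an Artinian subring $R_0$, write $\mathcal{F}=\mathcal{F}(R_0,R)$, and let $S=\mathcal{F}\llbracket X_1,\ldots,X_n\rrbracket$. Then $\dim S=n$. Moreover, for each $M\in\operatorname{Spec}R$, the extended ideal $MS$ is a minimal prime ideal of $S$, and $S/MS$ is a (Noetherian) regular local ring of dimension $n$.
   Context: All rings are commutative with identity, and subrings share the identity. For a $0$-dimensional ring $R$ and an Artinian subring $R_0\subseteq R$ such that $R$ is integral over $R_0$, let $\mathcal{F}(R_0,R)=\{R_\alpha\}$ denote the family of all subrings of $R$ that are finitely generated as $R_0$-algebras; this family is directed, each $R_\alpha$ is Artinian, and $R=\bigcup_\alpha R_\alpha$. The ring of Artinian power series $\mathcal{F}\llbracket X_1,\ldots,X_n\rrbracket$ is the set of all $f\in R\llbracket X_1,\ldots,X_n\rrbracket$ such that all coefficients of $f$ lie in a single $R_\alpha\in\mathcal{F}$; equivalently, $\mathcal{F}\llbracket X_1,\ldots,X_n\rrbracket=\bigcup_\alpha R_\alpha\llbracket X_1,\ldots,X_n\rrbracket$, which is a subring of $R\llbracket X_1,\ldots,X_n\rrbracket$. Dimension means Krull dimension. *)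

theory Defs
  imports "HOL-Algebra.Ring_Divisibility" "HOL-Algebra.QuotRing" "HOL-Algebra.Generated_Rings" "HOL-Library.Extended_Nat"
begin

definition prime_chain :: "('a, 'b) ring_scheme \<Rightarrow> nat \<Rightarrow> bool" where
  "prime_chain R k \<longleftrightarrow>
     (\<exists>P :: nat \<Rightarrow> 'a set. (\<forall>i \<le> k. primeideal (P i) R) \<and> (\<forall>i < k. P i \<subset> P (Suc i)))"

definition krull_dim :: "('a, 'b) ring_scheme \<Rightarrow> enat" where
  "krull_dim R = Sup {enat k | k. prime_chain R k}"

definition artinian_ring :: "('a, 'b) ring_scheme \<Rightarrow> bool" where
  "artinian_ring R \<longleftrightarrow> cring R \<and>
     (\<forall>I :: nat \<Rightarrow> 'a set. (\<forall>k. ideal (I k) R \<and> I (Suc k) \<subseteq> I k) \<longrightarrow>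
        (\<exists>N. \<forall>k \<ge> N. I k = I N))"

definition minimal_prime :: "'a set \<Rightarrow> ('a, 'b) ring_scheme \<Rightarrow> bool" where
  "minimal_prime P R \<longleftrightarrow> primeideal P R \<and> (\<forall>Q. primeideal Q R \<and> Q \<subseteq> P \<longrightarrow> Q = P)"

definition local_ring :: "('a, 'b) ring_scheme \<Rightarrow> bool" where
  "local_ring R \<longleftrightarrow> cring R \<and> (\<exists>!m. maximalideal m R)"

definition regular_local_ring :: "('a, 'b) ring_scheme \<Rightarrow> bool" where
  "regular_local_ring R \<longleftrightarrow> local_ring R \<and> noetherian_ring R \<and>
     (\<exists>d::nat. krull_dim R = enat d \<and>
        (\<forall>m. maximalideal m R \<longrightarrow>
           (\<exists>G \<subseteq> carrier R. finite G \<and> card G \<le> d \<and> m = Idl\<^bsub>R\<^esub> G)))"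

definition integral_over :: "('a, 'b) ring_scheme \<Rightarrow> 'a set \<Rightarrow> bool" where
  "integral_over R R0 \<longleftrightarrow>
     (\<forall>x \<in> carrier R. \<exists>(k::nat) (a :: nat \<Rightarrow> 'a). (\<forall>i < k. a i \<in> R0) \<and>
        x [^]\<^bsub>R\<^esub> k \<oplus>\<^bsub>R\<^esub> (\<Oplus>\<^bsub>R\<^esub> i \<in> {..<k}. a i \<otimes>\<^bsub>R\<^esub> x [^]\<^bsub>R\<^esub> i) = \<zero>\<^bsub>R\<^esub>)"

definition fg_subalgebras :: "('a, 'b) ring_scheme \<Rightarrow> 'a set \<Rightarrow> 'a set set" where
  "fg_subalgebras R R0 =
     {generate_ring R (R0 \<union> G) | G. finite G \<and> G \<subseteq> carrier R}"

definition exps :: "nat \<Rightarrow> (nat \<Rightarrow> nat) set" where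
  "exps n = {e. \<forall>i \<ge> n. e i = 0}"

definition PS :: "('a, 'b) ring_scheme \<Rightarrow> nat \<Rightarrow> ((nat \<Rightarrow> nat) \<Rightarrow> 'a) ring" where
  "PS R n =
    \<lparr> carrier = {f. (\<forall>e \<in> exps n. f e \<in> carrier R) \<and> (\<forall>e. e \<notin> exps n \<longrightarrow> f e = \<zero>\<^bsub>R\<^esub>)},
      mult = (\<lambda>f g e. if e \<in> exps n then
          (\<Oplus>\<^bsub>R\<^esub> p \<in> {(a, b). a \<in> exps n \<and> b \<in> exps n \<and> (\<forall>i. a i + b i = e i)}.
             f (fst p) \<otimes>\<^bsub>R\<^esub> g (snd p))
        else \<zero>\<^bsub>R\<^esub>),
      one = (\<lambda>e. if e = (\<lambda>_. 0) then \<one>\<^bsub>R\<^esub> else \<zero>\<^bsub>R\<^esub>),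
      zero = (\<lambda>e. \<zero>\<^bsub>R\<^esub>),
      add = (\<lambda>f g e. if e \<in> exps n then f e \<oplus>\<^bsub>R\<^esub> g e else \<zero>\<^bsub>R\<^esub>) \<rparr>"

definition PS_const :: "('a, 'b) ring_scheme \<Rightarrow> 'a \<Rightarrow> (nat \<Rightarrow> nat) \<Rightarrow> 'a" where
  "PS_const R c = (\<lambda>e. if e = (\<lambda>_. 0) then c else \<zero>\<^bsub>R\<^esub>)"

definition artinian_PS :: "('a, 'b) ring_scheme \<Rightarrow> 'a set \<Rightarrow> nat \<Rightarrow> ((nat \<Rightarrow> nat) \<Rightarrow> 'a) ring" where
  "artinian_PS R R0 n = (PS R n)\<lparr> carrier :=
     {f \<in> carrier (PS R n). \<exists>A \<in> fg_subalgebras R R0. \<forall>e. f e \<in> A} \<rparr>"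

end

theory Submission
  imports Defs "HOL-Library.Function_Algebras" "HOL-Computational_Algebra.Primes"
begin

text \<open>Integrality over an Artinian ring makes every nonzero class modulo a prime \<open>M\<close> of \<open>R\<close> invertible already inside
  any \<open>R\<^sub>\<alpha>\<close> containing it, so the images of the \<open>R\<^sub>\<alpha>\<close> in the field \<open>K = R/M\<close> form a directed family of
  subfields. As \<open>R\<^sub>0\<close> is Noetherian and \<open>R\<^sub>\<alpha>\<close> lies in a finite \<open>R\<^sub>0\<close>-module, \<open>M \<inter> R\<^sub>\<alpha>\<close> is finitely generated; hence \<open>MS\<close>
  consists of the series with coefficients in \<open>M\<close>, and \<open>S/MS\<close> is the ring \<open>D\<close> of power series over \<open>K\<close> whose
  coefficients lie in a single subfield of the family. Every prime of \<open>S\<close> contains some \<open>MS\<close>, and everything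
  reduces to \<open>D\<close>.

  Division by finitely many series, with respect to a monomial order of type \<open>\<omega>\<close>, does not leave the subfield of
  the coefficients, so by Dickson's lemma every ideal of \<open>D\<close> has a finite standard basis. This gives
  Noetherianity, locality and the generators \<open>X\<^sub>1, \<dots>, X\<^sub>n\<close> of the maximal ideal. For the dimension, let \<open>H\<^sub>P(t)\<close> count
  the monomials of size less than \<open>2\<^sup>t\<close> that are not leading monomials of \<open>P\<close>. For primes \<open>P \<subset> P'\<close> there is a \<open>c\<close> with
  \<open>H\<^sub>P\<^sub>'(t + c) + H\<^sub>P(t) \<le> H\<^sub>P(t + c)\<close>, so a chain of length \<open>k\<close> forces growth of degree \<open>k\<close>, whereas \<open>H\<^sub>P(t) \<le> t\<^sup>n\<close>.\<close>

subsection \<open>Power series over a directed family of subrings\<close>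

text \<open>\<open>D\<close> need not be complete: a Cauchy sequence of series can use coefficients
  from ever larger subfields. Division is therefore not a limit process; it is a recursion over the
  exponents that computes every quotient coefficient from the finitely many given series. Leading
  monomials are the smallest ones, so that every nonzero series has one. Since sizes are
  multiplicative, cut-offs are powers of 2: a factor of size at most \<open>2 ^ c\<close> moves
  \<open>t\<close> to \<open>t + c\<close>. The number \<open>H\<^sub>P(t)\<close> is a
  Hilbert-Samuel function for the resulting filtration, and \<open>c\<close> is an Artin-Rees
  constant: dividing by an element of \<open>P' - P\<close> modulo \<open>P\<close> lowers the order
  of vanishing by at most the factor \<open>2 ^ c\<close>. Along multiples of \<open>c\<close> the
  inequality between \<open>H\<^sub>P\<close> and \<open>H\<^sub>P\<^sub>'\<close> becomes Pascal's
  rule, so the growth is that of binomial coefficients. The lower bound for the dimension comes from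
  the primes generated by initial segments of the variables. For a prime \<open>Q\<close> of
  \<open>S\<close> the relevant \<open>M\<close> is the contraction of \<open>Q\<close> to
  \<open>R\<close>.\<close>

definition exp_pairs :: "nat \<Rightarrow> (nat \<Rightarrow> nat) \<Rightarrow> ((nat \<Rightarrow> nat) \<times> (nat \<Rightarrow> nat)) set" where
  "exp_pairs n e = {(a, b). a \<in> exps n \<and> b \<in> exps n \<and> a + b = e}"

lemma zero_in_exps [simp]: "0 \<in> exps n"
  by (simp add: exps_def)

lemma exps_add [simp]: "a + b \<in> exps n \<longleftrightarrow> a \<in> exps n \<and> b \<in> exps n"
  by (auto simp: exps_def)

lemma exps_diff: "e \<in> exps n \<Longrightarrow> e - a \<in> exps n"
  by (auto simp: exps_def)

lemma exp_add_diff_cancel [simp]: "a + b - a = b" "b + a - a = b" for a b :: "nat \<Rightarrow> nat"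
  by auto

lemma exp_le_add [simp]: "a \<le> a + b" "b \<le> a + b" for a b :: "nat \<Rightarrow> nat"
  by (auto simp: le_fun_def)

lemma finite_exps_bounded: "finite {e \<in> exps n. \<forall>i<n. e i < t}"
proof (rule finite_subset)
  show "{e \<in> exps n. \<forall>i<n. e i < t} \<subseteq> (\<lambda>f i. if i < n then f i else 0) ` (PiE {..<n} (\<lambda>_. {..<t}))"
  proof
    fix e assume "e \<in> {e \<in> exps n. \<forall>i<n. e i < t}"
    then show "e \<in> (\<lambda>f i. if i < n then f i else 0) ` (PiE {..<n} (\<lambda>_. {..<t}))"
      by (intro image_eqI[where x = "restrict e {..<n}"]) (auto simp: exps_def fun_eq_iff)
  qed
qed (auto intro: finite_PiE)

lemma card_exps_bounded: "card {e \<in> exps n. \<forall>i<n. e i < t} \<le> t ^ n"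
proof -
  have "inj_on (\<lambda>e. restrict e {..<n}) {e \<in> exps n. \<forall>i<n. e i < t}"
  proof (rule inj_onI, rule ext)
    fix a b :: "nat \<Rightarrow> nat" and i
    assume ab: "a \<in> {e \<in> exps n. \<forall>i<n. e i < t}" "b \<in> {e \<in> exps n. \<forall>i<n. e i < t}"
      "restrict a {..<n} = restrict b {..<n}"
    show "a i = b i"
    proof (cases "i < n")
      case True
      then show ?thesis using fun_cong[OF ab(3), of i] by simp
    qed (use ab in \<open>auto simp: exps_def\<close>)
  qed
  moreover have "(\<lambda>e. restrict e {..<n}) ` {e \<in> exps n. \<forall>i<n. e i < t} \<subseteq> PiE {..<n} (\<lambda>_. {..<t})"
    by (auto simp: restrict_def split: if_splits)
  ultimately have "card {e \<in> exps n. \<forall>i<n. e i < t} \<le> card (PiE {..<n} (\<lambda>_. {..<t}))"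
    by (rule card_inj_on_le) (auto intro: finite_PiE)
  also have "\<dots> = t ^ n" by (simp add: card_PiE)
  finally show ?thesis .
qed

lemma finite_exps_le: "finite {a \<in> exps n. a \<le> e}"
proof (rule finite_subset)
  show "{a \<in> exps n. a \<le> e} \<subseteq> {a \<in> exps n. \<forall>i<n. a i < Suc (Max (e ` {..<n}))}"
    by (auto simp: le_fun_def less_Suc_eq_le) (meson Max_ge finite_imageI finite_lessThan image_eqI lessThan_iff order_trans)
qed (rule finite_exps_bounded)

lemma finite_exp_pairs [simp]: "finite (exp_pairs n e)"
  by (rule finite_subset[of _ "{a \<in> exps n. a \<le> e} \<times> {a \<in> exps n. a \<le> e}"])
    (auto simp: exp_pairs_def finite_exps_le)

lemma exp_pairs_outside: "e \<notin> exps n \<Longrightarrow> exp_pairs n e = {}"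
  by (auto simp: exp_pairs_def)

lemma (in abelian_monoid) finsum_Sigma:
  assumes "finite A" "\<And>x. x \<in> A \<Longrightarrow> finite (B x)"
    "\<And>x y. x \<in> A \<Longrightarrow> y \<in> B x \<Longrightarrow> g (x, y) \<in> carrier G"
  shows "(\<Oplus>x\<in>A. \<Oplus>y\<in>B x. g (x, y)) = (\<Oplus>p\<in>Sigma A B. g p)"
proof -
  have eq: "Sigma A B = (\<Union>x\<in>A. Pair x ` B x)" by auto
  have "(\<Oplus>p\<in>Sigma A B. g p) = (\<Oplus>x\<in>A. finsum G g (Pair x ` B x))"
    unfolding eq using assms
    by (intro add.finprod_UN_disjoint) (auto simp: pairwise_def disjnt_def)
  also have "\<dots> = (\<Oplus>x\<in>A. \<Oplus>y\<in>B x. g (x, y))"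
  proof (intro finsum_cong')
    fix i assume "i \<in> A"
    then show "finsum G g (Pair i ` B i) = (\<Oplus>y\<in>B i. g (i, y))"
      using assms(3) by (intro finsum_reindex) (auto simp: inj_on_def)
  qed (use assms in \<open>auto intro!: finsum_closed\<close>)
  finally show ?thesis by simp
qed

lemma (in abelian_monoid) finsum_bij:
  assumes "bij_betw h A B" "\<And>y. y \<in> B \<Longrightarrow> g y \<in> carrier G"
  shows "finsum G g B = (\<Oplus>x\<in>A. g (h x))"
  using assms finsum_reindex[of g h A] by (auto simp: bij_betw_def)

lemma (in abelian_group) finsum_in_subgroup:
  assumes "additive_subgroup H G" "\<And>x. x \<in> A \<Longrightarrow> f x \<in> H"
  shows "finsum G f A \<in> H"
proof -
  interpret additive_subgroup H G by fact
  show ?thesis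
    using assms(2) by (induction A rule: infinite_finite_induct) (auto simp: Pi_def)
qed

section \<open>The ring of all power series in n variables\<close>

lemma PS_carrier_iff:
  "f \<in> carrier (PS R n) \<longleftrightarrow> (\<forall>e\<in>exps n. f e \<in> carrier R) \<and> (\<forall>e. e \<notin> exps n \<longrightarrow> f e = \<zero>\<^bsub>R\<^esub>)"
  by (simp add: PS_def)

lemma PS_zero [simp]: "\<zero>\<^bsub>PS R n\<^esub> = (\<lambda>e. \<zero>\<^bsub>R\<^esub>)"
  by (simp add: PS_def)

lemma PS_one: "\<one>\<^bsub>PS R n\<^esub> = PS_const R \<one>\<^bsub>R\<^esub>"
  by (simp add: PS_def PS_const_def)

lemma PS_const_eval: "PS_const R c e = (if e = 0 then c else \<zero>\<^bsub>R\<^esub>)"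
  by (simp add: PS_const_def zero_fun_def)

context cring
begin

lemma PS_closed: "f \<in> carrier (PS R n) \<Longrightarrow> f e \<in> carrier R"
  by (cases "e \<in> exps n") (auto simp: PS_carrier_iff)

lemma PS_outside: "f \<in> carrier (PS R n) \<Longrightarrow> e \<notin> exps n \<Longrightarrow> f e = \<zero>"
  by (auto simp: PS_carrier_iff)

lemma PS_add: 
  assumes "f \<in> carrier (PS R n)" "g \<in> carrier (PS R n)"
  shows "(f \<oplus>\<^bsub>PS R n\<^esub> g) e = f e \<oplus> g e"
  using assms by (auto simp: PS_def)

lemma PS_mult: "(f \<otimes>\<^bsub>PS R n\<^esub> g) e = (\<Oplus>p\<in>exp_pairs n e. f (fst p) \<otimes> g (snd p))"
proof -
  have "{(a, b). a \<in> exps n \<and> b \<in> exps n \<and> (\<forall>i. a i + b i = e i)} = exp_pairs n e"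
    by (auto simp: exp_pairs_def fun_eq_iff)
  then show ?thesis
    by (auto simp: PS_def exp_pairs_outside)
qed

lemma PS_const_closed [intro]: "c \<in> carrier R \<Longrightarrow> PS_const R c \<in> carrier (PS R n)"
  by (auto simp: PS_carrier_iff PS_const_eval)

lemma PS_mult_closed:
  "f \<in> carrier (PS R n) \<Longrightarrow> g \<in> carrier (PS R n) \<Longrightarrow> f \<otimes>\<^bsub>PS R n\<^esub> g \<in> carrier (PS R n)"
  by (simp add: PS_carrier_iff[of "f \<otimes>\<^bsub>PS R n\<^esub> g"] PS_mult exp_pairs_outside PS_closed finsum_closed)

lemma PS_const_mult:
  assumes "c \<in> carrier R" "f \<in> carrier (PS R n)"
  shows "(PS_const R c \<otimes>\<^bsub>PS R n\<^esub> f) e = c \<otimes> f e"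
proof (cases "e \<in> exps n")
  case True
  have "(PS_const R c \<otimes>\<^bsub>PS R n\<^esub> f) e = (\<Oplus>p\<in>exp_pairs n e. if p = (0, e) then c \<otimes> f e else \<zero>)"
    unfolding PS_mult using assms
    by (intro finsum_cong') (auto simp: PS_const_eval exp_pairs_def PS_closed)
  also have "\<dots> = c \<otimes> f e"
  proof (rule add.finprod_singleton_swap[where f = "\<lambda>_. c \<otimes> f e"])
    show "(0, e) \<in> exp_pairs n e" using True by (auto simp: exp_pairs_def)
  qed (use assms in \<open>auto simp: PS_closed\<close>)
  finally show ?thesis .
qed (use assms in \<open>auto simp: PS_mult exp_pairs_outside PS_outside\<close>)

lemma PS_mult_comm:
  assumes "f \<in> carrier (PS R n)" "g \<in> carrier (PS R n)"
  shows "f \<otimes>\<^bsub>PS R n\<^esub> g = g \<otimes>\<^bsub>PS R n\<^esub> f"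
proof
  fix e
  have bij: "bij_betw prod.swap (exp_pairs n e) (exp_pairs n e)"
    by (rule bij_betwI[of _ _ _ prod.swap]) (auto simp: exp_pairs_def add.commute)
  show "(f \<otimes>\<^bsub>PS R n\<^esub> g) e = (g \<otimes>\<^bsub>PS R n\<^esub> f) e"
    unfolding PS_mult using assms
    by (subst finsum_bij[OF bij]) (auto intro!: finsum_cong' simp: PS_closed m_comm)
qed

lemma PS_mult_assoc:
  assumes "f \<in> carrier (PS R n)" "g \<in> carrier (PS R n)" "h \<in> carrier (PS R n)"
  shows "(f \<otimes>\<^bsub>PS R n\<^esub> g) \<otimes>\<^bsub>PS R n\<^esub> h = f \<otimes>\<^bsub>PS R n\<^esub> (g \<otimes>\<^bsub>PS R n\<^esub> h)"
proof
  fix e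
  let ?S = "Sigma (exp_pairs n e) (\<lambda>p. exp_pairs n (fst p))"
  let ?T = "Sigma (exp_pairs n e) (\<lambda>p. exp_pairs n (snd p))"
  let ?u = "\<lambda>(p, q). f (fst q) \<otimes> g (snd q) \<otimes> h (snd p)"
  let ?v = "\<lambda>(p, q). f (fst p) \<otimes> (g (fst q) \<otimes> h (snd q))"
  \<comment> \<open>Both iterated sums run over the decompositions of \<open>e\<close> into three
    exponents \<open>a + b + c\<close>; the bijection rebrackets \<open>(a + b) + c\<close> as
    \<open>a + (b + c)\<close>.\<close>
  have bij: "bij_betw (\<lambda>((d, c), (a, b)). ((a, b + c), (b, c))) ?S ?T"
    by (rule bij_betwI[of _ _ _ "\<lambda>((a, d), (b, c)). ((a + b, c), (a, b))"])
      (auto simp: exp_pairs_def add.assoc)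
  have "((f \<otimes>\<^bsub>PS R n\<^esub> g) \<otimes>\<^bsub>PS R n\<^esub> h) e
      = (\<Oplus>p\<in>exp_pairs n e. \<Oplus>q\<in>exp_pairs n (fst p). ?u (p, q))"
    unfolding PS_mult using assms
    by (intro finsum_cong') (auto simp: PS_closed finsum_ldistr Pi_def intro!: finsum_closed)
  also have "\<dots> = (\<Oplus>x\<in>?S. ?u x)"
    using assms by (intro finsum_Sigma) (auto simp: PS_closed)
  also have "\<dots> = (\<Oplus>x\<in>?T. ?v x)"
    using assms by (subst finsum_bij[OF bij])
     (auto intro!: finsum_cong' simp: PS_closed m_assoc split: prod.splits)
  also have "\<dots> = (\<Oplus>p\<in>exp_pairs n e. \<Oplus>q\<in>exp_pairs n (snd p). ?v (p, q))"
    using assms by (intro finsum_Sigma[symmetric]) (auto simp: PS_closed)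
  also have "\<dots> = (f \<otimes>\<^bsub>PS R n\<^esub> (g \<otimes>\<^bsub>PS R n\<^esub> h)) e"
    unfolding PS_mult using assms
    by (intro finsum_cong') (auto simp: PS_closed finsum_rdistr Pi_def intro!: finsum_closed)
  finally show "((f \<otimes>\<^bsub>PS R n\<^esub> g) \<otimes>\<^bsub>PS R n\<^esub> h) e = (f \<otimes>\<^bsub>PS R n\<^esub> (g \<otimes>\<^bsub>PS R n\<^esub> h)) e" .
qed

lemma PS_cring: "cring (PS R n)"
proof (rule cringI)
  show "abelian_group (PS R n)"
  proof (rule abelian_groupI)
    fix x assume x: "x \<in> carrier (PS R n)"
    have "(\<lambda>e. \<ominus> x e) \<in> carrier (PS R n)" 
      using x by (auto simp: PS_carrier_iff)
    moreover have "(\<lambda>e. \<ominus> x e) \<oplus>\<^bsub>PS R n\<^esub> x = \<zero>\<^bsub>PS R n\<^esub>"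
      using x calculation by (auto simp: PS_add fun_eq_iff PS_closed l_neg)
    ultimately show "\<exists>y\<in>carrier (PS R n). y \<oplus>\<^bsub>PS R n\<^esub> x = \<zero>\<^bsub>PS R n\<^esub>" by blast
  next
    fix x y z assume "x \<in> carrier (PS R n)" "y \<in> carrier (PS R n)" "z \<in> carrier (PS R n)"
    moreover have "u \<oplus>\<^bsub>PS R n\<^esub> v \<in> carrier (PS R n)"
      if "u \<in> carrier (PS R n)" "v \<in> carrier (PS R n)" for u v
      using that by (auto simp: PS_def)
    ultimately show "x \<oplus>\<^bsub>PS R n\<^esub> y \<oplus>\<^bsub>PS R n\<^esub> z = x \<oplus>\<^bsub>PS R n\<^esub> (y \<oplus>\<^bsub>PS R n\<^esub> z)"
      by (auto simp: PS_add PS_closed fun_eq_iff a_assoc)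
  qed (auto simp: PS_def fun_eq_iff a_comm)
  show "comm_monoid (PS R n)"
  proof (rule comm_monoidI)
    fix x assume "x \<in> carrier (PS R n)"
    then show "\<one>\<^bsub>PS R n\<^esub> \<otimes>\<^bsub>PS R n\<^esub> x = x"
      by (auto simp: PS_one PS_const_mult PS_closed)
  qed (simp_all add: PS_mult_closed PS_mult_assoc PS_one PS_const_closed PS_mult_comm[of _ n])
  fix x y z assume xyz: "x \<in> carrier (PS R n)" "y \<in> carrier (PS R n)" "z \<in> carrier (PS R n)"
  have *: "x \<oplus>\<^bsub>PS R n\<^esub> y \<in> carrier (PS R n)" using xyz by (auto simp: PS_def)
  have "(x \<oplus>\<^bsub>PS R n\<^esub> y) \<otimes>\<^bsub>PS R n\<^esub> z = (\<lambda>e. (x \<otimes>\<^bsub>PS R n\<^esub> z) e \<oplus> (y \<otimes>\<^bsub>PS R n\<^esub> z) e)"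
    unfolding PS_mult using xyz
    by (subst finsum_addf[symmetric])
      (auto simp: fun_eq_iff PS_add PS_closed l_distr Pi_def intro!: finsum_cong')
  then show "(x \<oplus>\<^bsub>PS R n\<^esub> y) \<otimes>\<^bsub>PS R n\<^esub> z = x \<otimes>\<^bsub>PS R n\<^esub> z \<oplus>\<^bsub>PS R n\<^esub> y \<otimes>\<^bsub>PS R n\<^esub> z"
    using xyz by (auto simp: PS_add PS_mult_closed fun_eq_iff)
qed

lemma PS_uminus:
  assumes "f \<in> carrier (PS R n)"
  shows "(\<ominus>\<^bsub>PS R n\<^esub> f) e = \<ominus> f e"
proof -
  interpret P: cring "PS R n" by (rule PS_cring)
  have "\<zero> = (f \<oplus>\<^bsub>PS R n\<^esub> (\<ominus>\<^bsub>PS R n\<^esub> f)) e"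
    using assms by (simp add: P.r_neg)
  then show ?thesis using assms
    by (metis P.a_inv_closed PS_add PS_closed a_comm minus_equality)
qed

end

text \<open>The family is kept arbitrary because the construction is applied twice: to the finitely
  generated subalgebras of \<open>R\<close>, and to their images in a residue field.\<close>

definition union_PS :: "('a, 'b) ring_scheme \<Rightarrow> 'a set set \<Rightarrow> nat \<Rightarrow> ((nat \<Rightarrow> nat) \<Rightarrow> 'a) ring" where
  "union_PS R \<A> n = (PS R n)\<lparr>carrier := {f \<in> carrier (PS R n). \<exists>A\<in>\<A>. \<forall>e. f e \<in> A}\<rparr>"

locale directed_subrings = cring R for R (structure) +
  fixes \<A> :: "'a set set" and n :: nat
  assumes subring: "A \<in> \<A> \<Longrightarrow> subring A R"
    and nonempty: "\<A> \<noteq> {}"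
    and directed: "A \<in> \<A> \<Longrightarrow> B \<in> \<A> \<Longrightarrow> \<exists>C\<in>\<A>. A \<union> B \<subseteq> C"
begin

abbreviation "S \<equiv> union_PS R \<A> n"

lemma S_mem_iff: "f \<in> carrier S \<longleftrightarrow> f \<in> carrier (PS R n) \<and> (\<exists>A\<in>\<A>. \<forall>e. f e \<in> A)"
  by (simp add: union_PS_def)

lemma S_memI:
  assumes "A \<in> \<A>" "\<And>e. f e \<in> A" "\<And>e. e \<notin> exps n \<Longrightarrow> f e = \<zero>"
  shows "f \<in> carrier S"
  using assms subringE(1)[OF subring[OF assms(1)]] by (auto simp: S_mem_iff PS_carrier_iff)

lemma S_memE: "f \<in> carrier S \<Longrightarrow> \<exists>A\<in>\<A>. \<forall>e. f e \<in> A"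
  by (auto simp: S_mem_iff)

lemma S_ops: "mult S = mult (PS R n)" "add S = add (PS R n)" "\<one>\<^bsub>S\<^esub> = \<one>\<^bsub>PS R n\<^esub>" "\<zero>\<^bsub>S\<^esub> = (\<lambda>e. \<zero>)"
  by (auto simp: union_PS_def)

lemma directed_finite:
  assumes "finite F" "\<And>x. x \<in> F \<Longrightarrow> \<exists>A\<in>\<A>. P x \<subseteq> A"
  shows "\<exists>A\<in>\<A>. \<forall>x\<in>F. P x \<subseteq> A"
  using assms
proof (induction F)
  case empty
  then show ?case using nonempty by auto
next
  case (insert x F)
  then obtain A B where "A \<in> \<A>" "\<forall>x\<in>F. P x \<subseteq> A" "B \<in> \<A>" "P x \<subseteq> B" by (metis insertI1 insertI2)
  then show ?case using directed[of A B] by (metis Un_subset_iff insertE order_trans)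
qed

lemma finsum_in_subring:
  assumes "subring A R" "\<And>x. x \<in> F \<Longrightarrow> f x \<in> A"
  shows "finsum R f F \<in> A"
  by (rule finsum_in_subgroup) (use assms in \<open>auto intro!: additive_subgroup.intro subring.axioms(1)\<close>)

lemma S_subcring: "subring (carrier S) (PS R n)"
proof -
  interpret P: cring "PS R n" by (rule PS_cring)
  show ?thesis
  proof (rule P.subringI)
    show "carrier S \<subseteq> carrier (PS R n)" by (auto simp: S_mem_iff)
    obtain A where "A \<in> \<A>" using nonempty by auto
    then show "\<one>\<^bsub>PS R n\<^esub> \<in> carrier S"
      using subringE[OF subring] by (intro S_memI[of A]) (auto simp: PS_one PS_const_eval)
    fix f assume f: "f \<in> carrier S"
    then obtain A where A: "A \<in> \<A>" "\<forall>e. f e \<in> A" by (auto simp: S_mem_iff)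
    have fP: "f \<in> carrier (PS R n)" using f by (simp add: S_mem_iff)
    show "\<ominus>\<^bsub>PS R n\<^esub> f \<in> carrier S"
      using A subringE(5)[OF subring[OF A(1)]] PS_outside[OF fP]
      by (intro S_memI[of A]) (auto simp: PS_uminus[OF fP])
    fix g assume g: "g \<in> carrier S"
    then obtain B where B: "B \<in> \<A>" "\<forall>e. g e \<in> B" by (auto simp: S_mem_iff)
    have gP: "g \<in> carrier (PS R n)" using g by (simp add: S_mem_iff)
    obtain C where C: "C \<in> \<A>" "A \<union> B \<subseteq> C" using directed A B by blast
    show "f \<oplus>\<^bsub>PS R n\<^esub> g \<in> carrier S"
      using A(2) B(2) C subringE(7)[OF subring[OF C(1)]] PS_outside[OF fP] PS_outside[OF gP]
      by (intro S_memI[of C]) (auto simp: PS_add[OF fP gP] subset_iff)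
    show "f \<otimes>\<^bsub>PS R n\<^esub> g \<in> carrier S"
      using A(2) B(2) C subringE(6)[OF subring[OF C(1)]]
      by (intro S_memI[of C]) (auto simp: PS_mult exp_pairs_outside subset_iff intro!: finsum_in_subring subring[OF C(1)])
  qed
qed

lemma S_cring: "cring S"
proof -
  interpret P: cring "PS R n" by (rule PS_cring)
  have "S = (PS R n)\<lparr>carrier := carrier S\<rparr>" by (simp add: union_PS_def)
  then show ?thesis
    using P.subcringI'[OF S_subcring] P.subcring_iff[of "carrier S"] subringE(1)[OF S_subcring] by metis
qed

sublocale S: cring S
  by (rule S_cring)

lemma S_closed: "f \<in> carrier S \<Longrightarrow> f e \<in> carrier R"
  by (auto simp: S_mem_iff PS_closed)

lemma S_outside: "f \<in> carrier S \<Longrightarrow> e \<notin> exps n \<Longrightarrow> f e = \<zero>"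
  by (auto simp: S_mem_iff PS_outside)

lemma S_add: "f \<in> carrier S \<Longrightarrow> g \<in> carrier S \<Longrightarrow> (f \<oplus>\<^bsub>S\<^esub> g) e = f e \<oplus> g e"
  by (simp add: S_ops S_mem_iff PS_add)

lemma S_mult: "(f \<otimes>\<^bsub>S\<^esub> g) e = (\<Oplus>p\<in>exp_pairs n e. f (fst p) \<otimes> g (snd p))"
  by (simp add: S_ops PS_mult)

lemma S_uminus: 
  assumes "f \<in> carrier S"
  shows "(\<ominus>\<^bsub>S\<^esub> f) e = \<ominus> f e"
proof -
  have "\<zero> = (f \<oplus>\<^bsub>S\<^esub> (\<ominus>\<^bsub>S\<^esub> f)) e"
    using S.r_neg[OF assms] by (simp add: S_ops(4))
  then show ?thesis using assms
    by (metis S.a_inv_closed S_add S_closed a_comm minus_equality)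
qed

lemma S_minus: "f \<in> carrier S \<Longrightarrow> g \<in> carrier S \<Longrightarrow> (f \<ominus>\<^bsub>S\<^esub> g) e = f e \<ominus> g e"
  by (simp add: S.minus_eq minus_eq S_add S_uminus)

lemma S_finsum:
  assumes "\<And>x. x \<in> F \<Longrightarrow> f x \<in> carrier S"
  shows "(finsum S f F) e = (\<Oplus>x\<in>F. f x e)"
  using assms
proof (induction F rule: infinite_finite_induct)
  case (insert x F)
  then show ?case
    by (subst S.finsum_insert) (auto simp: S_add Pi_def S_closed)
qed (auto simp: S_ops)

lemma const_closed: "A \<in> \<A> \<Longrightarrow> c \<in> A \<Longrightarrow> PS_const R c \<in> carrier S"
  using subringE[OF subring] by (intro S_memI[of A]) (auto simp: PS_const_eval)

lemma const_mult:
  "c \<in> carrier R \<Longrightarrow> f \<in> carrier S \<Longrightarrow> (PS_const R c \<otimes>\<^bsub>S\<^esub> f) e = c \<otimes> f e"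
  by (simp add: S_ops S_mem_iff PS_const_mult)

end

lemma artinian_PS_eq: "artinian_PS R R0 n = union_PS R (fg_subalgebras R R0) n"
  by (simp add: artinian_PS_def union_PS_def)

subsection \<open>A multiplicative order on exponents\<close>

text \<open>Ordering the exponents \<open>e\<close> by the natural number \<open>\<Prod> p\<^sub>i ^ e\<^sub>i\<close>, with \<open>p\<^sub>i\<close> the \<open>i\<close>-th prime, is a
  monomial order of type \<open>\<omega>\<close>: unique factorisation makes it total.\<close>

definition expnum :: "nat \<Rightarrow> (nat \<Rightarrow> nat) \<Rightarrow> nat" where
  "expnum n e = (\<Prod>i<n. enumerate {p. Factorial_Ring.prime p} i ^ e i)"

lemma prime_enumerate: "Factorial_Ring.prime (enumerate {p::nat. Factorial_Ring.prime p} i)"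
  using enumerate_in_set[OF primes_infinite] by simp

lemma expnum_0 [simp]: "expnum n 0 = 1"
  by (simp add: expnum_def)

lemma expnum_add: "expnum n (a + b) = expnum n a * expnum n b"
  by (simp add: expnum_def power_add prod.distrib)

lemma expnum_pos [simp]: "0 < expnum n e"
  using prime_gt_0_nat[OF prime_enumerate] by (auto simp: expnum_def intro!: prod_pos)

lemma expnum_mono: "a \<le> b \<Longrightarrow> expnum n a \<le> expnum n b"
  using prime_gt_0_nat[OF prime_enumerate]
  by (auto simp: expnum_def le_fun_def intro!: prod_mono power_increasing Suc_leI)

lemma multiplicity_expnum:
  assumes "i < n"
  shows "multiplicity (enumerate {p. Factorial_Ring.prime p} i) (expnum n e) = e i"
proof -
  let ?p = "enumerate {p::nat. Factorial_Ring.prime p}"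
  have inj: "inj_on ?p A" for A
    using strict_mono_enumerate[OF primes_infinite] by (meson inj_on_subset strict_mono_imp_inj_on subset_UNIV)
  have "expnum n e = (\<Prod>q\<in>?p ` {..<n}. q ^ e (the_inv_into {..<n} ?p q))"
    unfolding expnum_def by (subst prod.reindex) (auto simp: inj the_inv_into_f_f)
  also have "multiplicity (?p i) \<dots> = e (the_inv_into {..<n} ?p (?p i))"
    using assms by (subst multiplicity_prod_prime_powers) (auto simp: prime_enumerate)
  also have "\<dots> = e i"
    using assms by (simp add: inj the_inv_into_f_f)
  finally show ?thesis .
qed

lemma expnum_inj:
  assumes "a \<in> exps n" "b \<in> exps n" "expnum n a = expnum n b"
  shows "a = b"
proof
  fix i show "a i = b i"
    using multiplicity_expnum[of i n a] multiplicity_expnum[of i n b] assms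
    by (cases "i < n") (auto simp: exps_def)
qed

text \<open>All primes are at least 2, so each single exponent is bounded by the binary logarithm of
  the size. This is why the cut-off \<open>2 ^ t\<close> fits into a box of side \<open>t\<close>,
  which yields the polynomial bound \<open>t ^ n\<close>.\<close>

lemma expnum_less_imp:
  assumes "expnum n e < 2 ^ t" "i < n"
  shows "e i < t"
proof -
  let ?p = "enumerate {p::nat. Factorial_Ring.prime p}"
  have "2 ^ e i \<le> ?p i ^ e i"
    by (intro power_mono prime_ge_2_nat prime_enumerate) auto
  also have "\<dots> \<le> expnum n e"
    using assms(2) prime_gt_0_nat[OF prime_enumerate] unfolding expnum_def
    by (intro dvd_imp_le dvd_prodI) (auto intro!: prod_pos)
  also note assms(1)
  finally show ?thesis by simp
qed

lemma finite_expnum_less: "finite {e \<in> exps n. expnum n e < 2 ^ t}"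
  by (rule finite_subset[OF _ finite_exps_bounded[of n t]]) (auto dest: expnum_less_imp)

lemma card_expnum_less: "card {e \<in> exps n. expnum n e < 2 ^ t} \<le> t ^ n"
proof -
  have "card {e \<in> exps n. expnum n e < 2 ^ t} \<le> card {e \<in> exps n. \<forall>i<n. e i < t}"
    by (intro card_mono finite_exps_bounded) (auto dest: expnum_less_imp)
  then show ?thesis using card_exps_bounded[of n t] by simp
qed

subsection \<open>Dickson's lemma\<close>

text \<open>Every sequence has a monotone subsequence, and a decreasing one of natural numbers is
  constant from the place \<open>N\<close> of its least value on.\<close>

lemma nat_seq_incseq_subseq:
  fixes s :: "nat \<Rightarrow> nat"
  obtains \<phi> :: "nat \<Rightarrow> nat" where "strict_mono \<phi>" "incseq (\<lambda>k. s (\<phi> k))"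
proof -
  obtain \<phi> :: "nat \<Rightarrow> nat" where \<phi>: "strict_mono \<phi>" "monoseq (\<lambda>k. s (\<phi> k))"
    using seq_monosub by metis
  consider "incseq (\<lambda>k. s (\<phi> k))" | "decseq (\<lambda>k. s (\<phi> k))"
    using \<phi>(2) by (auto simp: monoseq_iff)
  then show ?thesis
  proof cases
    case 2
    define N where "N = (ARG_MIN (\<lambda>k. s (\<phi> k)) k. True)"
    have "s (\<phi> N) \<le> s (\<phi> k)" for k
      unfolding N_def by (rule arg_min_nat_le) simp
    then have "s (\<phi> (k + N)) = s (\<phi> N)" for k
      using decseqD[OF 2, of N "k + N"] by (intro antisym) auto
    then show ?thesis
      using \<phi>(1) by (intro that[of "\<lambda>k. \<phi> (k + N)"]) (auto simp: strict_mono_def incseq_def)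
  qed (use \<phi> that in auto)
qed

lemma nat_fun_seq_incseq_subseq:
  fixes s :: "nat \<Rightarrow> nat \<Rightarrow> nat"
  shows "\<exists>\<phi>. strict_mono \<phi> \<and> (\<forall>i<n. incseq (\<lambda>k. s (\<phi> k) i))"
proof (induction n)
  case 0
  then show ?case by (auto intro: exI[of _ id] simp: strict_mono_def)
next
  case (Suc n)
  then obtain \<phi> :: "nat \<Rightarrow> nat" where \<phi>: "strict_mono \<phi>" "\<forall>i<n. incseq (\<lambda>k. s (\<phi> k) i)" by auto
  obtain \<psi> :: "nat \<Rightarrow> nat" where \<psi>: "strict_mono \<psi>" "incseq (\<lambda>k. s (\<phi> (\<psi> k)) n)"
    by (rule nat_seq_incseq_subseq[of "\<lambda>k. s (\<phi> k) n"])
  have "incseq (\<lambda>k. s (\<phi> (\<psi> k)) i)" if "i < Suc n" for i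
    using that \<phi>(2) \<psi> by (cases "i = n") (auto simp: incseq_def strict_mono_less_eq)
  then show ?case
    using \<phi>(1) \<psi>(1) by (intro exI[of _ "\<phi> \<circ> \<psi>"]) (auto simp: strict_mono_def)
qed

text \<open>\<open>B\<close> consists of the minimal elements of \<open>A\<close>. If it were
  infinite, an injective sequence in it would have a subsequence that is nondecreasing in every
  coordinate, hence two distinct comparable minimal elements. Below a given \<open>a\<close>, an
  element of least \<open>expnum\<close> is minimal, since \<open>expnum\<close> is monotone and
  injective.\<close>

lemma Dickson:
  assumes "A \<subseteq> exps n"
  obtains B where "finite B" "B \<subseteq> A" "\<And>a. a \<in> A \<Longrightarrow> \<exists>b\<in>B. b \<le> a"
proof -
  define B where "B = {b \<in> A. \<forall>a\<in>A. a \<le> b \<longrightarrow> a = b}"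
  have "finite B"
  proof (rule ccontr)
    assume "infinite B"
    then obtain s :: "nat \<Rightarrow> nat \<Rightarrow> nat" where s: "inj s" "range s \<subseteq> B"
      using infinite_countable_subset by blast
    obtain \<phi> :: "nat \<Rightarrow> nat" where \<phi>: "strict_mono \<phi>" "\<forall>i<n. incseq (\<lambda>k. s (\<phi> k) i)"
      using nat_fun_seq_incseq_subseq by blast
    have mem: "s k \<in> B" "s k \<in> exps n" for k
      using s(2) assms by (auto simp: B_def)
    have "s (\<phi> 0) i \<le> s (\<phi> 1) i" for i
      using \<phi>(2) mem(2) by (cases "i < n") (auto simp: exps_def incseq_def)
    then have "s (\<phi> 0) \<le> s (\<phi> 1)" by (simp add: le_fun_def)
    moreover have "s (\<phi> 0) \<in> A" "\<forall>a\<in>A. a \<le> s (\<phi> 1) \<longrightarrow> a = s (\<phi> 1)"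
      using mem(1)[of "\<phi> 0"] mem(1)[of "\<phi> 1"] unfolding B_def by blast+
    ultimately have "s (\<phi> 0) = s (\<phi> 1)" by blast
    then have "\<phi> 0 = \<phi> 1" by (rule injD[OF s(1)])
    moreover have "\<phi> 0 < \<phi> 1" using \<phi>(1) by (auto simp: strict_mono_def)
    ultimately show False by linarith
  qed
  moreover have "\<exists>b\<in>B. b \<le> a" if a: "a \<in> A" for a
  proof -
    define b where "b = arg_min (expnum n) (\<lambda>b. b \<in> A \<and> b \<le> a)"
    have b: "b \<in> A \<and> b \<le> a"
      unfolding b_def by (rule arg_min_natI[of "\<lambda>b. b \<in> A \<and> b \<le> a"]) (use a in auto)
    have "c = b" if "c \<in> A" "c \<le> b" for c
    proof -
      have "expnum n b \<le> expnum n c"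
        unfolding b_def using that b
        by (intro arg_min_nat_le[where P = "\<lambda>b. b \<in> A \<and> b \<le> a"] conjI order_trans[of c b a]) auto
      with expnum_mono[OF that(2)] have "expnum n c = expnum n b" by (rule antisym)
      then show ?thesis
        using that b assms by (intro expnum_inj[of c n b]) auto
    qed
    then have "b \<in> B" using b by (simp add: B_def)
    then show ?thesis using b by blast
  qed
  moreover have "B \<subseteq> A" by (auto simp: B_def)
  ultimately show ?thesis using that by blast
qed

subsection \<open>Division of power series over a directed family of fields\<close>

text \<open>Closure under inverses lets division normalise leading coefficients inside one member;
  \<open>covering\<close> makes every field element available as a constant series.\<close>

locale directed_subfields = directed_subrings + field R +
  assumes inv_closed: "A \<in> \<A> \<Longrightarrow> x \<in> A \<Longrightarrow> x \<noteq> \<zero> \<Longrightarrow> inv x \<in> A"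
    and covering: "x \<in> carrier R \<Longrightarrow> \<exists>A\<in>\<A>. x \<in> A"
begin

text \<open>The leading exponent for a local order: the smallest exponent that occurs. For the zero
  series the value is unspecified, so uses of it carry a nonzero condition.\<close>

definition lexp :: "((nat \<Rightarrow> nat) \<Rightarrow> 'a) \<Rightarrow> nat \<Rightarrow> nat" where
  "lexp f = arg_min (expnum n) (\<lambda>e. f e \<noteq> \<zero>)"

lemma S_nonzeroE: "f \<in> carrier S \<Longrightarrow> f \<noteq> \<zero>\<^bsub>S\<^esub> \<Longrightarrow> \<exists>e. f e \<noteq> \<zero>"
  by (auto simp: S_ops fun_eq_iff)

lemma lexp_nonzero: "f \<in> carrier S \<Longrightarrow> f \<noteq> \<zero>\<^bsub>S\<^esub> \<Longrightarrow> f (lexp f) \<noteq> \<zero>"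
  using S_nonzeroE[of f] unfolding lexp_def by (metis (mono_tags, lifting) arg_min_natI)

lemma lexp_exps: "f \<in> carrier S \<Longrightarrow> f \<noteq> \<zero>\<^bsub>S\<^esub> \<Longrightarrow> lexp f \<in> exps n"
  using lexp_nonzero S_outside by blast

lemma lexp_le: "f e \<noteq> \<zero> \<Longrightarrow> expnum n (lexp f) \<le> expnum n e"
  unfolding lexp_def using arg_min_nat_le[of "\<lambda>e. f e \<noteq> \<zero>" e "expnum n"] by simp

lemma lexp_eqI:
  assumes "f \<in> carrier S" "f e \<noteq> \<zero>" "\<And>e'. expnum n e' < expnum n e \<Longrightarrow> f e' = \<zero>"
  shows "lexp f = e"
proof -
  have nz: "f \<noteq> \<zero>\<^bsub>S\<^esub>" using assms(2) by (auto simp: S_ops)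
  have "e \<in> exps n" using assms(1,2) S_outside by blast
  moreover have "expnum n (lexp f) = expnum n e"
    using lexp_le[of f e] assms(2,3) lexp_nonzero[OF assms(1) nz] by (meson leD leI le_antisym)
  ultimately show ?thesis using lexp_exps[OF assms(1) nz] expnum_inj by blast
qed

definition vanishing :: "nat \<Rightarrow> ((nat \<Rightarrow> nat) \<Rightarrow> 'a) \<Rightarrow> bool" where
  "vanishing T f \<longleftrightarrow> (\<forall>e. expnum n e < T \<longrightarrow> f e = \<zero>)"

lemma vanishing_mult:
  assumes "vanishing T f" "f \<in> carrier S" "g \<in> carrier S"
  shows "vanishing T (f \<otimes>\<^bsub>S\<^esub> g)"
  unfolding vanishing_def
proof (intro allI impI)
  fix e assume e: "expnum n e < T"
  have "f (fst p) = \<zero>" if "p \<in> exp_pairs n e" for p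
  proof -
    have "fst p \<le> e" using that by (auto simp: exp_pairs_def)
    then have "expnum n (fst p) < T" using e expnum_mono[of "fst p" e n] by simp
    then show ?thesis using assms(1) by (simp add: vanishing_def)
  qed
  then show "(f \<otimes>\<^bsub>S\<^esub> g) e = \<zero>"
    using assms unfolding S_mult by (intro add.finprod_one_eqI) (auto simp: S_closed)
qed

lemma vanishing_finsum:
  "(\<And>x. x \<in> F \<Longrightarrow> vanishing T (f x)) \<Longrightarrow> (\<And>x. x \<in> F \<Longrightarrow> f x \<in> carrier S) \<Longrightarrow> vanishing T (finsum S f F)"
  by (auto simp: vanishing_def S_finsum intro!: add.finprod_one_eqI)

context
  fixes G :: "((nat \<Rightarrow> nat) \<Rightarrow> 'a) set" and h
  assumes G: "finite G" "G \<subseteq> carrier S - {\<zero>\<^bsub>S\<^esub>}" and h: "h \<in> carrier S"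
begin

private definition red where "red e \<longleftrightarrow> (\<exists>g\<in>G. lexp g \<le> e)"

private definition pick where "pick e = (SOME g. g \<in> G \<and> lexp g \<le> e)"

text \<open>A single array \<open>c\<close> on the reducible exponents encodes all quotients at
  once: its entry at \<open>e\<close> is the coefficient of \<open>e - lexp (pick e)\<close> in the
  quotient belonging to \<open>pick e\<close>.\<close>

private definition quo where
  "quo c g d = (if d \<in> exps n \<and> pick (d + lexp g) = g then c (d + lexp g) else \<zero>)"

text \<open>Makes explicit that the recursion looks only at strictly smaller sizes; the
  \<open>cut\<close> inserted by \<open>wfrec\<close> then has no effect.\<close>

private definition trunc where "trunc c e e' = (if expnum n e' < expnum n e then c e' else \<zero>)"

text \<open>Comparing \<open>h\<close> with the sum of quotients times divisors at a reducible
  \<open>e\<close> gives a triangular system: the unknown at \<open>e\<close> is multiplied by the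
  leading coefficient of \<open>pick e\<close>, and all other unknowns involved have smaller size.
  The recursion solves this system.\<close>

private definition coef :: "(nat \<Rightarrow> nat) \<Rightarrow> 'a" where
  "coef = wfrec (measure (expnum n)) (\<lambda>c e. if e \<in> exps n \<and> red e
     then inv (pick e (lexp (pick e))) \<otimes> (h e \<ominus> (\<Oplus>g\<in>G. (quo (trunc c e) g \<otimes>\<^bsub>S\<^esub> g) e)) else \<zero>)"

private lemma coef_eq:
  "coef e = (if e \<in> exps n \<and> red e
     then inv (pick e (lexp (pick e))) \<otimes> (h e \<ominus> (\<Oplus>g\<in>G. (quo (trunc coef e) g \<otimes>\<^bsub>S\<^esub> g) e)) else \<zero>)"
proof -
  have "trunc (cut coef (measure (expnum n)) e) e = trunc coef e"
    by (auto simp: fun_eq_iff trunc_def cut_def)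
  then show ?thesis
    unfolding coef_def by (subst wfrec[OF wf_measure]) (simp add: coef_def[symmetric])
qed

private lemma pickD: "red e \<Longrightarrow> pick e \<in> G \<and> lexp (pick e) \<le> e"
  unfolding red_def pick_def by (rule someI_ex[of "\<lambda>g. g \<in> G \<and> lexp g \<le> e"]) blast

private lemma coef_in:
  assumes "L \<in> \<A>" "\<And>e. h e \<in> L" "\<And>g e. g \<in> G \<Longrightarrow> g e \<in> L"
  shows "coef e \<in> L"
proof (induction e rule: measure_induct_rule[of "expnum n"])
  case (less e)
  note sub = subringE[OF subring[OF assms(1)]]
  have "quo (trunc coef e) g d \<in> L" for g d
    using less sub by (auto simp: quo_def trunc_def)
  then have "(\<Oplus>g\<in>G. (quo (trunc coef e) g \<otimes>\<^bsub>S\<^esub> g) e) \<in> L"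
    using assms sub unfolding S_mult by (intro finsum_in_subring subring) auto
  moreover have "inv (pick e (lexp (pick e))) \<in> L" if "red e"
    using pickD[OF that] G(2) assms lexp_nonzero[of "pick e"] by (intro inv_closed) auto
  ultimately show ?case
    using sub assms by (subst coef_eq) (auto simp: minus_eq)
qed

text \<open>Isolates the only term of the Cauchy product in which the unknown at \<open>e\<close>
  can occur. If \<open>a + b = e\<close> and \<open>g b\<close> is nonzero, then either
  \<open>b = lexp g\<close>, or \<open>b\<close> is larger than \<open>lexp g\<close>; in the second
  case \<open>a + lexp g\<close> is smaller than \<open>e\<close> and the truncation is not
  noticed.\<close>

private lemma quo_mult:
  assumes c: "\<And>e. coef e \<in> carrier R" and g: "g \<in> G" and e: "e \<in> exps n" "red e"
  shows "(quo coef g \<otimes>\<^bsub>S\<^esub> g) e =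
    (quo (trunc coef e) g \<otimes>\<^bsub>S\<^esub> g) e \<oplus> (if g = pick e then coef e \<otimes> pick e (lexp (pick e)) else \<zero>)"
proof -
  let ?t = "\<lambda>p. if p = (e - lexp g, lexp g) then (if g = pick e then coef e \<otimes> g (lexp g) else \<zero>) else \<zero>"
  have gS: "g \<in> carrier S" "g \<noteq> \<zero>\<^bsub>S\<^esub>" using g G by auto
  have closed: "quo coef g a \<in> carrier R" "quo (trunc coef e) g a \<in> carrier R" "g a \<in> carrier R" for a
    using c gS by (auto simp: quo_def trunc_def S_closed)
  have "quo coef g a \<otimes> g b = quo (trunc coef e) g a \<otimes> g b \<oplus> ?t (a, b)" if ab: "(a, b) \<in> exp_pairs n e" for a b
  proof -
    have e_eq: "e = a + b" and ab': "a \<in> exps n" "b \<in> exps n" using ab by (auto simp: exp_pairs_def)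
    consider "b = lexp g" | "b \<noteq> lexp g" "g b = \<zero>" | "b \<noteq> lexp g" "g b \<noteq> \<zero>" by auto
    then show ?thesis
    proof cases
      case 1
      then show ?thesis using c ab' closed by (auto simp: quo_def trunc_def e_eq)
    next
      case 2
      then show ?thesis using closed by auto
    next
      case 3
      then have "expnum n (lexp g) < expnum n b"
        using lexp_le[of g b] expnum_inj[OF ab'(2) lexp_exps[OF gS]] by fastforce
      then have "quo (trunc coef e) g a = quo coef g a"
        by (auto simp: quo_def trunc_def e_eq expnum_add)
      then show ?thesis using 3 closed by auto
    qed
  qed
  then have "(quo coef g \<otimes>\<^bsub>S\<^esub> g) e
      = (\<Oplus>p\<in>exp_pairs n e. quo (trunc coef e) g (fst p) \<otimes> g (snd p) \<oplus> ?t p)"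
    unfolding S_mult using c closed by (intro finsum_cong') auto
  also have "\<dots> = (quo (trunc coef e) g \<otimes>\<^bsub>S\<^esub> g) e \<oplus> (\<Oplus>p\<in>exp_pairs n e. ?t p)"
    unfolding S_mult using c closed by (intro finsum_addf) auto
  also have "(\<Oplus>p\<in>exp_pairs n e. ?t p) = (if g = pick e then coef e \<otimes> g (lexp g) else \<zero>)"
  proof (cases "g = pick e")
    case True
    then have "lexp g \<le> e" using pickD[OF e(2)] by simp
    then have "(e - lexp g, lexp g) \<in> exp_pairs n e"
      using e(1) lexp_exps[OF gS] by (auto simp: exp_pairs_def exps_diff le_fun_def)
    then show ?thesis using True c closed
      by (subst add.finprod_singleton_swap[where f = "\<lambda>_. if g = pick e then coef e \<otimes> g (lexp g) else \<zero>"]) auto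
  qed (auto intro: add.finprod_one_eqI)
  finally show ?thesis by (auto split: if_splits)
qed

text \<open>The last clause is the quantitative part needed later for the Artin-Rees estimate:
  quotients lose order of vanishing only by the size of the leading exponent of their
  divisor.\<close>

lemma division:
  "\<exists>q r. (\<forall>g\<in>G. q g \<in> carrier S) \<and> r \<in> carrier S \<and> h = (\<Oplus>\<^bsub>S\<^esub>g\<in>G. q g \<otimes>\<^bsub>S\<^esub> g) \<oplus>\<^bsub>S\<^esub> r \<and>
    (\<forall>g\<in>G. \<forall>e. lexp g \<le> e \<longrightarrow> r e = \<zero>) \<and>
    (\<forall>T. vanishing T h \<longrightarrow> (\<forall>g\<in>G. \<forall>e. expnum n e * expnum n (lexp g) < T \<longrightarrow> q g e = \<zero>))"
proof -
  \<comment> \<open>One member \<open>L\<close> contains all coefficients of \<open>h\<close> and of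
    the divisors; the recursion then stays in \<open>L\<close>, so quotients and remainder are again
    elements of \<open>S\<close>.\<close>
  have "\<exists>L\<in>\<A>. \<forall>f\<in>insert h G. range f \<subseteq> L"
  proof (rule directed_finite)
    fix f assume "f \<in> insert h G"
    then have "f \<in> carrier S" using G h by auto
    from S_memE[OF this] show "\<exists>A\<in>\<A>. range f \<subseteq> A" by (metis image_subset_iff)
  qed (use G in simp)
  then obtain L where L: "L \<in> \<A>" "\<And>e. h e \<in> L" "\<And>g e. g \<in> G \<Longrightarrow> g e \<in> L" by blast
  have c: "coef e \<in> L" for e by (rule coef_in[of L]) (simp_all add: L)
  have cR: "coef e \<in> carrier R" for e using c L(1) subringE(1)[OF subring] by blast
  have q: "quo coef g \<in> carrier S" for g
    using c subringE(2)[OF subring[OF L(1)]] by (intro S_memI[OF L(1)]) (auto simp: quo_def)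
  define s where "s = (\<Oplus>\<^bsub>S\<^esub>g\<in>G. quo coef g \<otimes>\<^bsub>S\<^esub> g)"
  have s: "s \<in> carrier S" unfolding s_def using q G by (intro S.finsum_closed) auto
  have GS: "g \<in> carrier S" if "g \<in> G" for g using that G by auto
  have eq: "s e = h e" if e: "e \<in> exps n" "red e" for e
  proof -
    define g0 where "g0 = pick e"
    have g0: "g0 \<in> G" "g0 (lexp g0) \<noteq> \<zero>" "g0 (lexp g0) \<in> carrier R"
      using pickD[OF e(2)] G lexp_nonzero[of g0] by (auto simp: g0_def S_closed)
    define u where "u = (\<Oplus>g\<in>G. (quo (trunc coef e) g \<otimes>\<^bsub>S\<^esub> g) e)"
    have tr: "(quo (trunc coef e) g \<otimes>\<^bsub>S\<^esub> g) e \<in> carrier R" if "g \<in> G" for g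
      unfolding S_mult using cR GS[OF that] by (intro finsum_closed) (auto simp: quo_def trunc_def S_closed)
    then have u: "u \<in> carrier R" unfolding u_def by (intro finsum_closed) auto
    have "s e = (\<Oplus>g\<in>G. (quo coef g \<otimes>\<^bsub>S\<^esub> g) e)"
      unfolding s_def using q GS by (intro S_finsum) auto
    also have "\<dots> = (\<Oplus>g\<in>G. (quo (trunc coef e) g \<otimes>\<^bsub>S\<^esub> g) e
        \<oplus> (if g = g0 then coef e \<otimes> g0 (lexp g0) else \<zero>))"
    proof (rule finsum_cong')
      show "(\<lambda>g. (quo (trunc coef e) g \<otimes>\<^bsub>S\<^esub> g) e \<oplus> (if g = g0 then coef e \<otimes> g0 (lexp g0) else \<zero>))
        \<in> G \<rightarrow> carrier R"
        using tr cR g0 by auto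
    qed (use quo_mult[OF cR _ e] in \<open>simp_all add: g0_def\<close>)
    also have "\<dots> = u \<oplus> (\<Oplus>g\<in>G. (if g = g0 then coef e \<otimes> g0 (lexp g0) else \<zero>))"
      unfolding u_def using tr cR g0 by (intro finsum_addf) auto
    also have "(\<Oplus>g\<in>G. (if g = g0 then coef e \<otimes> g0 (lexp g0) else \<zero>)) = coef e \<otimes> g0 (lexp g0)"
      using cR g0 G(1) by (intro add.finprod_singleton_swap[where f = "\<lambda>_. coef e \<otimes> g0 (lexp g0)"]) auto
    also have "coef e = inv (g0 (lexp g0)) \<otimes> (h e \<ominus> u)"
      using e by (subst coef_eq) (simp add: g0_def u_def)
    also have "inv (g0 (lexp g0)) \<otimes> (h e \<ominus> u) \<otimes> g0 (lexp g0) = h e \<ominus> u"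
    proof -
      have U: "g0 (lexp g0) \<in> Units R" using g0 by (simp add: field_Units)
      have hu: "h e \<ominus> u \<in> carrier R" using u h by (simp add: S_closed)
      have "inv (g0 (lexp g0)) \<otimes> (h e \<ominus> u) \<otimes> g0 (lexp g0) = (h e \<ominus> u) \<otimes> (inv (g0 (lexp g0)) \<otimes> g0 (lexp g0))"
        using U hu g0(3) by (simp add: m_ac)
      then show ?thesis using U hu by simp
    qed
    also have "u \<oplus> (h e \<ominus> u) = h e"
      using u S_closed[OF h] by (simp add: minus_eq a_lcomm[of u "h e"] r_neg)
    finally show ?thesis .
  qed
  show ?thesis
  proof (intro exI[of _ "quo coef"] exI[of _ "h \<ominus>\<^bsub>S\<^esub> s"] conjI allI ballI impI)
    show "h = (\<Oplus>\<^bsub>S\<^esub>g\<in>G. quo coef g \<otimes>\<^bsub>S\<^esub> g) \<oplus>\<^bsub>S\<^esub> (h \<ominus>\<^bsub>S\<^esub> s)"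
      unfolding s_def[symmetric] using s h by (simp add: S.minus_eq S.a_lcomm S.r_neg)
    show "(h \<ominus>\<^bsub>S\<^esub> s) e = \<zero>" if "g \<in> G" "lexp g \<le> e" for g e
    proof (cases "e \<in> exps n")
      case True
      then have "s e = h e" using eq[of e] that by (auto simp: red_def)
      then show ?thesis using S_closed[OF h] by (simp add: S_minus[OF h s])
    next
      case False
      then show ?thesis using s h by (auto simp: S_outside)
    qed
    fix g e T assume T: "vanishing T h" "g \<in> G" "expnum n e * expnum n (lexp g) < T"
    \<comment> \<open>Below the order of vanishing of \<open>h\<close> the recursion subtracts zero
      from zero at every exponent.\<close>
    have "coef e = \<zero>" if "expnum n e < T" for e
      using that
    proof (induction e rule: measure_induct_rule[of "expnum n"])
      case (less e)
      have q0: "quo (trunc coef e) g = (\<lambda>_. \<zero>)" for g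
        using less by (auto simp: quo_def trunc_def fun_eq_iff)
      have "(\<Oplus>g\<in>G. (quo (trunc coef e) g \<otimes>\<^bsub>S\<^esub> g) e) = \<zero>"
        unfolding S_mult q0 using GS by (intro add.finprod_one_eqI) (auto simp: S_closed)
      moreover have "inv (pick e (lexp (pick e))) \<in> carrier R" if "red e"
        using pickD[OF that] GS G(2) lexp_nonzero[of "pick e"]
        by (intro Units_inv_closed) (auto simp: field_Units S_closed)
      moreover have "h e = \<zero>" using T(1) less(2) by (simp add: vanishing_def)
      ultimately show ?case by (subst coef_eq) (auto simp: minus_eq)
    qed
    then show "quo coef g e = \<zero>" using T(3) by (simp add: quo_def expnum_add)
  qed (use q s h in auto)
qed

end

end

subsection \<open>Noetherianity and locality\<close>

lemma (in ideal) finsum_mem: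
  assumes "\<And>x. x \<in> A \<Longrightarrow> f x \<in> I"
  shows "finsum R f A \<in> I"
  using is_additive_subgroup assms by (rule finsum_in_subgroup)

context directed_subfields
begin

definition LE :: "((nat \<Rightarrow> nat) \<Rightarrow> 'a) set \<Rightarrow> (nat \<Rightarrow> nat) set" where
  "LE I = lexp ` (I - {\<zero>\<^bsub>S\<^esub>})"

definition mono_PS :: "(nat \<Rightarrow> nat) \<Rightarrow> (nat \<Rightarrow> nat) \<Rightarrow> 'a" where
  "mono_PS d = (\<lambda>e. if e = d then \<one> else \<zero>)"

lemma mono_PS_closed: "d \<in> exps n \<Longrightarrow> mono_PS d \<in> carrier S"
proof -
  assume d: "d \<in> exps n"
  obtain A where "A \<in> \<A>" using nonempty by auto
  then show ?thesis
    using d subringE(2,3)[OF subring[of A]] by (intro S_memI[of A]) (auto simp: mono_PS_def)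
qed

lemma mono_PS_nonzero: "mono_PS d \<noteq> \<zero>\<^bsub>S\<^esub>"
  by (auto simp: mono_PS_def S_ops fun_eq_iff)

lemma lexp_mono_PS: "d \<in> exps n \<Longrightarrow> lexp (mono_PS d) = d"
  by (rule lexp_eqI) (auto simp: mono_PS_def mono_PS_closed[unfolded mono_PS_def])

lemma ex_standard_basis:
  assumes "ideal I S"
  obtains G where "finite G" "G \<subseteq> I - {\<zero>\<^bsub>S\<^esub>}" "\<And>e. e \<in> LE I \<Longrightarrow> \<exists>g\<in>G. lexp g \<le> e"
proof -
  interpret I: ideal I S by fact
  have "LE I \<subseteq> exps n"
    by (auto simp: LE_def intro!: lexp_exps I.Icarr)
  then obtain B where B: "finite B" "B \<subseteq> LE I" "\<And>e. e \<in> LE I \<Longrightarrow> \<exists>b\<in>B. b \<le> e"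
    by (rule Dickson) blast
  then obtain G where G: "G \<subseteq> I - {\<zero>\<^bsub>S\<^esub>}" "finite G" "B = lexp ` G"
    unfolding LE_def by (meson finite_subset_image)
  show ?thesis
    by (rule that[of G]) (use G B in auto)
qed

text \<open>The remainder is itself in \<open>I\<close>. Were it nonzero, its leading exponent would
  be a multiple of some \<open>lexp g\<close>, where the remainder has coefficient zero.\<close>

lemma standard_basis_division:
  assumes "ideal I S" "finite G" "G \<subseteq> I - {\<zero>\<^bsub>S\<^esub>}" "\<And>e. e \<in> LE I \<Longrightarrow> \<exists>g\<in>G. lexp g \<le> e" "h \<in> I"
  shows "\<exists>q. (\<forall>g\<in>G. q g \<in> carrier S) \<and> h = (\<Oplus>\<^bsub>S\<^esub>g\<in>G. q g \<otimes>\<^bsub>S\<^esub> g) \<and>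
    (\<forall>T. vanishing T h \<longrightarrow> (\<forall>g\<in>G. \<forall>e. expnum n e * expnum n (lexp g) < T \<longrightarrow> q g e = \<zero>))"
proof -
  interpret I: ideal I S by fact
  have "G \<subseteq> carrier S - {\<zero>\<^bsub>S\<^esub>}" using assms(3) I.Icarr by auto
  then obtain q r where q: "\<forall>g\<in>G. q g \<in> carrier S" and r: "r \<in> carrier S"
    and h: "h = (\<Oplus>\<^bsub>S\<^esub>g\<in>G. q g \<otimes>\<^bsub>S\<^esub> g) \<oplus>\<^bsub>S\<^esub> r"
    and r0: "\<forall>g\<in>G. \<forall>e. lexp g \<le> e \<longrightarrow> r e = \<zero>"
    and v: "\<forall>T. vanishing T h \<longrightarrow> (\<forall>g\<in>G. \<forall>e. expnum n e * expnum n (lexp g) < T \<longrightarrow> q g e = \<zero>)"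
    using division[OF assms(2) _ I.Icarr[OF assms(5)]] by blast
  let ?s = "\<Oplus>\<^bsub>S\<^esub>g\<in>G. q g \<otimes>\<^bsub>S\<^esub> g"
  have s: "?s \<in> I" using q assms(3) by (intro I.finsum_mem I.I_l_closed) auto
  have "r = \<ominus>\<^bsub>S\<^esub> ?s \<oplus>\<^bsub>S\<^esub> h" using r I.Icarr[OF s] by (simp add: h S.r_neg1)
  then have "r \<in> I" using s assms(5) by simp
  have "r = \<zero>\<^bsub>S\<^esub>"
  proof (rule ccontr)
    assume "r \<noteq> \<zero>\<^bsub>S\<^esub>"
    then obtain g where "g \<in> G" "lexp g \<le> lexp r"
      using assms(4)[of "lexp r"] \<open>r \<in> I\<close> by (auto simp: LE_def)
    then show False using r0 lexp_nonzero[OF r \<open>r \<noteq> _\<close>] by blast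
  qed
  then have "h = ?s" using h I.Icarr[OF s] by simp
  then show ?thesis using q v by blast
qed

text \<open>Division by a standard basis removes every exponent of \<open>LE I\<close> from the
  remainder, not just the leading one. Remainders thus have coordinates on the standard exponents,
  which makes linear algebra modulo \<open>I\<close> possible.\<close>

lemma normal_form:
  assumes "ideal I S" "h \<in> carrier S"
  obtains p r where "p \<in> I" "r \<in> carrier S" "h = p \<oplus>\<^bsub>S\<^esub> r" "\<And>e. e \<in> LE I \<Longrightarrow> r e = \<zero>"
proof -
  interpret I: ideal I S by fact
  obtain G where G: "finite G" "G \<subseteq> I - {\<zero>\<^bsub>S\<^esub>}" "\<And>e. e \<in> LE I \<Longrightarrow> \<exists>g\<in>G. lexp g \<le> e"
    using ex_standard_basis[OF assms(1)] by blast
  have "G \<subseteq> carrier S - {\<zero>\<^bsub>S\<^esub>}" using G I.Icarr by auto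
  then obtain q r where q: "\<forall>g\<in>G. q g \<in> carrier S" and r: "r \<in> carrier S"
    and h: "h = (\<Oplus>\<^bsub>S\<^esub>g\<in>G. q g \<otimes>\<^bsub>S\<^esub> g) \<oplus>\<^bsub>S\<^esub> r"
    and r0: "\<forall>g\<in>G. \<forall>e. lexp g \<le> e \<longrightarrow> r e = \<zero>"
    using division[OF G(1) _ assms(2)] by blast
  show ?thesis
  proof (rule that[OF _ r h])
    show "(\<Oplus>\<^bsub>S\<^esub>g\<in>G. q g \<otimes>\<^bsub>S\<^esub> g) \<in> I"
      using q G by (intro I.finsum_mem I.I_l_closed) auto
  qed (use r0 G(3) in blast)
qed

lemma standard_basis_generates:
  assumes "ideal I S" "finite G" "G \<subseteq> I - {\<zero>\<^bsub>S\<^esub>}" "\<And>e. e \<in> LE I \<Longrightarrow> \<exists>g\<in>G. lexp g \<le> e"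
  shows "I = Idl\<^bsub>S\<^esub> G"
proof -
  interpret I: ideal I S by fact
  have GS: "G \<subseteq> carrier S" using assms(3) I.Icarr by auto
  interpret J: ideal "Idl\<^bsub>S\<^esub> G" S by (rule S.genideal_ideal[OF GS])
  have "h \<in> Idl\<^bsub>S\<^esub> G" if h: "h \<in> I" for h
  proof -
    obtain q where "\<forall>g\<in>G. q g \<in> carrier S" "h = (\<Oplus>\<^bsub>S\<^esub>g\<in>G. q g \<otimes>\<^bsub>S\<^esub> g)"
      using standard_basis_division[OF assms h] by blast
    then show ?thesis
      using S.genideal_self[OF GS] by (auto intro!: J.finsum_mem J.I_l_closed)
  qed
  moreover have "Idl\<^bsub>S\<^esub> G \<subseteq> I"
    using assms(3) by (intro S.genideal_minimal assms(1)) auto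
  ultimately show ?thesis by blast
qed

lemma S_noetherian: "noetherian_ring S"
proof (rule S.noetherian_ringI)
  fix I assume I: "ideal I S"
  then interpret I: ideal I S .
  obtain G where "finite G" "G \<subseteq> I - {\<zero>\<^bsub>S\<^esub>}" "\<And>e. e \<in> LE I \<Longrightarrow> \<exists>g\<in>G. lexp g \<le> e"
    using ex_standard_basis[OF I] by blast
  moreover from this have "I = Idl\<^bsub>S\<^esub> G" by (intro standard_basis_generates I) blast+
  ultimately show "\<exists>G\<subseteq>carrier S. finite G \<and> I = Idl\<^bsub>S\<^esub> G" using I.Icarr by blast
qed

section \<open>Units, coordinate primes and the maximal ideal\<close>

lemma lexp_eq_0: "f \<in> carrier S \<Longrightarrow> f 0 \<noteq> \<zero> \<Longrightarrow> lexp f = 0"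
  by (rule lexp_eqI) (use expnum_pos[of n] in \<open>simp_all add: neq0_conv[symmetric] del: neq0_conv\<close>)

text \<open>Divide \<open>\<one>\<close> by \<open>f\<close>: since \<open>lexp f = 0\<close>, every
  exponent is reducible and the remainder vanishes. So \<open>f\<close> is a unit.\<close>

lemma ideal_eq_carrier:
  assumes "ideal I S" "f \<in> I" "f 0 \<noteq> \<zero>"
  shows "I = carrier S"
proof -
  interpret I: ideal I S by fact
  have f: "f \<in> carrier S" "f \<noteq> \<zero>\<^bsub>S\<^esub>" using I.Icarr assms by (auto simp: S_ops)
  obtain p r where pr: "p \<in> I" "r \<in> carrier S" "\<one>\<^bsub>S\<^esub> = p \<oplus>\<^bsub>S\<^esub> r" and q: "\<And>e. lexp f \<le> e \<Longrightarrow> r e = \<zero>"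
  proof -
    have "{f} \<subseteq> carrier S - {\<zero>\<^bsub>S\<^esub>}" using f by auto
    then obtain q r where "q f \<in> carrier S" "r \<in> carrier S" "\<one>\<^bsub>S\<^esub> = (\<Oplus>\<^bsub>S\<^esub>g\<in>{f}. q g \<otimes>\<^bsub>S\<^esub> g) \<oplus>\<^bsub>S\<^esub> r"
      "\<And>e. lexp f \<le> e \<Longrightarrow> r e = \<zero>"
      using division[of "{f}" "\<one>\<^bsub>S\<^esub>"] S.one_closed by blast
    then show ?thesis
      using that[of "q f \<otimes>\<^bsub>S\<^esub> f" r] f assms(2) I.I_l_closed by (simp add: S.finsum_insert)
  qed
  have "r = \<zero>\<^bsub>S\<^esub>"
    using q lexp_eq_0[OF f(1) assms(3)] by (auto simp: S_ops fun_eq_iff le_fun_def)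
  then have "\<one>\<^bsub>S\<^esub> \<in> I" using pr I.Icarr by simp
  then show ?thesis by (rule I.one_imp_carrier)
qed

text \<open>The ideal generated by the first \<open>k\<close> variables, described through
  coefficients so that primality can be read off from lowest terms. It is the zero ideal for
  \<open>k = 0\<close> and the maximal ideal for \<open>k = n\<close>.\<close>

definition coord_ideal :: "nat \<Rightarrow> ((nat \<Rightarrow> nat) \<Rightarrow> 'a) set" where
  "coord_ideal k = {f \<in> carrier S. \<forall>e. (\<forall>i<k. e i = 0) \<longrightarrow> f e = \<zero>}"

lemma coord_ideal_ideal: "ideal (coord_ideal k) S"
proof (rule idealI)
  show "ring S" by (rule S.ring_axioms)
  show "subgroup (coord_ideal k) (add_monoid S)"
    by (rule S.add.subgroupI)
     (auto simp: coord_ideal_def S_add S_uminus a_inv_def[symmetric] S_ops(4) intro: exI[of _ "\<zero>\<^bsub>S\<^esub>"]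
        simp del: S.add.inv_eq_1_iff)
  show "x \<otimes>\<^bsub>S\<^esub> f \<in> coord_ideal k" if f: "f \<in> coord_ideal k" and x: "x \<in> carrier S" for f x
    using that by (auto simp: coord_ideal_def S_mult exp_pairs_def S_closed intro!: add.finprod_one_eqI)
  then show "f \<otimes>\<^bsub>S\<^esub> x \<in> coord_ideal k" if f: "f \<in> coord_ideal k" and x: "x \<in> carrier S" for f x
    using that S.m_comm[of f x] by (auto simp: coord_ideal_def)
qed

text \<open>Modulo the ideal only monomials free of the first \<open>k\<close> variables count. The
  lowest such monomials \<open>a\<close> of \<open>f\<close> and \<open>b\<close> of
  \<open>g\<close> multiply to a term of \<open>f g\<close> that nothing cancels.\<close>

lemma coord_ideal_prime: "primeideal (coord_ideal k) S"
proof (rule primeidealI[OF coord_ideal_ideal S.cring_axioms])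
  have "\<one>\<^bsub>S\<^esub> 0 \<noteq> \<zero>" by (simp add: S_ops PS_one PS_const_eval)
  then have "\<one>\<^bsub>S\<^esub> \<notin> coord_ideal k" by (auto simp: coord_ideal_def intro!: exI[of _ 0])
  then show "carrier S \<noteq> coord_ideal k" by blast
  fix f g assume fg: "f \<in> carrier S" "g \<in> carrier S" "f \<otimes>\<^bsub>S\<^esub> g \<in> coord_ideal k"
  show "f \<in> coord_ideal k \<or> g \<in> coord_ideal k"
  proof (rule ccontr)
    assume "\<not> (f \<in> coord_ideal k \<or> g \<in> coord_ideal k)"
    then have ex: "\<exists>e. (\<forall>i<k. e i = 0) \<and> f e \<noteq> \<zero>" "\<exists>e. (\<forall>i<k. e i = 0) \<and> g e \<noteq> \<zero>"
      using fg by (auto simp: coord_ideal_def)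
    define a where "a = arg_min (expnum n) (\<lambda>e. (\<forall>i<k. e i = 0) \<and> f e \<noteq> \<zero>)"
    define b where "b = arg_min (expnum n) (\<lambda>e. (\<forall>i<k. e i = 0) \<and> g e \<noteq> \<zero>)"
    have a: "\<forall>i<k. a i = 0" "f a \<noteq> \<zero>"
      using ex(1) arg_min_natI[of "\<lambda>e. (\<forall>i<k. e i = 0) \<and> f e \<noteq> \<zero>" _ "expnum n"] unfolding a_def by blast+
    have b: "\<forall>i<k. b i = 0" "g b \<noteq> \<zero>"
      using ex(2) arg_min_natI[of "\<lambda>e. (\<forall>i<k. e i = 0) \<and> g e \<noteq> \<zero>" _ "expnum n"] unfolding b_def by blast+
    have amin: "expnum n a \<le> expnum n e" if "\<forall>i<k. e i = 0" "f e \<noteq> \<zero>" for e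
      using arg_min_nat_le[of "\<lambda>e. (\<forall>i<k. e i = 0) \<and> f e \<noteq> \<zero>" e "expnum n"] that unfolding a_def by blast
    have bmin: "expnum n b \<le> expnum n e" if "\<forall>i<k. e i = 0" "g e \<noteq> \<zero>" for e
      using arg_min_nat_le[of "\<lambda>e. (\<forall>i<k. e i = 0) \<and> g e \<noteq> \<zero>" e "expnum n"] that unfolding b_def by blast
    have ab: "a \<in> exps n" "b \<in> exps n" using a b S_outside fg by blast+
    \<comment> \<open>As \<open>c + d = a + b\<close>, both \<open>c\<close> and \<open>d\<close>
      avoid the first \<open>k\<close> variables, so their sizes are at least those of
      \<open>a\<close> and \<open>b\<close>. The products of the sizes agree; hence so do the sizes,
      and by injectivity of \<open>expnum\<close> the exponents.\<close>
    have "f c \<otimes> g d = \<zero>" if cd: "(c, d) \<in> exp_pairs n (a + b)" "(c, d) \<noteq> (a, b)" for c d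
    proof (rule ccontr)
      assume "f c \<otimes> g d \<noteq> \<zero>"
      then have nz: "f c \<noteq> \<zero>" "g d \<noteq> \<zero>" using S_closed fg by auto
      have sum: "c + d = a + b" and cdn: "c \<in> exps n" "d \<in> exps n" using cd by (auto simp: exp_pairs_def)
      have "c i = 0 \<and> d i = 0" if "i < k" for i
        using fun_cong[OF sum, of i] a(1) b(1) that by simp
      then have le: "expnum n a \<le> expnum n c" "expnum n b \<le> expnum n d"
        using nz amin bmin by auto
      have prod: "expnum n c * expnum n d = expnum n a * expnum n b"
        by (simp flip: expnum_add add: sum)
      have "expnum n a = expnum n c"
      proof (rule ccontr)
        assume "expnum n a \<noteq> expnum n c"
        then have "expnum n a * expnum n b < expnum n c * expnum n d"
          using le by (intro mult_less_le_imp_less) auto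
        then show False using prod by simp
      qed
      then have "a = c" using expnum_inj ab cdn by blast
      then have "b = d" using sum by simp
      then show False using \<open>a = c\<close> cd by simp
    qed
    then have "(f \<otimes>\<^bsub>S\<^esub> g) (a + b)
        = (\<Oplus>p\<in>exp_pairs n (a + b). if p = (a, b) then f a \<otimes> g b else \<zero>)"
      unfolding S_mult using fg
    proof (intro finsum_cong')
      fix p assume "p \<in> exp_pairs n (a + b)" "\<And>c d. (c, d) \<in> exp_pairs n (a + b) \<Longrightarrow> (c, d) \<noteq> (a, b) \<Longrightarrow> f c \<otimes> g d = \<zero>"
      then show "f (fst p) \<otimes> g (snd p) = (if p = (a, b) then f a \<otimes> g b else \<zero>)"
        by (cases p) auto
    qed (auto simp: S_closed)
    also have "\<dots> = f a \<otimes> g b"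
      using ab fg by (intro add.finprod_singleton_swap[where f = "\<lambda>_. f a \<otimes> g b"])
        (auto simp: S_closed exp_pairs_def[of n "a + b"] finite_exp_pairs[of n "a + b", unfolded exp_pairs_def])
    finally have "(f \<otimes>\<^bsub>S\<^esub> g) (a + b) \<noteq> \<zero>"
      using a b fg by (simp add: S_closed integral_iff)
    moreover have "(a + b) i = 0" if "i < k" for i using that a b by simp
    ultimately show False using fg(3) by (auto simp: coord_ideal_def)
  qed
qed

definition coord :: "nat \<Rightarrow> nat \<Rightarrow> nat" where
  "coord i = (\<lambda>j. if j = i then 1 else 0)"

lemma coord_exps: "i < n \<Longrightarrow> coord i \<in> exps n"
  by (auto simp: coord_def exps_def)

lemma coord_ideal_strict: "k < n \<Longrightarrow> coord_ideal k \<subset> coord_ideal (Suc k)"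
proof
  show "coord_ideal k \<subseteq> coord_ideal (Suc k)" by (auto simp: coord_ideal_def)
  assume k: "k < n"
  have "mono_PS (coord k) \<in> coord_ideal (Suc k)"
    using mono_PS_closed[OF coord_exps[OF k]]
    by (auto simp: coord_ideal_def mono_PS_def coord_def dest: spec[of _ k])
  moreover have "mono_PS (coord k) \<notin> coord_ideal k"
    by (auto simp: coord_ideal_def mono_PS_def coord_def)
  ultimately show "coord_ideal k \<noteq> coord_ideal (Suc k)" by blast
qed

lemma prime_chain_S: "prime_chain S n"
  unfolding prime_chain_def
  by (rule exI[of _ coord_ideal]) (use coord_ideal_prime coord_ideal_strict in auto)

lemma coord_ideal_n: "coord_ideal n = {f \<in> carrier S. f 0 = \<zero>}"
proof -
  have "f e = \<zero>" if "f \<in> carrier S" "f 0 = \<zero>" "\<forall>i<n. e i = 0" for f e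
  proof (cases "e \<in> exps n")
    case True
    then have "e i = 0" for i using that(3) by (cases "i < n") (auto simp: exps_def)
    then have "e = 0" by (simp add: fun_eq_iff)
    then show ?thesis using that by simp
  qed (use that S_outside in blast)
  then show ?thesis by (auto simp: coord_ideal_def)
qed

lemma coord_ideal_n_gen: "coord_ideal n = Idl\<^bsub>S\<^esub> ((\<lambda>i. mono_PS (coord i)) ` {..<n})"
proof (rule standard_basis_generates[OF coord_ideal_ideal])
  show "(\<lambda>i. mono_PS (coord i)) ` {..<n} \<subseteq> coord_ideal n - {\<zero>\<^bsub>S\<^esub>}"
    using mono_PS_nonzero mono_PS_closed[OF coord_exps]
    by (auto simp: coord_ideal_n) (auto simp: mono_PS_def coord_def fun_eq_iff split: if_splits)
  fix e assume "e \<in> LE (coord_ideal n)"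
  then obtain f where f: "f \<in> carrier S" "f 0 = \<zero>" "f \<noteq> \<zero>\<^bsub>S\<^esub>" "e = lexp f"
    by (auto simp: LE_def coord_ideal_n)
  then have "e \<noteq> 0" "e \<in> exps n" using lexp_nonzero lexp_exps by fastforce+
  then obtain i where i: "i < n" "e i \<noteq> 0"   proof -
    obtain i where "e i \<noteq> 0" using \<open>e \<noteq> 0\<close> by (auto simp: fun_eq_iff)
    moreover from this have "i < n" using \<open>e \<in> exps n\<close> by (auto simp: exps_def not_less[symmetric])
    ultimately show ?thesis using that by blast
  qed
  then have "coord i \<le> e" by (auto simp: coord_def le_fun_def)
  then show "\<exists>g\<in>(\<lambda>i. mono_PS (coord i)) ` {..<n}. lexp g \<le> e"
    using i lexp_mono_PS[OF coord_exps] by auto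
qed auto

lemma maximalideal_S_iff: "maximalideal m S \<longleftrightarrow> m = coord_ideal n"
proof
  have notc: "carrier S \<noteq> coord_ideal n"
    using primeideal.I_notcarr[OF coord_ideal_prime] .
  assume "maximalideal m S"
  then interpret m: maximalideal m S .
  have "m \<subseteq> coord_ideal n"
    using ideal_eq_carrier[OF m.is_ideal] m.Icarr m.I_notcarr unfolding coord_ideal_n by blast
  then show "m = coord_ideal n"
    using m.I_maximal[OF coord_ideal_ideal] notc coord_ideal_n by blast
next
  have notc: "carrier S \<noteq> coord_ideal n"
    using primeideal.I_notcarr[OF coord_ideal_prime] .
  assume m: "m = coord_ideal n"
  show "maximalideal m S"
    unfolding m
  proof (rule maximalidealI[OF coord_ideal_ideal notc])
    show "J = coord_ideal n \<or> J = carrier S" if "ideal J S" "coord_ideal n \<subseteq> J" for J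
      using that ideal_eq_carrier[OF that(1)] ideal.Icarr[OF that(1)] unfolding coord_ideal_n by blast
  qed
qed

subsection \<open>The dimension of a ring of power series\<close>

text \<open>The monomials with these exponents form a basis of \<open>S\<close> modulo the sum of
  \<open>I\<close> and the ideal of series vanishing below \<open>2 ^ t\<close>; their number is the
  value of a Hilbert-Samuel function.\<close>

definition std_exps :: "((nat \<Rightarrow> nat) \<Rightarrow> 'a) set \<Rightarrow> nat \<Rightarrow> (nat \<Rightarrow> nat) set" where
  "std_exps I t = {e \<in> exps n. expnum n e < 2 ^ t \<and> e \<notin> LE I}"

lemma finite_std_exps [simp]: "finite (std_exps I t)"
  by (rule finite_subset[OF _ finite_expnum_less[of n t]]) (auto simp: std_exps_def)

lemma card_std_exps: "card (std_exps I t) \<le> t ^ n"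
proof -
  have "card (std_exps I t) \<le> card {e \<in> exps n. expnum n e < 2 ^ t}"
    by (intro card_mono finite_expnum_less) (auto simp: std_exps_def)
  then show ?thesis using card_expnum_less[of n t] by simp
qed

lemma std_exps_mono: "s \<le> t \<Longrightarrow> std_exps I s \<subseteq> std_exps I t"
  by (auto simp: std_exps_def intro: less_le_trans power_increasing)

text \<open>Division by a standard basis of \<open>I + (f)\<close> keeps track of the order of vanishing.\<close>

lemma Artin_Rees:
  assumes "primeideal I S" "f \<in> carrier S" "f \<notin> I"
  obtains c where "\<And>t g p u. g \<in> carrier S \<Longrightarrow> p \<in> I \<Longrightarrow> u \<in> carrier S \<Longrightarrow> vanishing (2 ^ (t + c)) u \<Longrightarrow>
    f \<otimes>\<^bsub>S\<^esub> g = p \<oplus>\<^bsub>S\<^esub> u \<Longrightarrow> \<exists>v\<in>carrier S. vanishing (2 ^ t) v \<and> g \<ominus>\<^bsub>S\<^esub> v \<in> I"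
proof -
  interpret I: primeideal I S by fact
  define J where "J = I <+>\<^bsub>S\<^esub> PIdl\<^bsub>S\<^esub> f"
  have J: "ideal J S"
    unfolding J_def using assms by (intro S.add_ideals I.is_ideal S.cgenideal_ideal)
  have J_iff: "h \<in> J \<longleftrightarrow> (\<exists>p\<in>I. \<exists>d\<in>carrier S. h = p \<oplus>\<^bsub>S\<^esub> d \<otimes>\<^bsub>S\<^esub> f)" for h
    by (auto simp: J_def set_add_def' cgenideal_def)
  obtain G where G: "finite G" "G \<subseteq> J - {\<zero>\<^bsub>S\<^esub>}" "\<And>e. e \<in> LE J \<Longrightarrow> \<exists>g\<in>G. lexp g \<le> e"
    using ex_standard_basis[OF J] by blast
  have "\<forall>g\<in>G. \<exists>p d. p \<in> I \<and> d \<in> carrier S \<and> g = p \<oplus>\<^bsub>S\<^esub> d \<otimes>\<^bsub>S\<^esub> f"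
    using G(2) J_iff by blast
  then obtain p d where pd: "\<And>g. g \<in> G \<Longrightarrow> p g \<in> I" "\<And>g. g \<in> G \<Longrightarrow> d g \<in> carrier S"
    "\<And>g. g \<in> G \<Longrightarrow> g = p g \<oplus>\<^bsub>S\<^esub> d g \<otimes>\<^bsub>S\<^esub> f"
    by metis
  \<comment> \<open>Any \<open>c\<close> for which \<open>2 ^ c\<close> bounds the sizes of the
    leading exponents would do; the sum is a crude choice that works because
    \<open>c \<le> 2 ^ c\<close>.\<close>
  define c where "c = (\<Sum>g\<in>G. expnum n (lexp g))"
  have c: "expnum n (lexp g) \<le> 2 ^ c" if "g \<in> G" for g
  proof -
    have "expnum n (lexp g) \<le> c"
      unfolding c_def using that G(1) by (intro member_le_sum) auto
    also have "c \<le> 2 ^ c" by (rule less_imp_le[OF less_exp])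
    finally show ?thesis .
  qed
  show ?thesis
  proof (rule that[of c])
    fix t g p' u
    assume g: "g \<in> carrier S" and p': "p' \<in> I" and u: "u \<in> carrier S"
      and vu: "vanishing (2 ^ (t + c)) u" and eq: "f \<otimes>\<^bsub>S\<^esub> g = p' \<oplus>\<^bsub>S\<^esub> u"
    have "\<ominus>\<^bsub>S\<^esub> p' \<oplus>\<^bsub>S\<^esub> g \<otimes>\<^bsub>S\<^esub> f = \<ominus>\<^bsub>S\<^esub> p' \<oplus>\<^bsub>S\<^esub> (p' \<oplus>\<^bsub>S\<^esub> u)"
      using S.m_comm[OF assms(2) g] eq by simp
    then have "u = \<ominus>\<^bsub>S\<^esub> p' \<oplus>\<^bsub>S\<^esub> g \<otimes>\<^bsub>S\<^esub> f"
      using u I.Icarr[OF p'] by (simp add: S.r_neg1)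
    moreover have "\<ominus>\<^bsub>S\<^esub> p' \<in> I" using p' by simp
    ultimately have "u \<in> J" using g unfolding J_iff by blast
    then obtain q where q': "\<forall>g\<in>G. q g \<in> carrier S" and q2: "u = (\<Oplus>\<^bsub>S\<^esub>g\<in>G. q g \<otimes>\<^bsub>S\<^esub> g)"
      and q3: "\<forall>T. vanishing T u \<longrightarrow> (\<forall>g\<in>G. \<forall>e. expnum n e * expnum n (lexp g) < T \<longrightarrow> q g e = \<zero>)"
      using standard_basis_division[OF J G] by blast
    have q1: "q g \<in> carrier S" if "g \<in> G" for g using q' that by blast
    have vq: "vanishing (2 ^ t) (q g)" if "g \<in> G" for g
      unfolding vanishing_def
    proof (intro allI impI)
      fix e assume "expnum n e < 2 ^ t"
      then have "expnum n e * expnum n (lexp g) < 2 ^ t * 2 ^ c"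
        using c[OF that] by (intro mult_less_le_imp_less) auto
      then show "q g e = \<zero>" using q3 vu that by (simp add: power_add)
    qed
    \<comment> \<open>Writing each basis element as \<open>p g + d g f\<close> turns the division of
      \<open>u\<close> into \<open>u = w + f v\<close> with \<open>w\<close> in \<open>I\<close>;
      the order of vanishing of the quotients passes to \<open>v\<close>.\<close>
    define v where "v = (\<Oplus>\<^bsub>S\<^esub>g\<in>G. q g \<otimes>\<^bsub>S\<^esub> d g)"
    define w where "w = (\<Oplus>\<^bsub>S\<^esub>g\<in>G. q g \<otimes>\<^bsub>S\<^esub> p g)"
    have v: "v \<in> carrier S" unfolding v_def using q1 pd by (intro S.finsum_closed) auto
    have w: "w \<in> I" unfolding w_def using q1 pd by (intro I.finsum_mem I.I_l_closed) auto
    have "u = (\<Oplus>\<^bsub>S\<^esub>g\<in>G. q g \<otimes>\<^bsub>S\<^esub> p g \<oplus>\<^bsub>S\<^esub> f \<otimes>\<^bsub>S\<^esub> (q g \<otimes>\<^bsub>S\<^esub> d g))"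
      unfolding q2
    proof (rule S.finsum_cong')
      fix g assume g: "g \<in> G"
      have "q g \<otimes>\<^bsub>S\<^esub> g = q g \<otimes>\<^bsub>S\<^esub> (p g \<oplus>\<^bsub>S\<^esub> d g \<otimes>\<^bsub>S\<^esub> f)" using pd(3)[OF g] by simp
      also have "\<dots> = q g \<otimes>\<^bsub>S\<^esub> p g \<oplus>\<^bsub>S\<^esub> f \<otimes>\<^bsub>S\<^esub> (q g \<otimes>\<^bsub>S\<^esub> d g)"
        using q1[OF g] pd(1,2)[OF g] I.Icarr assms(2) by (simp add: S.r_distr S.m_ac)
      finally show "q g \<otimes>\<^bsub>S\<^esub> g = q g \<otimes>\<^bsub>S\<^esub> p g \<oplus>\<^bsub>S\<^esub> f \<otimes>\<^bsub>S\<^esub> (q g \<otimes>\<^bsub>S\<^esub> d g)" .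
    qed (use q1 pd I.Icarr assms(2) in auto)
    also have "\<dots> = w \<oplus>\<^bsub>S\<^esub> (\<Oplus>\<^bsub>S\<^esub>g\<in>G. f \<otimes>\<^bsub>S\<^esub> (q g \<otimes>\<^bsub>S\<^esub> d g))"
      unfolding w_def using q1 pd I.Icarr assms(2) by (intro S.finsum_addf) auto
    also have "(\<Oplus>\<^bsub>S\<^esub>g\<in>G. f \<otimes>\<^bsub>S\<^esub> (q g \<otimes>\<^bsub>S\<^esub> d g)) = f \<otimes>\<^bsub>S\<^esub> v"
      unfolding v_def using q1 pd assms(2) G(1) by (intro S.finsum_rdistr[symmetric]) auto
    finally have u_eq: "u = w \<oplus>\<^bsub>S\<^esub> f \<otimes>\<^bsub>S\<^esub> v" .
    have "f \<otimes>\<^bsub>S\<^esub> (g \<ominus>\<^bsub>S\<^esub> v) = f \<otimes>\<^bsub>S\<^esub> g \<ominus>\<^bsub>S\<^esub> f \<otimes>\<^bsub>S\<^esub> v"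
      using g v assms(2) by (simp add: S.minus_eq S.r_distr S.r_minus)
    also have "\<dots> = p' \<oplus>\<^bsub>S\<^esub> w"
      using g v assms(2) I.Icarr[OF p'] I.Icarr[OF w] unfolding eq u_eq
      by (simp add: S.minus_eq S.a_assoc S.r_neg)
    finally have "f \<otimes>\<^bsub>S\<^esub> (g \<ominus>\<^bsub>S\<^esub> v) \<in> I" using p' w by simp
    \<comment> \<open>Primality of \<open>I\<close> cancels \<open>f\<close>.\<close>
    then have "g \<ominus>\<^bsub>S\<^esub> v \<in> I"
      using I.I_prime[OF assms(2) S.minus_closed[OF g v]] assms(3) by simp
    moreover have "vanishing (2 ^ t) v"
      unfolding v_def using vq q1 pd by (intro vanishing_finsum vanishing_mult) auto
    ultimately show "\<exists>v\<in>carrier S. vanishing (2 ^ t) v \<and> g \<ominus>\<^bsub>S\<^esub> v \<in> I" using v by blast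
  qed
qed

end

text \<open>Gaussian elimination, by induction on the equations: an equation with a nonzero
  coefficient serves to eliminate one unknown, and an equation that is identically zero is
  dropped.\<close>

lemma (in field) underdetermined_system:
  assumes "finite E" "finite N" "card E < card N" "\<And>i j. i \<in> E \<Longrightarrow> j \<in> N \<Longrightarrow> A i j \<in> carrier R"
  shows "\<exists>x. (\<forall>j\<in>N. x j \<in> carrier R) \<and> (\<exists>j\<in>N. x j \<noteq> \<zero>) \<and> (\<forall>i\<in>E. (\<Oplus>j\<in>N. A i j \<otimes> x j) = \<zero>)"
  using assms
proof (induction E arbitrary: N A rule: finite_induct)
  case empty
  then have "N \<noteq> {}" by auto
  then show ?case by (intro exI[of _ "\<lambda>_. \<one>"]) auto
next
  case (insert i E)
  show ?case
  proof (cases "\<forall>j\<in>N. A i j = \<zero>")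
    case True
    have "card E < card N" using insert.prems(2) insert.hyps by simp
    then obtain x where x: "\<forall>j\<in>N. x j \<in> carrier R" "\<exists>j\<in>N. x j \<noteq> \<zero>" "\<forall>i\<in>E. (\<Oplus>j\<in>N. A i j \<otimes> x j) = \<zero>"
      using insert.IH[of N A] insert.prems by auto
    moreover have "(\<Oplus>j\<in>N. A i j \<otimes> x j) = \<zero>"
      using True x by (intro add.finprod_one_eqI) auto
    ultimately show ?thesis by (intro exI[of _ x]) auto
  next
    case False
    then obtain k where k: "k \<in> N" "A i k \<noteq> \<zero>" by auto
    define N' where "N' = N - {k}"
    have N: "N = insert k N'" "k \<notin> N'" "finite N'" using k insert.prems by (auto simp: N'_def)
    define a where "a = A i k"
    have a: "a \<in> carrier R" "inv a \<in> carrier R" "a \<otimes> inv a = \<one>"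
      using k insert.prems(3) field_Units by (auto simp: a_def)
    \<comment> \<open>Row \<open>l\<close> minus the multiple of row \<open>i\<close> that clears
      column \<open>k\<close>.\<close>
    define A' where "A' l j = A l j \<ominus> A l k \<otimes> inv a \<otimes> A i j" for l j
    have Ac: "A l j \<in> carrier R" if "l \<in> insert i E" "j \<in> insert k N'" for l j
      using insert.prems(3) that N(1) by blast
    have "card E < card N'" using insert.prems(2) insert.hyps N by simp
    then obtain y where y: "\<forall>j\<in>N'. y j \<in> carrier R" "\<exists>j\<in>N'. y j \<noteq> \<zero>"
      "\<forall>l\<in>E. (\<Oplus>j\<in>N'. A' l j \<otimes> y j) = \<zero>"
      using insert.IH[of N' A'] N(3) Ac a by (auto simp: A'_def)
    define s where "s l = (\<Oplus>j\<in>N'. A l j \<otimes> y j)" for l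
    have s: "s l \<in> carrier R" if "l \<in> insert i E" for l
      unfolding s_def using Ac that y by (intro finsum_closed) auto
    \<comment> \<open>The value at \<open>k\<close> is forced by equation \<open>i\<close>, whose
      pivot is \<open>a\<close>.\<close>
    define x where "x j = (if j = k then \<ominus> (inv a \<otimes> s i) else y j)" for j
    have eq: "(\<Oplus>j\<in>N. A l j \<otimes> x j) = s l \<ominus> A l k \<otimes> inv a \<otimes> s i" if l: "l \<in> insert i E" for l
    proof -
      have "(\<Oplus>j\<in>N. A l j \<otimes> x j) = A l k \<otimes> x k \<oplus> (\<Oplus>j\<in>N'. A l j \<otimes> x j)"
        unfolding N(1) using N Ac[OF l] y a s by (intro finsum_insert) (auto simp: x_def)
      also have "(\<Oplus>j\<in>N'. A l j \<otimes> x j) = s l"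
        unfolding s_def using N Ac[OF l] y by (intro finsum_cong') (auto simp: x_def)
      also have "A l k \<otimes> x k = \<ominus> (A l k \<otimes> inv a \<otimes> s i)"
        using Ac[OF l] a s by (simp add: x_def r_minus m_assoc)
      finally show ?thesis
        using Ac[OF l] a s l by (simp add: minus_eq a_comm)
    qed
    have "(\<Oplus>j\<in>N. A l j \<otimes> x j) = \<zero>" if "l \<in> insert i E" for l
    proof (cases "l = i")
      case True
      then show ?thesis using eq[of i] a s by (simp add: a_def[symmetric])
    next
      case False
      then have l: "l \<in> E" using that by simp
      have "\<zero> = (\<Oplus>j\<in>N'. A' l j \<otimes> y j)" using y l by simp
      also have "\<dots> = (\<Oplus>j\<in>N'. A l j \<otimes> y j \<oplus> (\<ominus> (A l k \<otimes> inv a)) \<otimes> (A i j \<otimes> y j))"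
        using Ac l y a by (intro finsum_cong') (auto simp: A'_def minus_eq l_distr l_minus m_assoc)
      also have "\<dots> = s l \<oplus> (\<Oplus>j\<in>N'. (\<ominus> (A l k \<otimes> inv a)) \<otimes> (A i j \<otimes> y j))"
        unfolding s_def using Ac l y a by (intro finsum_addf) auto
      also have "(\<Oplus>j\<in>N'. (\<ominus> (A l k \<otimes> inv a)) \<otimes> (A i j \<otimes> y j)) = (\<ominus> (A l k \<otimes> inv a)) \<otimes> s i"
        unfolding s_def using Ac l y a N by (intro finsum_rdistr[symmetric]) auto
      finally show ?thesis
        using eq[OF that] Ac l a s by (simp add: minus_eq l_minus)
    qed
    moreover have "\<forall>j\<in>N. x j \<in> carrier R" using y a s by (auto simp: x_def N(1))
    moreover have "\<exists>j\<in>N. x j \<noteq> \<zero>" using y(2) N by (auto simp: x_def)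
    ultimately show ?thesis by blast
  qed
qed

context directed_subfields
begin

text \<open>Multiplication by an element of \<open>P' - P\<close> followed by reduction modulo \<open>P\<close> embeds the span of the standard
  monomials of \<open>P\<close> of bounded size in \<open>P'\<close>, so enough standard monomials of \<open>P\<close> are leading monomials of \<open>P'\<close>.\<close>

lemma card_std_exps_drop:
  assumes "primeideal P S" "ideal P' S" "P \<subset> P'"
  shows "\<exists>c. \<forall>t. card (std_exps P' (t + c)) + card (std_exps P t) \<le> card (std_exps P (t + c))"
proof -
  interpret P: primeideal P S by fact
  interpret P': ideal P' S by fact
  obtain f where f: "f \<in> P'" "f \<notin> P" using assms(3) by auto
  have fS: "f \<in> carrier S" using f P'.Icarr by simp
  obtain c where c: "\<And>t g p u. g \<in> carrier S \<Longrightarrow> p \<in> P \<Longrightarrow> u \<in> carrier S \<Longrightarrow> vanishing (2 ^ (t + c)) u \<Longrightarrow>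
    f \<otimes>\<^bsub>S\<^esub> g = p \<oplus>\<^bsub>S\<^esub> u \<Longrightarrow> \<exists>v\<in>carrier S. vanishing (2 ^ t) v \<and> g \<ominus>\<^bsub>S\<^esub> v \<in> P"
    using Artin_Rees[OF assms(1) fS f(2)] by blast
  have "card (std_exps P' (t + c)) + card (std_exps P t) \<le> card (std_exps P (t + c))" for t
  proof -
    define N where "N = std_exps P t"
    \<comment> \<open>Exponents that are standard for \<open>P\<close> but leading for
      \<open>P'\<close>; their number is the drop to be bounded from below by
      \<open>card N\<close>.\<close>
    define E where "E = std_exps P (t + c) - std_exps P' (t + c)"
    have sub: "std_exps P' (t + c) \<subseteq> std_exps P (t + c)"
      using assms(3) by (auto simp: std_exps_def LE_def)
    have finN: "finite N" and finE: "finite E" by (auto simp: N_def E_def)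
    have "card N \<le> card E"
    proof (rule ccontr)
      assume "\<not> card N \<le> card E"
      then have less: "card E < card N" by simp
      have Nexp: "e \<in> exps n" if "e \<in> N" for e using that by (auto simp: N_def std_exps_def)
      have "\<forall>e\<in>N. \<exists>p r. p \<in> P \<and> r \<in> carrier S \<and> f \<otimes>\<^bsub>S\<^esub> mono_PS e = p \<oplus>\<^bsub>S\<^esub> r \<and> (\<forall>i\<in>LE P. r i = \<zero>)"
      proof
        fix e assume "e \<in> N"
        then have "f \<otimes>\<^bsub>S\<^esub> mono_PS e \<in> carrier S" using fS mono_PS_closed[OF Nexp] by simp
        from normal_form[OF P.is_ideal this]
        show "\<exists>p r. p \<in> P \<and> r \<in> carrier S \<and> f \<otimes>\<^bsub>S\<^esub> mono_PS e = p \<oplus>\<^bsub>S\<^esub> r \<and> (\<forall>i\<in>LE P. r i = \<zero>)"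
          by metis
      qed
      then obtain p r where pr: "\<And>e. e \<in> N \<Longrightarrow> p e \<in> P" "\<And>e. e \<in> N \<Longrightarrow> r e \<in> carrier S"
        "\<And>e. e \<in> N \<Longrightarrow> f \<otimes>\<^bsub>S\<^esub> mono_PS e = p e \<oplus>\<^bsub>S\<^esub> r e" "\<And>e i. e \<in> N \<Longrightarrow> i \<in> LE P \<Longrightarrow> r e i = \<zero>"
        by metis
      \<comment> \<open>With more monomials in \<open>N\<close> than conditions in \<open>E\<close>,
        a nonzero combination \<open>g\<close> exists for which the reduction \<open>u\<close> of
        \<open>f g\<close> modulo \<open>P\<close> has no coefficient at any exponent of
        \<open>E\<close>.\<close>
      have "\<exists>x. (\<forall>j\<in>N. x j \<in> carrier R) \<and> (\<exists>j\<in>N. x j \<noteq> \<zero>) \<and> (\<forall>i\<in>E. (\<Oplus>j\<in>N. r j i \<otimes> x j) = \<zero>)"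
        using pr(2) by (intro underdetermined_system[OF finE finN less, of "\<lambda>i j. r j i"]) (auto simp: S_closed)
      then obtain x where x: "\<And>j. j \<in> N \<Longrightarrow> x j \<in> carrier R" "\<exists>j\<in>N. x j \<noteq> \<zero>"
        "\<And>i. i \<in> E \<Longrightarrow> (\<Oplus>j\<in>N. r j i \<otimes> x j) = \<zero>" by blast
      have cx: "PS_const R (x e) \<in> carrier S" if "e \<in> N" for e
        using covering[OF x(1)[OF that]] const_closed by blast
      have pS: "p e \<in> carrier S" if "e \<in> N" for e using pr(1)[OF that] P.Icarr by simp
      define g where "g = (\<Oplus>\<^bsub>S\<^esub>e\<in>N. PS_const R (x e) \<otimes>\<^bsub>S\<^esub> mono_PS e)"
      define p' where "p' = (\<Oplus>\<^bsub>S\<^esub>e\<in>N. PS_const R (x e) \<otimes>\<^bsub>S\<^esub> p e)"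
      define u where "u = (\<Oplus>\<^bsub>S\<^esub>e\<in>N. PS_const R (x e) \<otimes>\<^bsub>S\<^esub> r e)"
      have g: "g \<in> carrier S" unfolding g_def using cx mono_PS_closed[OF Nexp] by (intro S.finsum_closed) auto
      have p': "p' \<in> P" unfolding p'_def using cx pr(1) by (intro P.finsum_mem P.I_l_closed) auto
      have u: "u \<in> carrier S" unfolding u_def using cx pr(2) by (intro S.finsum_closed) auto
      have g_eval: "g i = (if i \<in> N then x i else \<zero>)" for i
      proof -
        have "g i = (\<Oplus>e\<in>N. (PS_const R (x e) \<otimes>\<^bsub>S\<^esub> mono_PS e) i)"
          unfolding g_def using cx mono_PS_closed[OF Nexp] by (intro S_finsum) auto
        also have "\<dots> = (\<Oplus>e\<in>N. if i = e then x e else \<zero>)"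
          using x(1) mono_PS_closed[OF Nexp] by (intro finsum_cong') (auto simp: const_mult, auto simp: mono_PS_def)
        also have "\<dots> = (if i \<in> N then x i else \<zero>)"
        proof (cases "i \<in> N")
          case True
          then show ?thesis using add.finprod_singleton[OF True finN, of x] x(1) by simp
        qed (auto intro!: add.finprod_one_eqI)
        finally show ?thesis .
      qed
      have u_eval: "u i = (\<Oplus>j\<in>N. r j i \<otimes> x j)" for i
      proof -
        have "u i = (\<Oplus>e\<in>N. (PS_const R (x e) \<otimes>\<^bsub>S\<^esub> r e) i)"
          unfolding u_def using cx pr(2) by (intro S_finsum) auto
        also have "\<dots> = (\<Oplus>j\<in>N. r j i \<otimes> x j)"
          using x(1) pr(2) by (intro finsum_cong') (auto simp: const_mult S_closed m_comm)
        finally show ?thesis .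
      qed
      have "f \<otimes>\<^bsub>S\<^esub> g = (\<Oplus>\<^bsub>S\<^esub>e\<in>N. f \<otimes>\<^bsub>S\<^esub> (PS_const R (x e) \<otimes>\<^bsub>S\<^esub> mono_PS e))"
        unfolding g_def using cx mono_PS_closed[OF Nexp] fS finN by (intro S.finsum_rdistr) auto
      also have "\<dots> = (\<Oplus>\<^bsub>S\<^esub>e\<in>N. PS_const R (x e) \<otimes>\<^bsub>S\<^esub> p e \<oplus>\<^bsub>S\<^esub> PS_const R (x e) \<otimes>\<^bsub>S\<^esub> r e)"
      proof (rule S.finsum_cong')
        fix e assume e: "e \<in> N"
        have "f \<otimes>\<^bsub>S\<^esub> (PS_const R (x e) \<otimes>\<^bsub>S\<^esub> mono_PS e) = PS_const R (x e) \<otimes>\<^bsub>S\<^esub> (f \<otimes>\<^bsub>S\<^esub> mono_PS e)"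
          using cx[OF e] mono_PS_closed[OF Nexp[OF e]] fS by (simp add: S.m_lcomm)
        also have "\<dots> = PS_const R (x e) \<otimes>\<^bsub>S\<^esub> p e \<oplus>\<^bsub>S\<^esub> PS_const R (x e) \<otimes>\<^bsub>S\<^esub> r e"
          using cx[OF e] pS[OF e] pr(2)[OF e] by (simp add: pr(3)[OF e] S.r_distr)
        finally show "f \<otimes>\<^bsub>S\<^esub> (PS_const R (x e) \<otimes>\<^bsub>S\<^esub> mono_PS e) =
          PS_const R (x e) \<otimes>\<^bsub>S\<^esub> p e \<oplus>\<^bsub>S\<^esub> PS_const R (x e) \<otimes>\<^bsub>S\<^esub> r e" .
      qed (use cx pS pr(2) in auto)
      also have "\<dots> = p' \<oplus>\<^bsub>S\<^esub> u"
        unfolding p'_def u_def using cx pS pr(2) by (intro S.finsum_addf) auto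
      finally have fg: "f \<otimes>\<^bsub>S\<^esub> g = p' \<oplus>\<^bsub>S\<^esub> u" .
      have "u \<in> P'"
      proof -
        have "f \<otimes>\<^bsub>S\<^esub> g \<in> P'" using f(1) g by (rule P'.I_r_closed)
        moreover have "\<ominus>\<^bsub>S\<^esub> p' \<in> P'" using p' assms(3) by auto
        moreover have "u = \<ominus>\<^bsub>S\<^esub> p' \<oplus>\<^bsub>S\<^esub> f \<otimes>\<^bsub>S\<^esub> g"
          unfolding fg using u P.Icarr[OF p'] by (simp add: S.r_neg1)
        ultimately show ?thesis by simp
      qed
      \<comment> \<open>The leading exponent of \<open>u\<close> belongs to \<open>LE P'\<close>
        because \<open>u\<close> lies in \<open>P'\<close>, and not to \<open>LE P\<close> because
        \<open>u\<close> is reduced. If its size were below \<open>2 ^ (t + c)\<close> it would be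
        in \<open>E\<close>, where \<open>u\<close> vanishes.\<close>
      have van: "vanishing (2 ^ (t + c)) u"
      proof (rule ccontr)
        assume "\<not> vanishing (2 ^ (t + c)) u"
        then obtain e where e: "expnum n e < 2 ^ (t + c)" "u e \<noteq> \<zero>" by (auto simp: vanishing_def)
        then have unz: "u \<noteq> \<zero>\<^bsub>S\<^esub>" by (auto simp: S_ops)
        have "expnum n (lexp u) < 2 ^ (t + c)" using e lexp_le[of u e] by simp
        moreover have "lexp u \<in> LE P'" using unz \<open>u \<in> P'\<close> by (auto simp: LE_def)
        moreover have "lexp u \<notin> LE P"
        proof
          assume "lexp u \<in> LE P"
          then have "u (lexp u) = \<zero>"
            unfolding u_eval[of "lexp u"] using pr(4) x(1) by (intro add.finprod_one_eqI) auto
          then show False using lexp_nonzero[OF u unz] by simp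
        qed
        ultimately have "lexp u \<in> E"
          using lexp_exps[OF u unz] by (auto simp: E_def std_exps_def)
        then show False using x(3) u_eval lexp_nonzero[OF u unz] by simp
      qed
      \<comment> \<open>Modulo \<open>P\<close>, \<open>g\<close> equals a series vanishing below
        \<open>2 ^ t\<close>. Since \<open>g\<close> is supported on \<open>N\<close>, subtracting
        \<open>v\<close> leaves its leading term alone, and a standard exponent becomes a leading
        exponent of \<open>P\<close>.\<close>
      obtain v where v: "v \<in> carrier S" "vanishing (2 ^ t) v" "g \<ominus>\<^bsub>S\<^esub> v \<in> P"
        using c[OF g p' u van fg] by blast
      have "g \<noteq> \<zero>\<^bsub>S\<^esub>" using x(2) g_eval by (auto simp: S_ops fun_eq_iff)
      then have gl: "g (lexp g) \<noteq> \<zero>" by (rule lexp_nonzero[OF g])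
      then have lN: "lexp g \<in> N" using g_eval by metis
      have ev: "(g \<ominus>\<^bsub>S\<^esub> v) e = g e" if "expnum n e \<le> expnum n (lexp g)" for e
      proof -
        have "expnum n e < 2 ^ t" using that lN by (auto simp: N_def std_exps_def)
        then have "v e = \<zero>" using v(2) by (simp add: vanishing_def)
        then show ?thesis using g v(1) by (simp add: S_minus S_closed minus_eq)
      qed
      have "lexp (g \<ominus>\<^bsub>S\<^esub> v) = lexp g"
      proof (rule lexp_eqI)
        show "(g \<ominus>\<^bsub>S\<^esub> v) e = \<zero>" if "expnum n e < expnum n (lexp g)" for e
          using ev[of e] that lexp_le[of g e] by fastforce
      qed (use g v gl ev in auto)
      moreover have "g \<ominus>\<^bsub>S\<^esub> v \<noteq> \<zero>\<^bsub>S\<^esub>" using ev[of "lexp g"] gl by (auto simp: S_ops)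
      ultimately have "lexp g \<in> LE P" using v(3) unfolding LE_def by (metis DiffI imageI singletonD)
      then show False using lN by (simp add: N_def std_exps_def)
    qed
    also have "card E = card (std_exps P (t + c)) - card (std_exps P' (t + c))"
      unfolding E_def using sub by (intro card_Diff_subset) auto
    finally show ?thesis
      using card_mono[OF finite_std_exps sub] by (simp add: N_def)
  qed
  then show ?thesis by blast
qed

text \<open>Supplies the start of the growth estimate: at the top of a chain at least the monomial 1
  is standard.\<close>

lemma zero_notin_LE: 
  assumes "primeideal P S"
  shows "0 \<notin> LE P"
proof
  interpret P: primeideal P S by fact
  assume "0 \<in> LE P"
  then obtain f where f: "f \<in> P" "f \<noteq> \<zero>\<^bsub>S\<^esub>" "lexp f = 0" unfolding LE_def by fastforce
  then have "f 0 \<noteq> \<zero>" using lexp_nonzero[of f] P.Icarr by fastforce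
  then show False using ideal_eq_carrier[OF P.is_ideal f(1)] P.I_notcarr by simp
qed

end

text \<open>A binomial coefficient with lower index \<open>k = n + 1\<close> grows with degree
  \<open>n + 1\<close> in the upper index. Take \<open>m = k s\<close>: then \<open>s ^ k\<close> is
  a lower bound, while the other side is at most \<open>s ^ n\<close> times a factor independent of
  \<open>s\<close>, and \<open>s\<close> is chosen larger than that factor.\<close>

lemma binomial_not_poly_bounded: "\<exists>m. (Suc m * c) ^ n < m choose Suc n"
proof (rule ccontr)
  assume "\<not> ?thesis"
  then have H: "m choose Suc n \<le> (Suc m * c) ^ n" for m by (meson not_less)
  define k where "k = Suc n"
  define s where "s = Suc ((Suc k * c) ^ n)"
  have k: "k > 0" and s: "s > 0" by (simp_all add: k_def s_def)
  have "real s ^ k = (real (k * s) / real k) ^ k" using k by simp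
  also have "\<dots> \<le> real ((k * s) choose k)"
    using s by (intro binomial_ge_n_over_k_pow_k) simp
  finally have "real s ^ k \<le> real ((k * s) choose k)" .
  then have "s ^ k \<le> (k * s) choose k" by (metis of_nat_le_iff of_nat_power)
  also have "\<dots> \<le> (Suc (k * s) * c) ^ n" using H[of "k * s"] by (simp add: k_def)
  also have "\<dots> \<le> (s * (Suc k * c)) ^ n"
  proof (rule power_mono)
    have "Suc (k * s) \<le> s * Suc k" using s by simp
    then show "Suc (k * s) * c \<le> s * (Suc k * c)" by (metis mult.assoc mult_le_mono1)
  qed simp
  also have "\<dots> = s ^ n * (Suc k * c) ^ n" by (simp add: power_mult_distrib)
  also have "\<dots> < s ^ n * s" by (simp add: s_def)
  finally show False by (simp add: k_def)
qed

section \<open>The upper bound for the dimension, and regularity\<close>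

context directed_subfields
begin

lemma prime_chain_S_le:
  assumes "prime_chain S k"
  shows "k \<le> n"
proof (rule ccontr)
  assume "\<not> k \<le> n"
  then have k: "Suc n \<le> k" by simp
  obtain P :: "nat \<Rightarrow> ((nat \<Rightarrow> nat) \<Rightarrow> 'a) set"
    where P: "\<And>i. i \<le> k \<Longrightarrow> primeideal (P i) S" "\<And>i. i < k \<Longrightarrow> P i \<subset> P (Suc i)"
    using assms unfolding prime_chain_def by auto
  let ?h = "\<lambda>i t. card (std_exps (P i) t)"
  have mono: "?h i s \<le> ?h i t" if "s \<le> t" for i s t
    by (intro card_mono finite_std_exps std_exps_mono that)
  have "\<exists>c. \<forall>t. ?h (Suc i) (t + c) + ?h i t \<le> ?h i (t + c)" if "i < Suc n" for i
    using P k that by (intro card_std_exps_drop) (auto intro: primeideal.axioms(1))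
  then obtain d where d: "\<And>i t. i < Suc n \<Longrightarrow> ?h (Suc i) (t + d i) + ?h i t \<le> ?h i (t + d i)" by metis
  \<comment> \<open>A common shift for the first \<open>n + 1\<close> steps of the chain; enlarging
    a shift is harmless because the counts are monotone. The successor makes \<open>c\<close>
    positive, so that already the cut-off \<open>2 ^ c\<close> exceeds the size 1 of the constant
    monomial.\<close>
  define c where "c = Suc (\<Sum>i<Suc n. d i)"
  have c: "?h (Suc i) (t + c) + ?h i t \<le> ?h i (t + c)" if i: "i < Suc n" for i t
  proof -
    have "d i \<le> c" unfolding c_def using i member_le_sum[of i "{..<Suc n}" d] by simp
    then have eq: "t + c = (t + (c - d i)) + d i" by simp
    have "?h (Suc i) (t + c) + ?h i t \<le> ?h (Suc i) (t + c) + ?h i (t + (c - d i))"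
      by (intro add_left_mono mono) simp
    also have "\<dots> \<le> ?h i (t + c)" unfolding eq by (rule d[OF i])
    finally show ?thesis .
  qed
  \<comment> \<open>Induction on the distance \<open>j\<close> from \<open>P (Suc n)\<close>, and
    for fixed \<open>j\<close> on \<open>m\<close>: the inequality for one step of the chain,
    evaluated at multiples of \<open>c\<close>, has the shape of Pascal's rule. At
    \<open>j = n + 1\<close> it contradicts the bound \<open>t ^ n\<close> for
    \<open>P 0\<close>.\<close>
  have "(m choose j) \<le> ?h (Suc n - j) (Suc m * c)" if "j \<le> Suc n" for j m
    using that
  proof (induction j arbitrary: m)
    case 0
    have "(1::nat) < 2 ^ (Suc m * c)" by (rule one_less_power) (auto simp: c_def)
    then have "0 \<in> std_exps (P (Suc n)) (Suc m * c)"
      using zero_notin_LE[OF P(1)[OF k]] by (simp add: std_exps_def)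
    then have "0 < ?h (Suc n) (Suc m * c)" by (auto simp: card_gt_0_iff)
    then show ?case by simp
  next
    case (Suc j)
    note IH = Suc.IH and j = Suc.prems
    show ?case
    proof (induction m)
      case (Suc m)
      let ?i = "Suc n - Suc j"
      have i: "Suc ?i = Suc n - j" "?i < Suc n" using j by auto
      have "(Suc m choose Suc j) \<le> (Suc m choose j) + (m choose Suc j)"
        by (simp add: binomial_right_mono)
      also have "\<dots> \<le> ?h (Suc ?i) (Suc m * c + c) + ?h ?i (Suc m * c)"
        using IH[of "Suc m"] j Suc.IH unfolding i(1) by (simp add: add.commute add_mono)
      also have "\<dots> \<le> ?h ?i (Suc m * c + c)" by (rule c[OF i(2)])
      finally show ?case by (simp add: add.commute add.left_commute)
    qed simp
  qed
  from this[of "Suc n"] have "(m choose Suc n) \<le> (Suc m * c) ^ n" for m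
    using card_std_exps[of "P 0" "Suc m * c"] order_trans by fastforce
  then show False using binomial_not_poly_bounded[of c n] by (meson not_less)
qed

lemma krull_dim_S: "krull_dim S = enat n"
  unfolding krull_dim_def using prime_chain_S prime_chain_S_le
  by (intro antisym Sup_least Sup_upper) auto

lemma S_regular_local: "regular_local_ring S"
  unfolding regular_local_ring_def local_ring_def
proof (intro conjI exI[of _ n] allI impI)
  show "\<exists>!m. maximalideal m S" by (simp add: maximalideal_S_iff)
  show "krull_dim S = enat n" by (rule krull_dim_S)
  fix m assume "maximalideal m S"
  then have "m = Idl\<^bsub>S\<^esub> ((\<lambda>i. mono_PS (coord i)) ` {..<n})"
    using maximalideal_S_iff coord_ideal_n_gen by simp
  moreover have "card ((\<lambda>i. mono_PS (coord i)) ` {..<n}) \<le> n"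
    using card_image_le[of "{..<n}" "\<lambda>i. mono_PS (coord i)"] by simp
  ultimately show "\<exists>G\<subseteq>carrier S. finite G \<and> card G \<le> n \<and> m = Idl\<^bsub>S\<^esub> G"
    using mono_PS_closed[OF coord_exps]
    by (intro exI[of _ "(\<lambda>i. mono_PS (coord i)) ` {..<n}"]) auto
qed (auto simp: S_noetherian S.cring_axioms)

end

subsection \<open>Artinian rings are Noetherian\<close>

text \<open>Zorn's lemma in the form used twice: avoiding \<open>\<one>\<close> yields maximal
  ideals, avoiding a general \<open>x\<close> yields the analogue of a hyperplane complementary to
  \<open>x\<close>.\<close>

lemma (in ring) ex_ideal_maximal_avoiding:
  assumes "ideal I R" "x \<notin> I"
  obtains J where "ideal J R" "I \<subseteq> J" "x \<notin> J" "\<And>K. ideal K R \<Longrightarrow> J \<subseteq> K \<Longrightarrow> x \<notin> K \<Longrightarrow> K = J"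
proof -
  define F where "F = {J. ideal J R \<and> I \<subseteq> J \<and> x \<notin> J}"
  have "\<exists>M\<in>F. \<forall>X\<in>F. M \<subseteq> X \<longrightarrow> X = M"
  proof (rule subset_Zorn_nonempty)
    fix C assume ne: "C \<noteq> {}" and C: "subset.chain F C"
    have "subset.chain {I. ideal I R} C" using C by (auto simp: pred_on.chain_def F_def)
    then have "ideal (\<Union>C) R" using chain_Union_is_ideal[of C] ne by simp
    moreover have "C \<subseteq> F" using C by (simp add: pred_on.chain_def)
    ultimately show "\<Union>C \<in> F" using ne by (fastforce simp: F_def)
  qed (use assms in \<open>auto simp: F_def\<close>)
  then obtain J where J: "J \<in> F" "\<And>K. K \<in> F \<Longrightarrow> J \<subseteq> K \<Longrightarrow> K = J" by blast
  show ?thesis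
    by (rule that[of J]) (use J in \<open>auto simp: F_def\<close>)
qed

lemma (in cring) ex_maximalideal:
  assumes "ideal I R" "\<one> \<notin> I"
  obtains m where "maximalideal m R" "I \<subseteq> m"
proof -
  obtain J where J: "ideal J R" "I \<subseteq> J" "\<one> \<notin> J" "\<And>K. ideal K R \<Longrightarrow> J \<subseteq> K \<Longrightarrow> \<one> \<notin> K \<Longrightarrow> K = J"
    using ex_ideal_maximal_avoiding[OF assms] by blast
  have "maximalideal J R"
  proof (rule maximalidealI[OF J(1)])
    show "carrier R \<noteq> J" using J(3) by auto
    show "K = J \<or> K = carrier R" if "ideal K R" "J \<subseteq> K" for K
      using J(4)[OF that] ideal.one_imp_carrier[OF that(1)] by blast
  qed
  then show ?thesis using that J(2) by blast
qed

lemma (in cring) ex_ideal_adjoin: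
  assumes "ideal I R" "r \<in> carrier R"
  shows "\<exists>J. ideal J R \<and> I \<subseteq> J \<and> r \<in> J \<and> (\<forall>z\<in>J. \<exists>i\<in>I. \<exists>s\<in>carrier R. z = i \<oplus> s \<otimes> r)"
proof (intro exI[of _ "I <+>\<^bsub>R\<^esub> PIdl r"] conjI)
  interpret I: ideal I R by fact
  have iff: "z \<in> I <+>\<^bsub>R\<^esub> PIdl r \<longleftrightarrow> (\<exists>i\<in>I. \<exists>s\<in>carrier R. z = i \<oplus> s \<otimes> r)" for z
    by (auto simp: set_add_def' cgenideal_def)
  show "\<forall>z\<in>I <+>\<^bsub>R\<^esub> PIdl r. \<exists>i\<in>I. \<exists>s\<in>carrier R. z = i \<oplus> s \<otimes> r" using iff by simp
  show "ideal (I <+>\<^bsub>R\<^esub> PIdl r) R" by (intro add_ideals cgenideal_ideal assms)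
  show "I \<subseteq> I <+>\<^bsub>R\<^esub> PIdl r"
  proof
    fix i assume i: "i \<in> I"
    then have "i = i \<oplus> \<zero> \<otimes> r" using assms(2) I.Icarr by simp
    then show "i \<in> I <+>\<^bsub>R\<^esub> PIdl r" unfolding iff using i zero_closed by blast
  qed
  have "r = \<zero> \<oplus> \<one> \<otimes> r" using assms(2) by simp
  moreover have "\<zero> \<in> I" by (rule additive_subgroup.zero_closed[OF I.is_additive_subgroup])
  ultimately show "r \<in> I <+>\<^bsub>R\<^esub> PIdl r" unfolding iff using one_closed by blast
qed

lemma (in maximalideal) inverse_mod:
  assumes "cring R" "r \<in> carrier R" "r \<notin> I"
  obtains s where "s \<in> carrier R" "\<one> \<ominus> s \<otimes> r \<in> I"
proof -
  interpret cring R by fact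
  obtain J where J: "ideal J R" "I \<subseteq> J" "r \<in> J" "\<forall>z\<in>J. \<exists>i\<in>I. \<exists>s\<in>carrier R. z = i \<oplus> s \<otimes> r"
    using ex_ideal_adjoin[OF is_ideal assms(2)] by blast
  have "J = carrier R"
    using I_maximal[OF J(1,2)] J(3) assms(3) ideal.Icarr[OF J(1)] by blast
  then obtain i s where i: "i \<in> I" "s \<in> carrier R" "\<one> = i \<oplus> s \<otimes> r"
    using J(4) one_closed by blast
  then have "\<one> \<ominus> s \<otimes> r = i" using Icarr[of i] assms(2) by (simp add: minus_eq a_assoc r_neg)
  then show ?thesis using that i by simp
qed

locale artinian = cring +
  assumes artinian: "artinian_ring R"
begin

lemma ex_minimal_ideal:
  assumes "\<I> \<noteq> {}" "\<And>I. I \<in> \<I> \<Longrightarrow> ideal I R"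
  shows "\<exists>I\<in>\<I>. \<forall>J\<in>\<I>. J \<subseteq> I \<longrightarrow> J = I"
proof -
  define r where "r = {(J, I). ideal J R \<and> ideal I R \<and> J \<subset> I}"
  have "wf r"
    unfolding wf_iff_no_infinite_down_chain
  proof
    assume "\<exists>f. \<forall>i. (f (Suc i), f i) \<in> r"
    then obtain f where f: "\<And>i. (f (Suc i), f i) \<in> r" by blast
    then have "\<forall>k. ideal (f k) R \<and> f (Suc k) \<subseteq> f k" by (auto simp: r_def)
    with artinian[unfolded artinian_ring_def] have "\<exists>N. \<forall>k\<ge>N. f k = f N"
      by (elim conjE allE[of _ f] impE)
    then obtain N where "\<forall>k\<ge>N. f k = f N" ..
    then have "f (Suc N) = f N" by (rule allE[of _ "Suc N"]) simp
    then show False using f[of N] by (auto simp: r_def)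
  qed
  then obtain I where I: "I \<in> \<I>" "\<And>J. (J, I) \<in> r \<Longrightarrow> J \<notin> \<I>"
    using assms(1) by (meson ex_in_conv wfE_min)
  show ?thesis
  proof (intro bexI ballI impI)
    fix J assume J: "J \<in> \<I>" "J \<subseteq> I"
    show "J = I"
    proof (rule ccontr)
      assume "J \<noteq> I"
      then have "(J, I) \<in> r" using J assms(2) I(1) by (auto simp: r_def)
      then show False using I(2) J(1) by blast
    qed
  qed (rule I)
qed

text \<open>Interpolates between the trivial case \<open>J = A\<close> and the goal: for
  \<open>J = {\<zero>}\<close> it says that \<open>A\<close> is finitely generated. Minimality among
  such \<open>J\<close> replaces an induction along a composition series.\<close>

definition fg_modulo :: "'a set \<Rightarrow> 'a set \<Rightarrow> bool" where
  "fg_modulo A J \<longleftrightarrow> (\<exists>F\<subseteq>A. finite F \<and> (\<forall>a\<in>A. \<exists>g\<in>Idl F. a \<ominus> g \<in> J))"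

text \<open>For \<open>x \<in> J - B\<close>, an ideal \<open>L \<supseteq> B\<close> maximal with \<open>x \<notin> L\<close> cuts out a complement of the line spanned by
  \<open>x\<close> in the vector space \<open>J/B\<close> over \<open>R/m\<close>, so that \<open>A\<close> is finitely generated modulo the smaller ideal \<open>L \<inter> J\<close>.\<close>

lemma fg_modulo_step:
  assumes A: "ideal A R" and "ideal J R" "J \<subseteq> A" and m: "maximalideal m R"
    and cof: "fg_modulo A J"
    and B: "ideal B R" "B \<subseteq> J" "\<And>y j. y \<in> m \<Longrightarrow> j \<in> J \<Longrightarrow> y \<otimes> j \<in> B"
    and min: "\<And>K. ideal K R \<Longrightarrow> K \<subseteq> J \<Longrightarrow> fg_modulo A K \<Longrightarrow> K = J"
  shows "B = J"
proof (rule ccontr)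
  assume "B \<noteq> J"
  then obtain x where x: "x \<in> J" "x \<notin> B" using B by auto
  interpret A: ideal A R by fact
  interpret J: ideal J R by fact
  interpret m: maximalideal m R by fact
  obtain L where L: "ideal L R" "B \<subseteq> L" "x \<notin> L" "\<And>K. ideal K R \<Longrightarrow> L \<subseteq> K \<Longrightarrow> x \<notin> K \<Longrightarrow> K = L"
    using ex_ideal_maximal_avoiding[OF B(1) x(2)] by blast
  interpret L: ideal L R by fact
  have xc: "x \<in> carrier R" using x J.Icarr by simp
  have decomp: "\<exists>s\<in>carrier R. y \<ominus> s \<otimes> x \<in> L" if y: "y \<in> J" for y
  proof (cases "y \<in> L")
    case True
    then show ?thesis using xc L.Icarr[of y] by (intro bexI[of _ \<zero>]) (auto simp: minus_eq)
  next
    case False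
    have yc: "y \<in> carrier R" using y J.Icarr by simp
    obtain K where K: "ideal K R" "L \<subseteq> K" "y \<in> K" "\<forall>z\<in>K. \<exists>l\<in>L. \<exists>r\<in>carrier R. z = l \<oplus> r \<otimes> y"
      using ex_ideal_adjoin[OF L(1) yc] by blast
    \<comment> \<open>Adjoining \<open>y\<close> to the maximal \<open>L\<close> captures
      \<open>x\<close>, so \<open>x = l + r y\<close>. Here \<open>r\<close> is not in
      \<open>m\<close>, otherwise \<open>r y\<close>, and with it \<open>x\<close>, would lie in
      \<open>L\<close>; inverting \<open>r\<close> modulo \<open>m\<close> expresses
      \<open>y\<close> through \<open>x\<close> modulo \<open>L\<close>.\<close>
    have "x \<in> K" using L(4)[OF K(1,2)] K(3) False by blast
    then obtain l r where lr: "l \<in> L" "r \<in> carrier R" "x = l \<oplus> r \<otimes> y" using K(4) by blast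
    have "r \<notin> m"
    proof
      assume "r \<in> m"
      then have "r \<otimes> y \<in> L" using B(3)[OF _ y] L(2) by blast
      then show False using lr(1,3) L(3) by simp
    qed
    then obtain s where s: "s \<in> carrier R" "\<one> \<ominus> s \<otimes> r \<in> m"
      using m.inverse_mod[OF cring_axioms lr(2)] by blast
    have lc: "l \<in> carrier R" using lr L.Icarr by simp
    have "(\<one> \<ominus> s \<otimes> r) \<otimes> y \<in> L" using B(3)[OF s(2) y] L(2) by blast
    moreover have "s \<otimes> l \<in> L" using s lr by (intro L.I_l_closed)
    moreover have "y \<ominus> s \<otimes> x = (\<one> \<ominus> s \<otimes> r) \<otimes> y \<ominus> s \<otimes> l"
      unfolding lr(3) using s(1) lr(2) lc yc by algebra
    ultimately have "y \<ominus> s \<otimes> x \<in> L" by (simp add: minus_eq)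
    then show ?thesis using s(1) by blast
  qed
  obtain F where F: "F \<subseteq> A" "finite F" "\<forall>a\<in>A. \<exists>g\<in>Idl F. a \<ominus> g \<in> J" using cof by (auto simp: fg_modulo_def)
  have Fc: "insert x F \<subseteq> carrier R" using F(1) A.Icarr xc by auto
  interpret G: ideal "Idl (insert x F)" R by (rule genideal_ideal[OF Fc])
  have "fg_modulo A (L \<inter> J)"
    unfolding fg_modulo_def
  proof (intro exI[of _ "insert x F"] conjI ballI)
    show "insert x F \<subseteq> A" using F(1) x(1) assms(3) by auto
    fix a assume a: "a \<in> A"
    then obtain g where g: "g \<in> Idl F" "a \<ominus> g \<in> J" using F(3) by blast
    obtain s where s: "s \<in> carrier R" "a \<ominus> g \<ominus> s \<otimes> x \<in> L" using decomp[OF g(2)] by blast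
    have "Idl F \<subseteq> Idl (insert x F)"
      using Fc by (intro subset_Idl_subset) auto
    then have g': "g \<in> Idl (insert x F)" using g(1) by blast
    have "s \<otimes> x \<in> Idl (insert x F)"
      using s(1) genideal_self[OF Fc] by (intro G.I_l_closed) auto
    then have "g \<oplus> s \<otimes> x \<in> Idl (insert x F)" using g' by simp
    moreover have "a \<ominus> (g \<oplus> s \<otimes> x) = a \<ominus> g \<ominus> s \<otimes> x"
      using a A.Icarr G.Icarr[OF g'] s(1) xc by algebra
    moreover have "a \<ominus> g \<ominus> s \<otimes> x \<in> J"
      using g(2) J.I_l_closed[OF x(1) s(1)] by (simp add: minus_eq)
    ultimately show "\<exists>g\<in>Idl (insert x F). a \<ominus> g \<in> L \<inter> J"
      using s(2) by (intro bexI[of _ "g \<oplus> s \<otimes> x"]) simp_all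
  qed (use F in simp)
  then have "L \<inter> J = J" by (intro min i_intersect L(1) assms(2)) auto
  then show False using x(1) L(3) by blast
qed

text \<open>A minimal \<open>J \<subseteq> A\<close> modulo which \<open>A\<close> is finitely generated satisfies \<open>m J = J\<close> for all maximal \<open>m\<close>. If \<open>J \<noteq> 0\<close>, an
  ideal \<open>K\<close> minimal with \<open>K J \<noteq> 0\<close> is generated by one element \<open>a\<close> with \<open>a \<in> m a\<close> for all \<open>m\<close>; taking
  \<open>m \<supseteq> Ann(a)\<close> gives a contradiction.\<close>

lemma noetherian: "noetherian_ring R"
proof (rule noetherian_ringI)
  fix A assume A: "ideal A R"
  then interpret A: ideal A R .
  have "\<exists>J\<in>{J. ideal J R \<and> J \<subseteq> A \<and> fg_modulo A J}. \<forall>K\<in>{J. ideal J R \<and> J \<subseteq> A \<and> fg_modulo A J}. K \<subseteq> J \<longrightarrow> K = J"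
  proof (rule ex_minimal_ideal)
    have "\<forall>a\<in>A. \<exists>g\<in>Idl {}. a \<ominus> g \<in> A"
    proof
      fix a assume a: "a \<in> A"
      have "\<zero> \<in> Idl {}"
        using genideal_ideal[of "{}"] by (simp add: additive_subgroup.zero_closed ideal.axioms(1))
      moreover have "a \<ominus> \<zero> \<in> A" using a A.Icarr by (simp add: minus_eq)
      ultimately show "\<exists>g\<in>Idl {}. a \<ominus> g \<in> A" by blast
    qed
    then have "fg_modulo A A" unfolding fg_modulo_def by blast
    then show "{J. ideal J R \<and> J \<subseteq> A \<and> fg_modulo A J} \<noteq> {}" using A by blast
  qed blast
  then obtain J where J0: "J \<in> {J. ideal J R \<and> J \<subseteq> A \<and> fg_modulo A J}"
    and J1: "\<forall>K\<in>{J. ideal J R \<and> J \<subseteq> A \<and> fg_modulo A J}. K \<subseteq> J \<longrightarrow> K = J"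
    by (elim bexE) (rule that)
  then have J: "ideal J R" "J \<subseteq> A" "fg_modulo A J" by auto
  have J_min: "K = J" if "ideal K R" "K \<subseteq> A" "fg_modulo A K" "K \<subseteq> J" for K
    by (rule J1[rule_format]) (use that in auto)
  interpret J: ideal J R by (rule J(1))
  \<comment> \<open>The product ideal \<open>m J\<close>; the preceding lemma with
    \<open>B = m J\<close> shows that it equals the minimal \<open>J\<close>.\<close>
  define prd where "prd m = Idl {y \<otimes> j | y j. y \<in> m \<and> j \<in> J}" for m
  have prd: "prd m = J" if m: "maximalideal m R" for m
  proof (rule fg_modulo_step[OF A _ _ m])
    interpret m: maximalideal m R by fact
    have sub: "{y \<otimes> j | y j. y \<in> m \<and> j \<in> J} \<subseteq> carrier R" using m.Icarr J.Icarr by auto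
    show "ideal (prd m) R" unfolding prd_def by (rule genideal_ideal[OF sub])
    show "prd m \<subseteq> J" unfolding prd_def
      by (rule genideal_minimal) (use m.Icarr J.I_l_closed J(1) in auto)
    show "y \<otimes> j \<in> prd m" if "y \<in> m" "j \<in> J" for y j
      unfolding prd_def using genideal_self[OF sub] that by blast
    show "K = J" if "ideal K R" "K \<subseteq> J" "fg_modulo A K" for K
      using that J J_min by blast
  qed (use J in auto)
  have "J \<subseteq> {\<zero>}"
  proof (rule ccontr)
    assume "\<not> J \<subseteq> {\<zero>}"
    then obtain j where j: "j \<in> J" "j \<noteq> \<zero>" by auto
    have "\<one> \<otimes> j \<noteq> \<zero>" using j J.Icarr by simp
    have "\<exists>K\<in>{K. ideal K R \<and> (\<exists>a\<in>K. \<exists>j\<in>J. a \<otimes> j \<noteq> \<zero>)}.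
      \<forall>K'\<in>{K. ideal K R \<and> (\<exists>a\<in>K. \<exists>j\<in>J. a \<otimes> j \<noteq> \<zero>)}. K' \<subseteq> K \<longrightarrow> K' = K"
    proof (rule ex_minimal_ideal)
      show "{K. ideal K R \<and> (\<exists>a\<in>K. \<exists>j\<in>J. a \<otimes> j \<noteq> \<zero>)} \<noteq> {}"
        using oneideal \<open>\<one> \<otimes> j \<noteq> \<zero>\<close> j(1) one_closed by blast
    qed blast
    then obtain K where K0: "K \<in> {K. ideal K R \<and> (\<exists>a\<in>K. \<exists>j\<in>J. a \<otimes> j \<noteq> \<zero>)}"
      and K1: "\<forall>K'\<in>{K. ideal K R \<and> (\<exists>a\<in>K. \<exists>j\<in>J. a \<otimes> j \<noteq> \<zero>)}. K' \<subseteq> K \<longrightarrow> K' = K"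
      by (elim bexE) (rule that)
    have K_min: "K' = K" if "ideal K' R" "\<exists>a\<in>K'. \<exists>j\<in>J. a \<otimes> j \<noteq> \<zero>" "K' \<subseteq> K" for K'
      by (rule K1[rule_format]) (use that in auto)
    obtain a j where K: "ideal K R" and aj: "a \<in> K" "j \<in> J" "a \<otimes> j \<noteq> \<zero>" using K0 by auto
    then interpret K: ideal K R by simp
    have ac: "a \<in> carrier R" using aj K.Icarr by simp
    define ann where "ann = {z \<in> carrier R. a \<otimes> z = \<zero>}"
    have annI: "ideal ann R"
      unfolding ann_def
    proof (rule idealI)
      show "ring R" by (rule ring_axioms)
      show "subgroup {z \<in> carrier R. a \<otimes> z = \<zero>} (add_monoid R)"
        using ac by (intro add.subgroupI) (auto simp: r_distr a_inv_def[symmetric] r_minus)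
      fix z x assume z: "z \<in> {z \<in> carrier R. a \<otimes> z = \<zero>}" "x \<in> carrier R"
      then have "a \<otimes> (x \<otimes> z) = \<zero>" using ac m_lcomm[of a x z] by simp
      then show "x \<otimes> z \<in> {z \<in> carrier R. a \<otimes> z = \<zero>}" "z \<otimes> x \<in> {z \<in> carrier R. a \<otimes> z = \<zero>}"
        using z m_comm[of x z] by auto
    qed
    have "\<one> \<notin> ann" using aj ac J.Icarr[OF aj(2)] by (auto simp: ann_def)
    then obtain m where m: "maximalideal m R" "ann \<subseteq> m" using ex_maximalideal[OF annI] by blast
    then interpret m: maximalideal m R by simp
    \<comment> \<open>The ideal \<open>m a\<close> is contained in \<open>K\<close>. Once it is
      known not to annihilate \<open>J\<close>, minimality of \<open>K\<close> gives
      \<open>m a = K\<close>, so \<open>a\<close> itself lies in \<open>m a\<close>.\<close>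
    define K' where "K' = {y \<otimes> a | y. y \<in> m}"
    have K'I: "ideal K' R"
    proof (rule idealI)
      show "ring R" by (rule ring_axioms)
      show "subgroup K' (add_monoid R)"
      proof (rule add.subgroupI)
        show "K' \<subseteq> carrier R" using ac m.Icarr by (auto simp: K'_def)
        have "\<zero> \<in> m" by (rule additive_subgroup.zero_closed[OF m.is_additive_subgroup])
        then show "K' \<noteq> {}" unfolding K'_def by blast
        fix u v assume "u \<in> K'" "v \<in> K'"
        then obtain y z where yz: "u = y \<otimes> a" "v = z \<otimes> a" "y \<in> m" "z \<in> m" by (auto simp: K'_def)
        have "u \<oplus> v = (y \<oplus> z) \<otimes> a" using yz m.Icarr ac by (simp add: l_distr)
        then show "u \<oplus> v \<in> K'" using yz unfolding K'_def by blast
      next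
        fix u assume "u \<in> K'"
        then obtain y where y: "u = y \<otimes> a" "y \<in> m" by (auto simp: K'_def)
        have "\<ominus> u = (\<ominus> y) \<otimes> a" using y m.Icarr ac by (simp add: l_minus)
        moreover have "\<ominus> y \<in> m" using y by simp
        ultimately show "\<ominus> u \<in> K'" unfolding K'_def by blast
      qed
      fix u x assume "u \<in> K'" and x: "x \<in> carrier R"
      then obtain y where y: "u = y \<otimes> a" "y \<in> m" by (auto simp: K'_def)
      have "x \<otimes> u = (x \<otimes> y) \<otimes> a" using y m.Icarr ac x by (simp add: m_assoc)
      moreover have "x \<otimes> y \<in> m" using y x by (intro m.I_l_closed)
      ultimately show "x \<otimes> u \<in> K'" unfolding K'_def by blast
      moreover have "u \<otimes> x = x \<otimes> u" using y m.Icarr ac x by (simp add: m_ac)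
      ultimately show "u \<otimes> x \<in> K'" by simp
    qed
    have "\<exists>b\<in>K'. \<exists>j\<in>J. b \<otimes> j \<noteq> \<zero>"
    proof (rule ccontr)
      assume "\<not> ?thesis"
      then have zero: "y \<otimes> a \<otimes> j = \<zero>" if "y \<in> m" "j \<in> J" for y j
        using that by (auto simp: K'_def)
      \<comment> \<open>If \<open>m a\<close> annihilated \<open>J\<close>, then \<open>a\<close>
        would annihilate \<open>m J = J\<close>, against \<open>a j \<noteq> 0\<close>.\<close>
      have "prd m \<subseteq> ann"
        unfolding prd_def
      proof (rule genideal_minimal[OF annI])
        show "{y \<otimes> j |y j. y \<in> m \<and> j \<in> J} \<subseteq> ann"
        proof
          fix z assume "z \<in> {y \<otimes> j |y j. y \<in> m \<and> j \<in> J}"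
          then obtain y j where z: "z = y \<otimes> j" "y \<in> m" "j \<in> J" by blast
          have c: "y \<in> carrier R" "j \<in> carrier R" using z m.Icarr J.Icarr by auto
          have "a \<otimes> z = y \<otimes> a \<otimes> j" using c ac z(1) by (simp add: m_ac)
          then show "z \<in> ann" using zero[OF z(2,3)] c z(1) by (simp add: ann_def)
        qed
      qed
      then show False using prd[OF m(1)] aj by (auto simp: ann_def)
    qed
    moreover have "K' \<subseteq> K" using aj(1) m.Icarr by (auto simp: K'_def intro: K.I_l_closed)
    ultimately have "K' = K" by (intro K_min K'I)
    then obtain y where y: "y \<in> m" "a = y \<otimes> a" using aj(1) by (auto simp: K'_def)
    have yc: "y \<in> carrier R" using y m.Icarr by simp
    \<comment> \<open>From \<open>a = y a\<close>, the element \<open>1 - y\<close> annihilates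
      \<open>a\<close> and so lies in \<open>m\<close>, together with \<open>y\<close>.\<close>
    have "a \<otimes> (\<one> \<ominus> y) = a \<ominus> y \<otimes> a" using ac yc by algebra
    also have "\<dots> = \<zero>" using y(2) ac by (simp add: minus_eq r_neg)
    finally have "\<one> \<ominus> y \<in> m" using m(2) yc by (auto simp: ann_def)
    then have "(\<one> \<ominus> y) \<oplus> y \<in> m" using y(1) by simp
    moreover have "(\<one> \<ominus> y) \<oplus> y = \<one>" using yc by algebra
    ultimately show False using m.one_imp_carrier m.I_notcarr by auto
  qed
  moreover obtain F where F: "F \<subseteq> A" "finite F" "\<forall>a\<in>A. \<exists>g\<in>Idl F. a \<ominus> g \<in> J"
    using J(3) by (auto simp: fg_modulo_def)
  ultimately have "A \<subseteq> Idl F"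
  proof -
    have Fc: "F \<subseteq> carrier R" using F(1) A.Icarr by auto
    show ?thesis
    proof
      fix a assume a: "a \<in> A"
      then obtain g where g: "g \<in> Idl F" "a \<ominus> g = \<zero>" using F(3) \<open>J \<subseteq> {\<zero>}\<close> by blast
      have gc: "g \<in> carrier R" using ideal.Icarr[OF genideal_ideal[OF Fc] g(1)] .
      have "a = a \<ominus> g \<oplus> g" using A.Icarr[OF a] gc by algebra
      then show "a \<in> Idl F" using g gc by simp
    qed
  qed
  then have "A = Idl F" using F(1) genideal_minimal[OF A F(1)] by blast
  then show "\<exists>F\<subseteq>carrier R. finite F \<and> A = Idl F" using F A.Icarr by blast
qed

end

subsection \<open>Finite modules over a subring\<close>

text \<open>The \<open>B\<close>-linear combinations of \<open>U\<close>, built one term at a time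
  so that closure properties follow by rule induction without finite sums.\<close>

inductive_set rspan :: "('a, 'b) ring_scheme \<Rightarrow> 'a set \<Rightarrow> 'a set \<Rightarrow> 'a set"
  for R :: "('a, 'b) ring_scheme" and B U where
  zero: "\<zero>\<^bsub>R\<^esub> \<in> rspan R B U"
| add_mult: "b \<in> B \<Longrightarrow> u \<in> U \<Longrightarrow> y \<in> rspan R B U \<Longrightarrow> b \<otimes>\<^bsub>R\<^esub> u \<oplus>\<^bsub>R\<^esub> y \<in> rspan R B U"

lemma rspan_mono: "U \<subseteq> V \<Longrightarrow> rspan R B U \<subseteq> rspan R B V"
proof
  fix x assume "U \<subseteq> V" "x \<in> rspan R B U"
  then show "x \<in> rspan R B V" by (induction rule: rspan.induct[consumes 1, OF \<open>x \<in> _\<close>]) (auto intro: rspan.intros)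
qed

text \<open>Closure under negatives is not demanded: over a subring it follows from multiplication
  by \<open>-1\<close>.\<close>

definition submodule_over :: "('a, 'b) ring_scheme \<Rightarrow> 'a set \<Rightarrow> 'a set \<Rightarrow> bool" where
  "submodule_over R B N \<longleftrightarrow> N \<subseteq> carrier R \<and> \<zero>\<^bsub>R\<^esub> \<in> N \<and> (\<forall>x\<in>N. \<forall>y\<in>N. x \<oplus>\<^bsub>R\<^esub> y \<in> N) \<and>
    (\<forall>b\<in>B. \<forall>x\<in>N. b \<otimes>\<^bsub>R\<^esub> x \<in> N)"

locale cring_subring = cring R for R (structure) + fixes B
  assumes B: "subring B R"
begin

lemmas B_closed = subringE[OF B]

lemma submodule_uminus: "submodule_over R B N \<Longrightarrow> x \<in> N \<Longrightarrow> \<ominus> x \<in> N"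
proof -
  assume N: "submodule_over R B N" "x \<in> N"
  then have "\<ominus> \<one> \<otimes> x \<in> N" using B_closed(3,5) by (auto simp: submodule_over_def)
  moreover have "\<ominus> \<one> \<otimes> x = \<ominus> x" using N by (auto simp: submodule_over_def l_minus)
  ultimately show ?thesis by simp
qed

lemma submodule_additive_subgroup: 
  assumes "submodule_over R B N"
  shows "additive_subgroup N R"
proof (rule additive_subgroup.intro, rule add.subgroupI)
  show "\<ominus> x \<in> N" if "x \<in> N" for x using submodule_uminus[OF assms that] .
qed (use assms in \<open>auto simp: submodule_over_def\<close>)

lemma rspan_subset: 
  assumes "submodule_over R B N" "U \<subseteq> N"
  shows "rspan R B U \<subseteq> N"
proof
  fix x assume "x \<in> rspan R B U"
  then show "x \<in> N" using assms by induction (auto simp: submodule_over_def)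
qed

lemma rspan_closed:
  assumes "U \<subseteq> carrier R"
  shows "rspan R B U \<subseteq> carrier R"
proof
  fix x assume "x \<in> rspan R B U"
  then show "x \<in> carrier R" using assms B_closed(1) by induction auto
qed

lemma rspan_map:
  assumes "U \<subseteq> carrier R" "V \<subseteq> carrier R" "z \<in> carrier R" "\<And>u. u \<in> U \<Longrightarrow> u \<otimes> z \<in> V" "y \<in> rspan R B U"
  shows "y \<otimes> z \<in> rspan R B V"
  using assms(5)
proof induction
  case zero
  then show ?case using assms(3) by (simp add: rspan.zero)
next
  case (add_mult b u y)
  have "b \<in> carrier R" "u \<in> carrier R" "y \<in> carrier R"
    using add_mult B_closed(1) assms(1) rspan_closed[OF assms(1)] by auto
  then have "(b \<otimes> u \<oplus> y) \<otimes> z = b \<otimes> (u \<otimes> z) \<oplus> y \<otimes> z"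
    using assms(3) by (simp add: l_distr m_assoc)
  then show ?case using add_mult assms(4) by (auto intro: rspan.add_mult)
qed

lemma rspan_submodule:
  assumes U: "U \<subseteq> carrier R"
  shows "submodule_over R B (rspan R B U)"
  unfolding submodule_over_def
proof (intro conjI ballI)
  note cl = subsetD[OF rspan_closed[OF U]]
  show "rspan R B U \<subseteq> carrier R" by (rule rspan_closed[OF U])
  show "x \<oplus> y \<in> rspan R B U" if "x \<in> rspan R B U" "y \<in> rspan R B U" for x y
    using that
  proof induction
    case (add_mult b u x)
    have "b \<in> carrier R" "u \<in> carrier R" "x \<in> carrier R" "y \<in> carrier R"
      using add_mult B_closed(1) U cl by auto
    then have "b \<otimes> u \<oplus> x \<oplus> y = b \<otimes> u \<oplus> (x \<oplus> y)" by (simp add: a_assoc)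
    then show ?case using add_mult by (auto intro: rspan.add_mult)
  qed (use cl in auto)
  show "c \<otimes> x \<in> rspan R B U" if "c \<in> B" "x \<in> rspan R B U" for c x
    using that(2)
  proof induction
    case zero
    have "c \<in> carrier R" using that(1) B_closed(1) by auto
    then show ?case by (simp add: rspan.zero)
  next
    case (add_mult b u x)
    have "b \<in> carrier R" "u \<in> carrier R" "x \<in> carrier R" "c \<in> carrier R"
      using add_mult B_closed(1) U cl that by auto
    then have "c \<otimes> (b \<otimes> u \<oplus> x) = (c \<otimes> b) \<otimes> u \<oplus> c \<otimes> x" by (simp add: r_distr m_assoc)
    then show ?case using add_mult B_closed(6)[OF that(1)] by (auto intro: rspan.add_mult)
  qed
qed (rule rspan.zero)

lemma rspan_incl: "u \<in> U \<Longrightarrow> U \<subseteq> carrier R \<Longrightarrow> u \<in> rspan R B U"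
  using rspan.add_mult[of \<one> B u U \<zero> R] rspan.zero[of R B U] B_closed(3) by auto

lemma rspan_insertE:
  assumes "x \<in> rspan R B (insert u U)" "insert u U \<subseteq> carrier R"
  shows "\<exists>b\<in>B. \<exists>w\<in>rspan R B U. x = b \<otimes> u \<oplus> w"
  using assms(1)
proof induction
  case zero
  then show ?case using assms(2) B_closed(2) by (intro bexI[of _ \<zero>]) (auto intro: rspan.zero)
next
  case (add_mult b v y)
  then obtain c w where cw: "c \<in> B" "w \<in> rspan R B U" "y = c \<otimes> u \<oplus> w" by blast
  have cl: "b \<in> carrier R" "c \<in> carrier R" "v \<in> carrier R" "u \<in> carrier R" "w \<in> carrier R"
    using add_mult cw B_closed(1) assms(2) rspan_closed[of U] by auto
  show ?case
  proof (cases "v = u")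
    case True
    have "b \<otimes> v \<oplus> y = (b \<oplus> c) \<otimes> u \<oplus> w" using cl by (simp add: cw(3) True l_distr a_assoc)
    then show ?thesis using cw add_mult(1) B_closed(7) by blast
  next
    case False
    then have "b \<otimes> v \<oplus> w \<in> rspan R B U" using add_mult cw by (auto intro: rspan.add_mult)
    moreover have "b \<otimes> v \<oplus> y = c \<otimes> u \<oplus> (b \<otimes> v \<oplus> w)" using cl by (simp add: cw(3) a_ac)
    ultimately show ?thesis using cw(1) by blast
  qed
qed

lemma ideal_subringI:
  assumes "submodule_over R B I" "I \<subseteq> B"
  shows "ideal I (R\<lparr>carrier := B\<rparr>)"
proof -
  interpret B: cring "R\<lparr>carrier := B\<rparr>"
    using subcring_iff[OF B_closed(1)] subcringI'[OF B] by simp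
  interpret I: additive_subgroup I R by (rule submodule_additive_subgroup[OF assms(1)])
  show ?thesis
  proof (rule idealI)
    show "subgroup I (add_monoid (R\<lparr>carrier := B\<rparr>))"
    proof (rule B.add.subgroupI)
      fix a assume a: "a \<in> I"
      have "\<ominus>\<^bsub>R\<lparr>carrier := B\<rparr>\<^esub> a = \<ominus> a"
      proof (rule B.minus_equality)
        show "\<ominus> a \<in> carrier (R\<lparr>carrier := B\<rparr>)" using a assms(2) B_closed(5) by auto
        show "a \<in> carrier (R\<lparr>carrier := B\<rparr>)" using a assms(2) by auto
        have "\<ominus> a \<oplus> a = \<zero>" using a assms(2) B_closed(1) by (auto intro!: l_neg)
        then show "\<ominus> a \<oplus>\<^bsub>R\<lparr>carrier := B\<rparr>\<^esub> a = \<zero>\<^bsub>R\<lparr>carrier := B\<rparr>\<^esub>" by simp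
      qed
      then show "\<ominus>\<^bsub>R\<lparr>carrier := B\<rparr>\<^esub> a \<in> I" using I.a_inv_closed[OF a] by simp
    next
      show "I \<noteq> {}" using additive_subgroup.zero_closed[OF I.additive_subgroup_axioms] by blast
    qed (use assms in \<open>auto simp: submodule_over_def\<close>)
    fix a x assume a: "a \<in> I" "x \<in> carrier (R\<lparr>carrier := B\<rparr>)"
    then have "x \<otimes> a \<in> I" "x \<otimes> a = a \<otimes> x"
      using assms B_closed(1) by (auto simp: submodule_over_def intro!: m_comm)
    then show "x \<otimes>\<^bsub>R\<lparr>carrier := B\<rparr>\<^esub> a \<in> I" "a \<otimes>\<^bsub>R\<lparr>carrier := B\<rparr>\<^esub> x \<in> I" by simp_all
  qed (rule B.ring_axioms)
qed

text \<open>Induction on the generators. The coefficients of \<open>u\<close> in elements of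
  \<open>N\<close> form an ideal \<open>I\<close> of \<open>B\<close>; lifting finitely many
  generators of \<open>I\<close> to elements of \<open>N\<close> reduces any element of
  \<open>N\<close> to one in the span of \<open>U\<close>, where the induction hypothesis
  applies.\<close>

lemma fg_submodule:
  assumes noeth: "noetherian_ring (R\<lparr>carrier := B\<rparr>)"
    and "finite U" "U \<subseteq> carrier R" "submodule_over R B N" "N \<subseteq> rspan R B U"
  shows "\<exists>F\<subseteq>N. finite F \<and> N \<subseteq> rspan R B F"
  using assms(2-)
proof (induction U arbitrary: N rule: finite_induct)
  case empty
  have "rspan R B {} \<subseteq> {\<zero>}"
    by (rule rspan_subset) (use B_closed(1) in \<open>auto simp: submodule_over_def\<close>)
  then have "N \<subseteq> rspan R B {}" using empty rspan.zero[of R B "{}"] by auto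
  then show ?case by (intro exI[of _ "{}"]) auto
next
  case (insert u U)
  note N = insert.prems(2)[unfolded submodule_over_def]
  have Uc: "U \<subseteq> carrier R" "u \<in> carrier R" using insert.prems by auto
  note span = rspan_submodule[OF Uc(1), unfolded submodule_over_def]
  define I where "I = {b \<in> B. \<exists>w\<in>rspan R B U. b \<otimes> u \<oplus> w \<in> N}"
  have "submodule_over R B I"
    unfolding submodule_over_def
  proof (intro conjI ballI)
    show "I \<subseteq> carrier R" using B_closed(1) by (auto simp: I_def)
    have "\<zero> \<otimes> u \<oplus> \<zero> \<in> N" using N Uc by simp
    then show "\<zero> \<in> I" using B_closed(2) rspan.zero unfolding I_def by blast
    fix x assume "x \<in> I"
    then obtain w where x: "x \<in> B" "w \<in> rspan R B U" "x \<otimes> u \<oplus> w \<in> N" by (auto simp: I_def)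
    have cl: "x \<in> carrier R" "w \<in> carrier R" using x B_closed(1) span by auto
    show "x \<oplus> y \<in> I" if "y \<in> I" for y
    proof -
      from that obtain v where y: "y \<in> B" "v \<in> rspan R B U" "y \<otimes> u \<oplus> v \<in> N" by (auto simp: I_def)
      have "y \<in> carrier R" "v \<in> carrier R" using y B_closed(1) span by auto
      then have "(x \<otimes> u \<oplus> w) \<oplus> (y \<otimes> u \<oplus> v) = (x \<oplus> y) \<otimes> u \<oplus> (w \<oplus> v)"
        using cl Uc by (simp add: l_distr a_ac)
      moreover have "(x \<otimes> u \<oplus> w) \<oplus> (y \<otimes> u \<oplus> v) \<in> N" using N x(3) y(3) by blast
      moreover have "w \<oplus> v \<in> rspan R B U" using span x(2) y(2) by blast
      ultimately show ?thesis using B_closed(7)[OF x(1) y(1)] unfolding I_def by auto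
    qed
    show "b \<otimes> x \<in> I" if "b \<in> B" for b
    proof -
      have "b \<in> carrier R" using that B_closed(1) by auto
      then have "b \<otimes> (x \<otimes> u \<oplus> w) = b \<otimes> x \<otimes> u \<oplus> b \<otimes> w" using cl Uc by (simp add: r_distr m_assoc)
      moreover have "b \<otimes> (x \<otimes> u \<oplus> w) \<in> N" using N x(3) that by blast
      moreover have "b \<otimes> w \<in> rspan R B U" using span x(2) that by blast
      ultimately show ?thesis using B_closed(6)[OF that x(1)] unfolding I_def by auto
    qed
  qed
  then have "ideal I (R\<lparr>carrier := B\<rparr>)" by (rule ideal_subringI) (auto simp: I_def)
  then obtain G where G: "G \<subseteq> B" "finite G" "I = Idl\<^bsub>R\<lparr>carrier := B\<rparr>\<^esub> G"
    using noetherian_ring.finetely_gen[OF noeth] by force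
  have "G \<subseteq> I" using ring.genideal_self[OF noetherian_ring.axioms(1)[OF noeth], of G] G by simp
  then have "\<forall>g\<in>G. \<exists>w. w \<in> rspan R B U \<and> g \<otimes> u \<oplus> w \<in> N" by (auto simp: I_def)
  then obtain w where w: "\<And>g. g \<in> G \<Longrightarrow> w g \<in> rspan R B U" "\<And>g. g \<in> G \<Longrightarrow> g \<otimes> u \<oplus> w g \<in> N" by metis
  define a where "a g = g \<otimes> u \<oplus> w g" for g
  have aN: "a ` G \<subseteq> N" using w(2) by (auto simp: a_def)
  then have ac: "a ` G \<subseteq> carrier R" using N by blast
  note aspan = rspan_submodule[OF ac, unfolded submodule_over_def]
  \<comment> \<open>The coefficients of \<open>u\<close> reached by the span of the lifted elements.
    They form an ideal containing the generators \<open>G\<close>, hence all of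
    \<open>I\<close>.\<close>
  define I' where "I' = {b \<in> B. \<exists>z\<in>rspan R B (a ` G). \<exists>v\<in>rspan R B U. z = b \<otimes> u \<oplus> v}"
  have "submodule_over R B I'"
    unfolding submodule_over_def
  proof (intro conjI ballI)
    show "I' \<subseteq> carrier R" using B_closed(1) by (auto simp: I'_def)
    have "\<zero> = \<zero> \<otimes> u \<oplus> \<zero>" using Uc by simp
    then show "\<zero> \<in> I'" using B_closed(2) rspan.zero unfolding I'_def by blast
    fix x assume "x \<in> I'"
    then obtain v where x: "x \<in> B" "v \<in> rspan R B U" "x \<otimes> u \<oplus> v \<in> rspan R B (a ` G)" by (auto simp: I'_def)
    have cl: "x \<in> carrier R" "v \<in> carrier R" using x B_closed(1) span by auto
    show "x \<oplus> y \<in> I'" if "y \<in> I'" for y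
    proof -
      from that obtain v' where y: "y \<in> B" "v' \<in> rspan R B U" "y \<otimes> u \<oplus> v' \<in> rspan R B (a ` G)"
        by (auto simp: I'_def)
      have "y \<in> carrier R" "v' \<in> carrier R" using y B_closed(1) span by auto
      then have "(x \<otimes> u \<oplus> v) \<oplus> (y \<otimes> u \<oplus> v') = (x \<oplus> y) \<otimes> u \<oplus> (v \<oplus> v')"
        using cl Uc by (simp add: l_distr a_ac)
      moreover have "(x \<otimes> u \<oplus> v) \<oplus> (y \<otimes> u \<oplus> v') \<in> rspan R B (a ` G)" using aspan x(3) y(3) by blast
      moreover have "v \<oplus> v' \<in> rspan R B U" using span x(2) y(2) by blast
      ultimately show ?thesis using B_closed(7)[OF x(1) y(1)] unfolding I'_def by auto
    qed
    show "b \<otimes> x \<in> I'" if "b \<in> B" for b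
    proof -
      have "b \<in> carrier R" using that B_closed(1) by auto
      then have "b \<otimes> (x \<otimes> u \<oplus> v) = b \<otimes> x \<otimes> u \<oplus> b \<otimes> v" using cl Uc by (simp add: r_distr m_assoc)
      moreover have "b \<otimes> (x \<otimes> u \<oplus> v) \<in> rspan R B (a ` G)" using aspan x(3) that by blast
      moreover have "b \<otimes> v \<in> rspan R B U" using span x(2) that by blast
      ultimately show ?thesis using B_closed(6)[OF that x(1)] unfolding I'_def by auto
    qed
  qed
  then have "ideal I' (R\<lparr>carrier := B\<rparr>)" by (rule ideal_subringI) (auto simp: I'_def)
  moreover have "G \<subseteq> I'"
  proof
    fix g assume g: "g \<in> G"
    then have "a g \<in> rspan R B (a ` G)" using ac by (intro rspan_incl) auto
    then show "g \<in> I'" using g G(1) w(1) unfolding I'_def a_def by blast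
  qed
  ultimately have I_sub: "I \<subseteq> I'"
    unfolding G(3) by (rule ring.genideal_minimal[OF noetherian_ring.axioms(1)[OF noeth]])
  have "submodule_over R B (N \<inter> rspan R B U)"
    using N span unfolding submodule_over_def by blast
  then obtain F where F: "F \<subseteq> N \<inter> rspan R B U" "finite F" "N \<inter> rspan R B U \<subseteq> rspan R B F"
    using insert.IH[OF Uc(1)] by blast
  have FU: "F \<union> a ` G \<subseteq> carrier R" using F(1) N ac by blast
  show ?case
  proof (intro exI[of _ "F \<union> a ` G"] conjI)
    show "F \<union> a ` G \<subseteq> N" using F aN by blast
    show "finite (F \<union> a ` G)" using F G by simp
    show "N \<subseteq> rspan R B (F \<union> a ` G)"
    proof
      fix x assume x: "x \<in> N"
      then obtain b v where bv: "b \<in> B" "v \<in> rspan R B U" "x = b \<otimes> u \<oplus> v"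
        using rspan_insertE[of x u U] insert.prems by blast
      then have "b \<in> I" using x by (auto simp: I_def)
      then obtain z v' where z: "z \<in> rspan R B (a ` G)" "v' \<in> rspan R B U" "z = b \<otimes> u \<oplus> v'"
        using I_sub by (auto simp: I'_def)
      have cl: "b \<in> carrier R" "v \<in> carrier R" "v' \<in> carrier R"
        using bv z B_closed(1) span by auto
      have zN: "z \<in> N" using z(1) rspan_subset[OF insert.prems(2) aN] by blast
      have "x \<ominus> z = v \<ominus> v'" using cl Uc unfolding bv(3) z(3) by algebra
      moreover have "\<ominus> v' \<in> rspan R B U" using submodule_uminus[OF rspan_submodule[OF Uc(1)] z(2)] .
      then have "v \<ominus> v' \<in> rspan R B U" using span bv(2) unfolding minus_eq by blast
      moreover have "\<ominus> z \<in> N" using submodule_uminus[OF insert.prems(2) zN] .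
      then have "x \<ominus> z \<in> N" using N x unfolding minus_eq by blast
      ultimately have "x \<ominus> z \<in> rspan R B F" using F(3) by auto
      then have "x \<ominus> z \<in> rspan R B (F \<union> a ` G)" using rspan_mono[of F "F \<union> a ` G" R B] by blast
      moreover have "z \<in> rspan R B (F \<union> a ` G)" using z(1) rspan_mono[of "a ` G" "F \<union> a ` G" R B] by blast
      ultimately have "(x \<ominus> z) \<oplus> z \<in> rspan R B (F \<union> a ` G)"
        using rspan_submodule[OF FU] unfolding submodule_over_def by blast
      moreover have "x \<in> carrier R" "z \<in> carrier R" using N x zN by auto
      then have "(x \<ominus> z) \<oplus> z = x" by algebra
      ultimately show "x \<in> rspan R B (F \<union> a ` G)" by simp
    qed
  qed
qed

subsection \<open>Integral extensions of Artinian rings\<close>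

text \<open>Adjoins the elements of \<open>G\<close> one by one: for a new \<open>x\<close> with an
  integral equation of degree \<open>k\<close>, the generators are multiplied by
  \<open>1, x, ..., x ^ (k - 1)\<close>, and the equation rewrites \<open>x ^ k\<close>. The
  statement speaks of a stable span containing \<open>\<one>\<close> because this form survives the
  induction.\<close>

lemma integral_span:
  assumes int: "integral_over R B" and nontriv: "\<one> \<noteq> \<zero>" and "finite G" "G \<subseteq> carrier R"
  shows "\<exists>U\<subseteq>carrier R. finite U \<and> \<one> \<in> rspan R B U \<and> (\<forall>g\<in>G. \<forall>w\<in>rspan R B U. g \<otimes> w \<in> rspan R B U)"
  using assms(3,4)
proof (induction G rule: finite_induct)
  case empty
  show ?case
    by (rule exI[of _ "{\<one>}"]) (auto intro!: rspan_incl)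
next
  case (insert x G)
  then obtain U where U: "U \<subseteq> carrier R" "finite U" "\<one> \<in> rspan R B U"
    "\<And>g w. g \<in> G \<Longrightarrow> w \<in> rspan R B U \<Longrightarrow> g \<otimes> w \<in> rspan R B U" by auto
  have xc: "x \<in> carrier R" and Gc: "G \<subseteq> carrier R" using insert.prems by auto
  obtain k :: nat and a :: "nat \<Rightarrow> 'a"
    where ka: "\<forall>i<k. a i \<in> B" "x [^] k \<oplus> (\<Oplus>i\<in>{..<k}. a i \<otimes> x [^] i) = \<zero>"
    using int xc unfolding integral_over_def by blast
  \<comment> \<open>For \<open>k = 0\<close> the integral equation would read
    \<open>1 = 0\<close>.\<close>
  have kpos: "k > 0"
  proof (rule ccontr)
    assume "\<not> k > 0"
    then show False using ka(2) nontriv by simp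
  qed
  define V where "V = (\<lambda>(u, i). u \<otimes> x [^] i) ` (U \<times> {..<k})"
  have Vc: "V \<subseteq> carrier R" using U(1) xc by (auto simp: V_def)
  have VI: "u \<otimes> x [^] i \<in> V" if "u \<in> U" "i < k" for u i
    using that by (auto simp: V_def)
  note Vspan = rspan_submodule[OF Vc]
  have pow: "w \<otimes> x [^] i \<in> rspan R B V" if "w \<in> rspan R B U" "i < k" for w i
    by (rule rspan_map[OF U(1) Vc _ _ that(1)]) (use xc VI that in auto)
  have xk: "u \<otimes> x [^] k \<in> rspan R B V" if u: "u \<in> U" for u
  proof -
    define s where "s = (\<Oplus>i\<in>{..<k}. a i \<otimes> x [^] i)"
    have ac: "a i \<in> carrier R" if "i < k" for i using ka(1) that B_closed(1) by auto
    have sc: "s \<in> carrier R" unfolding s_def using ac xc by (intro finsum_closed) auto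
    have uc: "u \<in> carrier R" using u U(1) by auto
    have "u \<otimes> s = (\<Oplus>i\<in>{..<k}. u \<otimes> (a i \<otimes> x [^] i))"
      unfolding s_def using ac xc uc by (intro finsum_rdistr) auto
    also have "\<dots> \<in> rspan R B V"
    proof (rule finsum_in_subgroup[OF submodule_additive_subgroup[OF Vspan]])
      fix i assume i: "i \<in> {..<k}"
      have "u \<otimes> (a i \<otimes> x [^] i) = a i \<otimes> (u \<otimes> x [^] i)" using ac i xc uc by (simp add: m_lcomm)
      then show "u \<otimes> (a i \<otimes> x [^] i) \<in> rspan R B V"
        using Vspan rspan_incl[OF VI[OF u] Vc, of i] ka(1) i unfolding submodule_over_def by simp
    qed
    finally have "\<ominus> (u \<otimes> s) \<in> rspan R B V" by (rule submodule_uminus[OF Vspan])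
    moreover have "x [^] k = \<ominus> s"
      using ka(2) xc sc by (simp add: s_def[symmetric] minus_equality)
    ultimately show ?thesis using uc sc by (simp add: r_minus)
  qed
  show ?case
  proof (intro exI[of _ V] conjI ballI)
    show "finite V" using U(2) by (simp add: V_def)
    show "\<one> \<in> rspan R B V" using pow[OF U(3), of 0] kpos by simp
    fix g w assume g: "g \<in> insert x G" and w: "w \<in> rspan R B V"
    have gc: "g \<in> carrier R" using g xc Gc by auto
    have "w \<otimes> g \<in> rspan R B V"
      using w
    proof induction
      case zero
      then show ?case using gc by (simp add: rspan.zero)
    next
      case (add_mult b v y)
      obtain u i where ui: "v = u \<otimes> x [^] i" "u \<in> U" "i < k" using add_mult(2) by (auto simp: V_def)
      have cl: "b \<in> carrier R" "u \<in> carrier R" "y \<in> carrier R"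
        using add_mult ui B_closed(1) U(1) rspan_closed[OF Vc] by auto
      have "g \<otimes> v \<in> rspan R B V"
      proof (cases "g = x")
        case True
        have "g \<otimes> v = u \<otimes> x [^] Suc i" using cl xc by (simp add: True ui(1) m_ac)
        then show ?thesis
          using xk[OF ui(2)] rspan_incl[OF VI[OF ui(2)] Vc, of "Suc i"] ui(3) by (cases "Suc i = k") auto
      next
        case False
        then have "g \<in> G" using g by simp
        then have "g \<otimes> u \<in> rspan R B U" by (intro U(4) rspan_incl ui U(1))
        then have "g \<otimes> u \<otimes> x [^] i \<in> rspan R B V" by (intro pow ui(3))
        then show ?thesis using gc cl xc by (simp add: ui(1) m_assoc)
      qed
      then have "b \<otimes> (g \<otimes> v) \<oplus> y \<otimes> g \<in> rspan R B V"
        using Vspan add_mult unfolding submodule_over_def by blast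
      moreover have "v \<in> carrier R" using cl xc by (simp add: ui(1))
      then have "(b \<otimes> v \<oplus> y) \<otimes> g = b \<otimes> (g \<otimes> v) \<oplus> y \<otimes> g"
        using cl gc by (simp add: l_distr m_assoc m_comm[of g v])
      ultimately show ?case by simp
    qed
    moreover have "w \<in> carrier R" using w rspan_closed[OF Vc] by auto
    ultimately show "g \<otimes> w \<in> rspan R B V" using gc by (simp add: m_comm)
  qed (rule Vc)
qed

text \<open>The elements that multiply the span into itself form a subring \<open>T\<close>
  containing \<open>B\<close> and \<open>G\<close>, hence \<open>A\<close>; applying them to
  \<open>\<one>\<close> places \<open>A\<close> in the span.\<close>

lemma fg_subalgebra_span:
  assumes int: "integral_over R B" and nontriv: "\<one> \<noteq> \<zero>" and A: "A \<in> fg_subalgebras R B"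
  shows "\<exists>U\<subseteq>carrier R. finite U \<and> A \<subseteq> rspan R B U"
proof -
  obtain G where G: "finite G" "G \<subseteq> carrier R" "A = generate_ring R (B \<union> G)"
    using A by (auto simp: fg_subalgebras_def)
  obtain U where U: "U \<subseteq> carrier R" "finite U" "\<one> \<in> rspan R B U"
    "\<And>g w. g \<in> G \<Longrightarrow> w \<in> rspan R B U \<Longrightarrow> g \<otimes> w \<in> rspan R B U"
    using integral_span[OF int nontriv G(1,2)] by blast
  note span = rspan_submodule[OF U(1)]
  define T where "T = {y \<in> carrier R. \<forall>w\<in>rspan R B U. y \<otimes> w \<in> rspan R B U}"
  have wc: "w \<in> carrier R" if "w \<in> rspan R B U" for w using that rspan_closed[OF U(1)] by auto
  have "subring T R"
  proof (rule subringI)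
    show "T \<subseteq> carrier R" by (auto simp: T_def)
    show "\<one> \<in> T" using wc by (auto simp: T_def)
    fix h assume h: "h \<in> T"
    then show "\<ominus> h \<in> T" using submodule_uminus[OF span] wc by (auto simp: T_def l_minus)
    fix h' assume h': "h' \<in> T"
    show "h \<otimes> h' \<in> T" using h h' wc by (auto simp: T_def m_assoc)
    show "h \<oplus> h' \<in> T" using h h' wc span by (auto simp: T_def l_distr submodule_over_def)
  qed
  moreover have "B \<union> G \<subseteq> T"
    using span U(4) G(2) B_closed(1) by (auto simp: T_def submodule_over_def)
  ultimately have "A \<subseteq> T"
    unfolding G(3) using G(2) B_closed(1) by (intro generate_ring_min_subring1) auto
  have "y \<in> rspan R B U" if "y \<in> A" for y
  proof -
    have y: "y \<in> T" using that \<open>A \<subseteq> T\<close> by auto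
    then have "y \<otimes> \<one> \<in> rspan R B U" using U(3) unfolding T_def by blast
    then show ?thesis using y by (simp add: T_def)
  qed
  then show ?thesis using U(1,2) by blast
qed

end

locale integral_over_artinian = cring_subring +
  assumes one_not_zero: "\<one> \<noteq> \<zero>"
    and artinian_B: "artinian_ring (R\<lparr>carrier := B\<rparr>)"
    and integral_B: "integral_over R B"
begin

lemma B_artinian: "artinian (R\<lparr>carrier := B\<rparr>)"
  using artinian_B unfolding artinian_ring_def artinian_def artinian_axioms_def by simp

text \<open>This finiteness controls the infinitely many coefficients of a single series: all those
  lying in \<open>M\<close> are combinations of the same finitely many elements of
  \<open>M\<close>.\<close>

lemma fg_subalgebra_Int_ideal:
  assumes "ideal M R" "A \<in> fg_subalgebras R B"
  shows "\<exists>F\<subseteq>A \<inter> M. finite F \<and> A \<inter> M \<subseteq> rspan R B F"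
proof -
  interpret M: ideal M R by fact
  obtain G where G: "finite G" "G \<subseteq> carrier R" "A = generate_ring R (B \<union> G)"
    using assms(2) by (auto simp: fg_subalgebras_def)
  have A: "subring A R" unfolding G(3) using G(2) B_closed(1) by (intro generate_ring_is_subring) auto
  have BA: "B \<subseteq> A" unfolding G(3) by (auto intro: generate_ring.incl)
  obtain U where U: "U \<subseteq> carrier R" "finite U" "A \<subseteq> rspan R B U"
    using fg_subalgebra_span[OF integral_B one_not_zero assms(2)] by blast
  have "submodule_over R B (A \<inter> M)"
    unfolding submodule_over_def
  proof (intro conjI ballI)
    fix b x assume bx: "b \<in> B" "x \<in> A \<inter> M"
    then have "b \<otimes> x \<in> M" using B_closed(1) by (intro M.I_l_closed) auto
    then show "b \<otimes> x \<in> A \<inter> M" using bx BA subringE(6)[OF A] by auto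
  qed (use subringE[OF A] additive_subgroup.zero_closed[OF M.is_additive_subgroup] in auto)
  then show ?thesis
    using U by (intro fg_submodule[OF artinian.noetherian[OF B_artinian], of U]) auto
qed

text \<open>The ideals \<open>r ^ k B\<close> descend and become stationary, so
  \<open>r ^ N = r ^ (N + 1) s\<close>. Then \<open>r ^ N (r s - 1) = 0\<close> lies in the prime
  \<open>M\<close>, which contains no power of \<open>r\<close>.\<close>

lemma inverse_mod_prime_B:
  assumes "primeideal M R" "r \<in> B" "r \<notin> M"
  shows "\<exists>s\<in>B. r \<otimes> s \<ominus> \<one> \<in> M"
proof -
  interpret M: primeideal M R by fact
  have rc: "r \<in> carrier R" using assms(2) B_closed(1) by auto
  have powB: "r [^] k \<in> B" for k :: nat
    using assms(2) B_closed(3,6) by (induction k) auto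
  define I where "I k = {r [^] k \<otimes> s | s. s \<in> B}" for k :: nat
  have I: "ideal (I k) (R\<lparr>carrier := B\<rparr>)" for k
  proof (rule ideal_subringI)
    show "I k \<subseteq> B" using powB B_closed(6) by (auto simp: I_def)
    show "submodule_over R B (I k)"
      unfolding submodule_over_def
    proof (intro conjI ballI)
      show "I k \<subseteq> carrier R" using powB B_closed(1,6) by (auto simp: I_def)
      have "\<zero> = r [^] k \<otimes> \<zero>" using rc by simp
      then show "\<zero> \<in> I k" using B_closed(2) unfolding I_def by blast
      fix x assume "x \<in> I k"
      then obtain s where s: "x = r [^] k \<otimes> s" "s \<in> B" by (auto simp: I_def)
      have sc: "s \<in> carrier R" using s(2) B_closed(1) by auto
      show "b \<otimes> x \<in> I k" if "b \<in> B" for b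
      proof -
        have "b \<in> carrier R" using that B_closed(1) by auto
        then have "b \<otimes> x = r [^] k \<otimes> (b \<otimes> s)" using sc rc by (simp add: s(1) m_lcomm)
        then show ?thesis using B_closed(6)[OF that s(2)] unfolding I_def by blast
      qed
      fix y assume "y \<in> I k"
      then obtain t where t: "y = r [^] k \<otimes> t" "t \<in> B" by (auto simp: I_def)
      have "t \<in> carrier R" using t(2) B_closed(1) by auto
      then have "x \<oplus> y = r [^] k \<otimes> (s \<oplus> t)" using sc rc by (simp add: s(1) t(1) r_distr)
      then show "x \<oplus> y \<in> I k" using B_closed(7)[OF s(2) t(2)] unfolding I_def by blast
    qed
  qed
  have "I (Suc k) \<subseteq> I k" for k
  proof
    fix x assume "x \<in> I (Suc k)"
    then obtain s where s: "x = r [^] Suc k \<otimes> s" "s \<in> B" by (auto simp: I_def)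
    have "s \<in> carrier R" using s(2) B_closed(1) by auto
    then have "x = r [^] k \<otimes> (r \<otimes> s)" using rc by (simp add: s(1) m_assoc)
    then show "x \<in> I k" using B_closed(6)[OF assms(2) s(2)] unfolding I_def by blast
  qed
  then have desc: "\<forall>k. ideal (I k) (R\<lparr>carrier := B\<rparr>) \<and> I (Suc k) \<subseteq> I k" using I by blast
  from artinian_B[unfolded artinian_ring_def] desc have "\<exists>N. \<forall>k\<ge>N. I k = I N"
    by (elim conjE allE[of _ I] impE)
  then obtain N where "\<forall>k\<ge>N. I k = I N" ..
  then have eq: "I (Suc N) = I N" by (rule allE[of _ "Suc N"]) simp
  have "r [^] N \<otimes> \<one> \<in> I N" using B_closed(3) unfolding I_def by blast
  then have "r [^] N \<otimes> \<one> \<in> I (Suc N)" using eq by simp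
  then obtain s where s: "r [^] N \<otimes> \<one> = r [^] Suc N \<otimes> s" "s \<in> B" unfolding I_def by blast
  have sc: "s \<in> carrier R" using s(2) B_closed(1) by auto
  have "r [^] N \<otimes> (r \<otimes> s \<ominus> \<one>) = r [^] Suc N \<otimes> s \<ominus> r [^] N \<otimes> \<one>"
    using rc sc by (simp add: minus_eq r_distr r_minus m_assoc)
  also have "\<dots> = \<zero>" using s(1) rc by (simp add: minus_eq r_neg)
  finally have "r [^] N \<otimes> (r \<otimes> s \<ominus> \<one>) \<in> M"
    using additive_subgroup.zero_closed[OF M.is_additive_subgroup] by simp
  then have "r [^] N \<in> M \<or> r \<otimes> s \<ominus> \<one> \<in> M" using rc sc by (intro M.I_prime) auto
  moreover have "r [^] k \<notin> M" for k :: nat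
  proof (induction k)
    case 0
    then show ?case using M.one_imp_carrier M.I_notcarr by auto
  next
    case (Suc k)
    then show ?case using M.I_prime[of "r [^] k" r] rc assms(3) by auto
  qed
  ultimately show ?thesis using s(2) by blast
qed

text \<open>Induction on the degree of a relation for \<open>x\<close> with some coefficient
  \<open>a j\<close> outside \<open>M\<close>. If \<open>a 0\<close> is in \<open>M\<close>, the
  factor \<open>x\<close> cancels, but only modulo \<open>M\<close>; hence the relation is required
  merely modulo \<open>M\<close>. Otherwise \<open>a 0\<close> has an inverse \<open>s\<close>
  modulo \<open>M\<close> in \<open>B\<close>, and \<open>x z + a 0\<close> in \<open>M\<close>
  makes \<open>- z s\<close> an inverse of \<open>x\<close>.\<close>

lemma inverse_mod_prime_aux:
  fixes a :: "nat \<Rightarrow> 'a"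
  assumes M: "primeideal M R" and A: "subring A R" "B \<subseteq> A" and x: "x \<in> A" "x \<notin> M"
  shows "(\<And>i. i \<le> k \<Longrightarrow> a i \<in> B) \<Longrightarrow> j \<le> k \<Longrightarrow> a j \<notin> M \<Longrightarrow> (\<Oplus>i\<in>{..k}. a i \<otimes> x [^] i) \<in> M \<Longrightarrow>
    \<exists>y\<in>A. x \<otimes> y \<ominus> \<one> \<in> M"
proof (induction k arbitrary: a j)
  interpret M: primeideal M R by fact
  note Asub = subringE[OF A(1)]
  have xc: "x \<in> carrier R" using x Asub(1) by auto
  have pow: "x [^] i \<in> A" for i :: nat using x Asub(3,6) by (induction i) auto
  case 0
  then show ?case using B_closed(1) by auto
next
  interpret M: primeideal M R by fact
  note Asub = subringE[OF A(1)]
  have xc: "x \<in> carrier R" using x Asub(1) by auto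
  have pow: "x [^] i \<in> A" for i :: nat using x Asub(3,6) by (induction i) auto
  case (Suc k)
  have ac: "a i \<in> carrier R" if "i \<le> Suc k" for i using Suc.prems(1)[OF that] B_closed(1) by auto
  define z where "z = (\<Oplus>i\<in>{..k}. a (Suc i) \<otimes> x [^] i)"
  have zA: "z \<in> A"
    unfolding z_def
  proof (rule finsum_in_subgroup)
    show "additive_subgroup A R" using subring.axioms(1)[OF A(1)] by (rule additive_subgroup.intro)
    show "a (Suc i) \<otimes> x [^] i \<in> A" if "i \<in> {..k}" for i
      using that Suc.prems(1)[of "Suc i"] A(2) pow by (intro Asub(6)) auto
  qed
  have zc: "z \<in> carrier R" using zA Asub(1) by auto
  have "(\<Oplus>i\<in>{..Suc k}. a i \<otimes> x [^] i) = (\<Oplus>i\<in>{..k}. a (Suc i) \<otimes> x [^] Suc i) \<oplus> a 0 \<otimes> x [^] (0::nat)"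
    using ac xc by (intro finsum_Suc2) auto
  also have "(\<Oplus>i\<in>{..k}. a (Suc i) \<otimes> x [^] Suc i) = (\<Oplus>i\<in>{..k}. x \<otimes> (a (Suc i) \<otimes> x [^] i))"
    using ac xc by (intro finsum_cong') (auto simp: m_ac)
  also have "\<dots> = x \<otimes> z"
    unfolding z_def using ac xc by (intro finsum_rdistr[symmetric]) auto
  finally have eq: "(\<Oplus>i\<in>{..Suc k}. a i \<otimes> x [^] i) = x \<otimes> z \<oplus> a 0" using ac by simp
  then have mem: "x \<otimes> z \<oplus> a 0 \<in> M" using Suc.prems(4) by simp
  have a0c: "a 0 \<in> carrier R" using ac by simp
  show ?case
  proof (cases "a 0 \<in> M")
    case True
    then have "(x \<otimes> z \<oplus> a 0) \<oplus> \<ominus> (a 0) \<in> M" using mem by simp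
    moreover have "(x \<otimes> z \<oplus> a 0) \<oplus> \<ominus> (a 0) = x \<otimes> z" using xc zc a0c by algebra
    ultimately have "z \<in> M" using M.I_prime[OF xc zc] x(2) by auto
    moreover obtain i where "j = Suc i" using True Suc.prems(3) by (cases j) auto
    ultimately show ?thesis
      using Suc.IH[of "\<lambda>i. a (Suc i)" i] Suc.prems by (auto simp: z_def)
  next
    case False
    then obtain s where s: "s \<in> B" "a 0 \<otimes> s \<ominus> \<one> \<in> M"
      using inverse_mod_prime_B[OF M Suc.prems(1)[of 0]] by auto
    have sc: "s \<in> carrier R" using s(1) B_closed(1) by auto
    have "(\<ominus> s) \<otimes> (x \<otimes> z \<oplus> a 0) \<in> M" using sc by (intro M.I_l_closed mem) simp
    then have "(\<ominus> s) \<otimes> (x \<otimes> z \<oplus> a 0) \<oplus> (a 0 \<otimes> s \<ominus> \<one>) \<in> M"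
      using s(2) by (rule additive_subgroup.a_closed[OF M.is_additive_subgroup])
    moreover have "(\<ominus> s) \<otimes> (x \<otimes> z \<oplus> a 0) \<oplus> (a 0 \<otimes> s \<ominus> \<one>) = x \<otimes> (\<ominus> (z \<otimes> s)) \<ominus> \<one>"
      using xc zc sc a0c by algebra
    moreover have "\<ominus> (z \<otimes> s) \<in> A" using zA s(1) A(2) by (intro Asub(5,6)) auto
    ultimately show ?thesis by auto
  qed
qed

lemma inverse_mod_prime:
  assumes M: "primeideal M R" and A: "subring A R" "B \<subseteq> A" and x: "x \<in> A" "x \<notin> M"
  shows "\<exists>y\<in>A. x \<otimes> y \<ominus> \<one> \<in> M"
proof -
  interpret M: primeideal M R by fact
  have xc: "x \<in> carrier R" using x subringE(1)[OF A(1)] by auto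
  obtain k :: nat and a :: "nat \<Rightarrow> 'a"
    where ka: "\<forall>i<k. a i \<in> B" "x [^] k \<oplus> (\<Oplus>i\<in>{..<k}. a i \<otimes> x [^] i) = \<zero>"
    using integral_B xc unfolding integral_over_def by blast
  \<comment> \<open>The integral equation with its leading coefficient made explicit; that
    coefficient is \<open>\<one>\<close>, which is outside \<open>M\<close>.\<close>
  define b where "b i = (if i = k then \<one> else a i)" for i
  have ac: "a i \<in> carrier R" if "i < k" for i using ka(1) that B_closed(1) by auto
  have "{..k} = insert k {..<k}" by auto
  then have "(\<Oplus>i\<in>{..k}. b i \<otimes> x [^] i) = b k \<otimes> x [^] k \<oplus> (\<Oplus>i\<in>{..<k}. b i \<otimes> x [^] i)"
    using ac xc by (simp only:) (intro finsum_insert, auto simp: b_def)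
  also have "(\<Oplus>i\<in>{..<k}. b i \<otimes> x [^] i) = (\<Oplus>i\<in>{..<k}. a i \<otimes> x [^] i)"
    using ac xc by (intro finsum_cong') (auto simp: b_def)
  also have "b k \<otimes> x [^] k \<oplus> \<dots> = \<zero>" using ka(2) xc by (simp add: b_def)
  finally have "(\<Oplus>i\<in>{..k}. b i \<otimes> x [^] i) \<in> M"
    using additive_subgroup.zero_closed[OF M.is_additive_subgroup] by simp
  moreover have "b k \<notin> M" using M.one_imp_carrier M.I_notcarr by (auto simp: b_def)
  moreover have "b i \<in> B" if "i \<le> k" for i using ka(1) that B_closed(3) by (auto simp: b_def)
  ultimately show ?thesis using inverse_mod_prime_aux[OF M A x, of k b k] by simp
qed

end

subsection \<open>Transport along ring homomorphisms\<close>

lemma (in ring_hom_ring) primeideal_vimage: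
  assumes "cring R" "primeideal P S"
  shows "primeideal {r \<in> carrier R. h r \<in> P} R"
proof (rule primeidealI)
  interpret P: primeideal P S by fact
  show "ideal {r \<in> carrier R. h r \<in> P} R" by (rule ideal_vimage[OF P.is_ideal])
  have "h \<one>\<^bsub>R\<^esub> \<notin> P" using P.one_imp_carrier P.I_notcarr by auto
  then have "\<one>\<^bsub>R\<^esub> \<notin> {r \<in> carrier R. h r \<in> P}" by blast
  then show "carrier R \<noteq> {r \<in> carrier R. h r \<in> P}" using R.one_closed by blast
  show "a \<in> {r \<in> carrier R. h r \<in> P} \<or> b \<in> {r \<in> carrier R. h r \<in> P}"
    if "a \<in> carrier R" "b \<in> carrier R" "a \<otimes>\<^bsub>R\<^esub> b \<in> {r \<in> carrier R. h r \<in> P}" for a b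
    using that P.I_prime[of "h a" "h b"] by auto
qed (rule assms(1))

text \<open>A prime containing the kernel is recovered from its image, so strict inclusions between
  such primes survive the passage to the image.\<close>

lemma (in ring_hom_ring) primeideal_image:
  assumes "cring S" "h ` carrier R = carrier S" "primeideal P R" "\<And>x. x \<in> carrier R \<Longrightarrow> h x = \<zero>\<^bsub>S\<^esub> \<Longrightarrow> x \<in> P"
  shows "primeideal (h ` P) S" and "{r \<in> carrier R. h r \<in> h ` P} = P"
proof -
  interpret P: primeideal P R by fact
  have mem: "x \<in> P" if x: "x \<in> carrier R" "h x \<in> h ` P" for x
  proof -
    obtain p where p: "p \<in> P" "h x = h p" using x(2) by auto
    have pc: "p \<in> carrier R" using p(1) P.Icarr by simp
    have "h (x \<ominus>\<^bsub>R\<^esub> p) = \<zero>\<^bsub>S\<^esub>" using x(1) p pc by (simp add: R.minus_eq S.r_neg)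
    then have "x \<ominus>\<^bsub>R\<^esub> p \<in> P" using assms(4) x(1) pc by blast
    then have "x \<ominus>\<^bsub>R\<^esub> p \<oplus>\<^bsub>R\<^esub> p \<in> P" using p(1) by simp
    then show ?thesis using x(1) pc by (simp add: R.minus_eq R.a_assoc R.l_neg)
  qed
  then show eq: "{r \<in> carrier R. h r \<in> h ` P} = P" using P.Icarr by auto
  show "primeideal (h ` P) S"
  proof (rule primeidealI[OF _ assms(1)])
    show "ideal (h ` P) S"
    proof (rule idealI)
      show "ring S" by (rule S.ring_axioms)
      show "subgroup (h ` P) (add_monoid S)"
      proof (rule S.add.subgroupI)
        show "h ` P \<subseteq> carrier S" using P.Icarr by auto
        show "h ` P \<noteq> {}" using additive_subgroup.zero_closed[OF P.is_additive_subgroup] by blast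
        show "\<ominus>\<^bsub>S\<^esub> y \<in> h ` P" if y: "y \<in> h ` P" for y
        proof -
          obtain p where "p \<in> P" "y = h p" using y by auto
          then show ?thesis using P.Icarr by (intro image_eqI[of _ _ "\<ominus>\<^bsub>R\<^esub> p"]) auto
        qed
        show "y \<oplus>\<^bsub>S\<^esub> z \<in> h ` P" if yz: "y \<in> h ` P" "z \<in> h ` P" for y z
        proof -
          obtain p q where "p \<in> P" "y = h p" "q \<in> P" "z = h q" using yz by auto
          then show ?thesis using P.Icarr by (intro image_eqI[of _ _ "p \<oplus>\<^bsub>R\<^esub> q"]) auto
        qed
      qed
      fix y z assume yz: "y \<in> h ` P" "z \<in> carrier S"
      obtain p r where "p \<in> P" "y = h p" "r \<in> carrier R" "z = h r" using yz assms(2) by blast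
      then have eqs: "z \<otimes>\<^bsub>S\<^esub> y = h (r \<otimes>\<^bsub>R\<^esub> p)" "y \<otimes>\<^bsub>S\<^esub> z = h (p \<otimes>\<^bsub>R\<^esub> r)"
        and "r \<otimes>\<^bsub>R\<^esub> p \<in> P" "p \<otimes>\<^bsub>R\<^esub> r \<in> P"
        using P.Icarr P.I_l_closed P.I_r_closed by auto
      then show "z \<otimes>\<^bsub>S\<^esub> y \<in> h ` P" "y \<otimes>\<^bsub>S\<^esub> z \<in> h ` P"
        unfolding eqs by (blast intro: imageI)+
    qed
    have "\<one>\<^bsub>R\<^esub> \<notin> P" using P.one_imp_carrier P.I_notcarr by auto
    then have "h \<one>\<^bsub>R\<^esub> \<notin> h ` P" using mem[of "\<one>\<^bsub>R\<^esub>"] by blast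
    then show "carrier S \<noteq> h ` P" by auto
    fix a b assume ab: "a \<in> carrier S" "b \<in> carrier S" "a \<otimes>\<^bsub>S\<^esub> b \<in> h ` P"
    obtain x y where xy: "x \<in> carrier R" "a = h x" "y \<in> carrier R" "b = h y" using ab(1,2) assms(2) by blast
    have "h (x \<otimes>\<^bsub>R\<^esub> y) \<in> h ` P" using ab(3) xy by simp
    then have "x \<otimes>\<^bsub>R\<^esub> y \<in> P" using mem xy by simp
    then show "a \<in> h ` P \<or> b \<in> h ` P" using P.I_prime xy by auto
  qed
qed

lemma (in ring_hom_ring) prime_chain_vimage:
  assumes "cring R" "h ` carrier R = carrier S" "prime_chain S k"
  shows "prime_chain R k"
proof -
  obtain P :: "nat \<Rightarrow> 'c set" where P: "\<And>i. i \<le> k \<Longrightarrow> primeideal (P i) S" "\<And>i. i < k \<Longrightarrow> P i \<subset> P (Suc i)"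
    using assms(3) unfolding prime_chain_def by auto
  define Q where "Q i = {r \<in> carrier R. h r \<in> P i}" for i
  have "Q i \<subset> Q (Suc i)" if i: "i < k" for i
  proof -
    obtain y where y: "y \<in> P (Suc i)" "y \<notin> P i" using P(2)[OF i] by auto
    have "y \<in> carrier S"
      using y(1) P(1)[of "Suc i"] i ideal.Icarr primeideal.axioms(1) by (metis Suc_leI)
    then obtain x where "x \<in> carrier R" "y = h x" using assms(2) by auto
    then have "x \<in> Q (Suc i) - Q i" using y by (simp add: Q_def)
    moreover have "Q i \<subseteq> Q (Suc i)" using P(2)[OF i] by (auto simp: Q_def)
    ultimately show ?thesis by blast
  qed
  moreover have "primeideal (Q i) R" if "i \<le> k" for i
    unfolding Q_def by (rule primeideal_vimage[OF assms(1) P(1)[OF that]])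
  ultimately show ?thesis unfolding prime_chain_def by (intro exI[of _ Q]) auto
qed

text \<open>An isomorphism together with its inverse: interpreting the locale with the roles
  exchanged gives each transport result in both directions.\<close>

locale ring_iso_pair = f: ring_hom_ring A B f + g: ring_hom_ring B A g for A B f g +
  assumes A: "cring A" and B: "cring B"
    and gf: "x \<in> carrier A \<Longrightarrow> g (f x) = x" and fg: "y \<in> carrier B \<Longrightarrow> f (g y) = y"
begin

lemma ring_iso_pair_sym: "ring_iso_pair B A g f"
  by (intro ring_iso_pair.intro ring_iso_pair_axioms.intro) (use A B gf fg f.ring_hom_ring_axioms g.ring_hom_ring_axioms in auto)

lemma f_surj: "f ` carrier A = carrier B"
proof
  show "carrier B \<subseteq> f ` carrier A" using g.hom_closed fg by (metis image_eqI subsetI)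
qed auto

lemma prime_chain_A: "prime_chain B k \<Longrightarrow> prime_chain A k"
  by (rule f.prime_chain_vimage[OF A f_surj])

lemma genideal_vimage:
  assumes "G \<subseteq> carrier B"
  shows "{x \<in> carrier A. f x \<in> Idl\<^bsub>B\<^esub> G} = Idl\<^bsub>A\<^esub> (g ` G)"
proof
  have gG: "g ` G \<subseteq> carrier A" using assms g.hom_closed by auto
  have I: "ideal {y \<in> carrier B. g y \<in> Idl\<^bsub>A\<^esub> (g ` G)} B"
    by (rule g.ideal_vimage[OF f.R.genideal_ideal[OF gG]])
  have "G \<subseteq> {y \<in> carrier B. g y \<in> Idl\<^bsub>A\<^esub> (g ` G)}"
    using assms f.R.genideal_self[OF gG] by auto
  then have sub: "Idl\<^bsub>B\<^esub> G \<subseteq> {y \<in> carrier B. g y \<in> Idl\<^bsub>A\<^esub> (g ` G)}"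
    by (rule f.S.genideal_minimal[OF I])
  show "{x \<in> carrier A. f x \<in> Idl\<^bsub>B\<^esub> G} \<subseteq> Idl\<^bsub>A\<^esub> (g ` G)"
  proof
    fix x assume x: "x \<in> {x \<in> carrier A. f x \<in> Idl\<^bsub>B\<^esub> G}"
    then have "g (f x) \<in> Idl\<^bsub>A\<^esub> (g ` G)" using sub by blast
    then show "x \<in> Idl\<^bsub>A\<^esub> (g ` G)" using gf x by auto
  qed
  show "Idl\<^bsub>A\<^esub> (g ` G) \<subseteq> {x \<in> carrier A. f x \<in> Idl\<^bsub>B\<^esub> G}"
  proof (rule f.R.genideal_minimal)
    show "ideal {x \<in> carrier A. f x \<in> Idl\<^bsub>B\<^esub> G} A"
      by (rule f.ideal_vimage[OF f.S.genideal_ideal[OF assms]])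
    show "g ` G \<subseteq> {x \<in> carrier A. f x \<in> Idl\<^bsub>B\<^esub> G}"
    proof
      fix x assume "x \<in> g ` G"
      then obtain y where y: "y \<in> G" "x = g y" by blast
      then have "f x = y" "x \<in> carrier A" using assms fg g.hom_closed by auto
      then show "x \<in> {x \<in> carrier A. f x \<in> Idl\<^bsub>B\<^esub> G}" using y(1) f.S.genideal_self[OF assms] by auto
    qed
  qed
qed

lemma vimage_vimage:
  assumes "I \<subseteq> carrier A"
  shows "{x \<in> carrier A. f x \<in> {y \<in> carrier B. g y \<in> I}} = I"
  using assms gf f.hom_closed by auto

lemma maximalideal_vimage:
  assumes "maximalideal m B"
  shows "maximalideal {x \<in> carrier A. f x \<in> m} A"
proof -
  interpret m: maximalideal m B by fact
  have one: "\<one>\<^bsub>A\<^esub> \<notin> {x \<in> carrier A. f x \<in> m}" using m.one_imp_carrier m.I_notcarr by auto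
  show ?thesis
  proof (rule maximalidealI)
    show "ideal {x \<in> carrier A. f x \<in> m} A" by (rule f.ideal_vimage[OF m.is_ideal])
    show "carrier A \<noteq> {x \<in> carrier A. f x \<in> m}" using one f.R.one_closed by blast
    fix J assume J: "ideal J A" "{x \<in> carrier A. f x \<in> m} \<subseteq> J"
    define J' where "J' = {y \<in> carrier B. g y \<in> J}"
    have "m \<subseteq> J'"
    proof
      fix y assume y: "y \<in> m"
      then have yc: "y \<in> carrier B" by (rule m.Icarr)
      then have "g y \<in> {x \<in> carrier A. f x \<in> m}" using y fg g.hom_closed by simp
      then show "y \<in> J'" using J(2) yc by (auto simp: J'_def)
    qed
    moreover have "ideal J' B" unfolding J'_def by (rule g.ideal_vimage[OF J(1)])
    moreover have "J' \<subseteq> carrier B" by (auto simp: J'_def)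
    ultimately have "J' = m \<or> J' = carrier B" using m.I_maximal by blast
    moreover have "J = {x \<in> carrier A. f x \<in> J'}"
      using vimage_vimage[of J] ideal.Icarr[OF J(1)] unfolding J'_def by blast
    ultimately show "J = {x \<in> carrier A. f x \<in> m} \<or> J = carrier A"
      using f.hom_closed by auto
  qed
qed

lemma noetherian_A:
  assumes "noetherian_ring B"
  shows "noetherian_ring A"
proof (rule f.R.noetherian_ringI)
  fix I assume I: "ideal I A"
  have "ideal {y \<in> carrier B. g y \<in> I} B" by (rule g.ideal_vimage[OF I])
  then obtain G where G: "G \<subseteq> carrier B" "finite G" "{y \<in> carrier B. g y \<in> I} = Idl\<^bsub>B\<^esub> G"
    using noetherian_ring.finetely_gen[OF assms] by blast
  have "I = {x \<in> carrier A. f x \<in> Idl\<^bsub>B\<^esub> G}"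
    using vimage_vimage[of I] ideal.Icarr[OF I] unfolding G(3)[symmetric] by blast
  then have "I = Idl\<^bsub>A\<^esub> (g ` G)" using genideal_vimage[OF G(1)] by simp
  then show "\<exists>G\<subseteq>carrier A. finite G \<and> I = Idl\<^bsub>A\<^esub> G"
    using G g.hom_closed by (intro exI[of _ "g ` G"]) auto
qed

lemma krull_dim_A: "krull_dim A = krull_dim B"
proof -
  interpret sym: ring_iso_pair B A g f by (rule ring_iso_pair_sym)
  have "prime_chain A k \<longleftrightarrow> prime_chain B k" for k
    using prime_chain_A sym.prime_chain_A by blast
  then show ?thesis by (simp add: krull_dim_def)
qed

lemma regular_local_A:
  assumes "regular_local_ring B"
  shows "regular_local_ring A"
proof -
  interpret sym: ring_iso_pair B A g f by (rule ring_iso_pair_sym)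
  obtain d where d: "krull_dim B = enat d"
    "\<And>m. maximalideal m B \<Longrightarrow> \<exists>G\<subseteq>carrier B. finite G \<and> card G \<le> d \<and> m = Idl\<^bsub>B\<^esub> G"
    and noeth: "noetherian_ring B" and loc: "\<exists>!m. maximalideal m B"
  proof -
    have "local_ring B" "noetherian_ring B" "\<exists>d. krull_dim B = enat d \<and>
        (\<forall>m. maximalideal m B \<longrightarrow> (\<exists>G\<subseteq>carrier B. finite G \<and> card G \<le> d \<and> m = Idl\<^bsub>B\<^esub> G))"
      using assms unfolding regular_local_ring_def by simp_all
    then show ?thesis using that unfolding local_ring_def by metis
  qed
  have m_eq: "m = {x \<in> carrier A. f x \<in> {y \<in> carrier B. g y \<in> m}}" if "maximalideal m A" for m
    using vimage_vimage[of m] ideal.Icarr[OF maximalideal.axioms(1)[OF that]] by blast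
  have "\<exists>!m. maximalideal m A"
  proof -
    obtain m where m: "maximalideal m B" "\<And>m'. maximalideal m' B \<Longrightarrow> m' = m" using loc by blast
    show ?thesis
    proof (rule ex1I)
      show "maximalideal {x \<in> carrier A. f x \<in> m} A" by (rule maximalideal_vimage[OF m(1)])
      fix m' assume m': "maximalideal m' A"
      then have "{y \<in> carrier B. g y \<in> m'} = m" by (intro m(2) sym.maximalideal_vimage)
      then show "m' = {x \<in> carrier A. f x \<in> m}" using m_eq[OF m'] by simp
    qed
  qed
  moreover have "\<exists>G\<subseteq>carrier A. finite G \<and> card G \<le> d \<and> m = Idl\<^bsub>A\<^esub> G" if m: "maximalideal m A" for m
  proof -
    have "maximalideal {y \<in> carrier B. g y \<in> m} B" by (rule sym.maximalideal_vimage[OF m])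
    then obtain G where G: "G \<subseteq> carrier B" "finite G" "card G \<le> d" "{y \<in> carrier B. g y \<in> m} = Idl\<^bsub>B\<^esub> G"
      using d(2) by blast
    have "m = Idl\<^bsub>A\<^esub> (g ` G)" using m_eq[OF m] genideal_vimage[OF G(1)] unfolding G(4) by simp
    moreover have "card (g ` G) \<le> d" using card_image_le[OF G(2), of g] G(3) by simp
    ultimately show ?thesis using G g.hom_closed by (intro exI[of _ "g ` G"]) auto
  qed
  ultimately show ?thesis
    unfolding regular_local_ring_def local_ring_def
    using A noetherian_A[OF noeth] krull_dim_A d(1) by auto
qed

end

lemma ring_iso_pairI:
  assumes "cring A" "cring B" "f \<in> ring_iso A B"
  shows "ring_iso_pair A B f (inv_into (carrier A) f)"
proof -
  have bij: "bij_betw f (carrier A) (carrier B)" by (rule ring_iso_memE(5)[OF assms(3)])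
  have inv: "inv_into (carrier A) f \<in> ring_iso B A"
    using ring_iso_set_sym[OF cring.axioms(1)[OF assms(1)] assms(3)] .
  show ?thesis
  proof (intro ring_iso_pair.intro ring_iso_pair_axioms.intro ring_hom_ringI2)
    show "f \<in> ring_hom A B" "inv_into (carrier A) f \<in> ring_hom B A"
      using assms(3) inv by (auto simp: ring_iso_def)
    show "inv_into (carrier A) f (f x) = x" if "x \<in> carrier A" for x
      using bij that by (simp add: bij_betw_def)
    show "f (inv_into (carrier A) f y) = y" if "y \<in> carrier B" for y
      using bij that by (simp add: bij_betw_def f_inv_into_f)
  qed (use assms cring.axioms(1) in auto)
qed

subsection \<open>Reduction modulo a prime of the base ring\<close>

lemma FactRing_components: "\<zero>\<^bsub>R Quot I\<^esub> = I" "carrier (R Quot I) = (\<Union>a\<in>carrier R. {I +>\<^bsub>R\<^esub> a})"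
  by (simp_all add: FactRing_def A_RCOSETS_def')

context integral_over_artinian
begin

lemma fg_subalgebra_props:
  assumes "A \<in> fg_subalgebras R B"
  shows "subring A R" "B \<subseteq> A"
proof -
  obtain G where G: "G \<subseteq> carrier R" "A = generate_ring R (B \<union> G)"
    using assms by (auto simp: fg_subalgebras_def)
  show "subring A R" unfolding G(2) using G(1) B_closed(1) by (intro generate_ring_is_subring) auto
  show "B \<subseteq> A" unfolding G(2) by (auto intro: generate_ring.incl)
qed

lemma fg_subalgebra_covering:
  assumes "x \<in> carrier R"
  shows "\<exists>A\<in>fg_subalgebras R B. x \<in> A"
proof
  show "generate_ring R (B \<union> {x}) \<in> fg_subalgebras R B"
    using assms unfolding fg_subalgebras_def by blast
  show "x \<in> generate_ring R (B \<union> {x})" by (auto intro: generate_ring.incl)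
qed

sublocale fg: directed_subrings R "fg_subalgebras R B" n for n
proof (intro directed_subrings.intro directed_subrings_axioms.intro cring_axioms)
  show "fg_subalgebras R B \<noteq> {}" using fg_subalgebra_covering[OF one_closed] by blast
  show "subring A R" if "A \<in> fg_subalgebras R B" for A by (rule fg_subalgebra_props(1)[OF that])
  fix A A' assume "A \<in> fg_subalgebras R B" "A' \<in> fg_subalgebras R B"
  then obtain G G' where G: "finite G" "G \<subseteq> carrier R" "A = generate_ring R (B \<union> G)"
    "finite G'" "G' \<subseteq> carrier R" "A' = generate_ring R (B \<union> G')"
    by (auto simp: fg_subalgebras_def)
  let ?C = "generate_ring R (B \<union> (G \<union> G'))"
  have C: "subring ?C R" using G B_closed(1) by (intro generate_ring_is_subring) auto
  have "B \<union> G \<subseteq> ?C" "B \<union> G' \<subseteq> ?C" by (auto intro: generate_ring.incl)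
  then have "A \<subseteq> ?C" "A' \<subseteq> ?C"
    unfolding G(3,6) using G B_closed(1) by (intro generate_ring_min_subring1 C; blast)+
  moreover have "?C \<in> fg_subalgebras R B" using G unfolding fg_subalgebras_def by blast
  ultimately show "\<exists>C\<in>fg_subalgebras R B. A \<union> A' \<subseteq> C" by blast
qed

text \<open>An element outside \<open>M\<close> is invertible modulo \<open>M\<close>, the inverse
  being found in a finitely generated subalgebra. Hence an ideal strictly above \<open>M\<close>
  contains \<open>\<one>\<close>.\<close>

lemma primeideal_maximal:
  assumes "primeideal M R"
  shows "maximalideal M R"
proof -
  interpret M: primeideal M R by fact
  show ?thesis
  proof (rule maximalidealI[OF M.is_ideal M.I_notcarr])
    fix J assume J: "ideal J R" "M \<subseteq> J"
    interpret J: ideal J R by fact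
    show "J = M \<or> J = carrier R"
    proof (rule ccontr)
      assume *: "\<not> (J = M \<or> J = carrier R)"
      then obtain x where x: "x \<in> J" "x \<notin> M" using J by auto
      obtain A where A: "A \<in> fg_subalgebras R B" "x \<in> A" using fg_subalgebra_covering J.Icarr[OF x(1)] by blast
      obtain y where y: "y \<in> A" "x \<otimes> y \<ominus> \<one> \<in> M"
        using inverse_mod_prime[OF assms fg_subalgebra_props[OF A(1)] A(2) x(2)] by blast
      have yc: "y \<in> carrier R" using y(1) subringE(1)[OF fg_subalgebra_props(1)[OF A(1)]] by auto
      have xc: "x \<in> carrier R" by (rule J.Icarr[OF x(1)])
      have "\<ominus> (x \<otimes> y \<ominus> \<one>) \<in> J" using y(2) J(2) by auto
      then have "x \<otimes> y \<oplus> \<ominus> (x \<otimes> y \<ominus> \<one>) \<in> J" using J.I_r_closed[OF x(1) yc] by simp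
      moreover have "x \<otimes> y \<oplus> \<ominus> (x \<otimes> y \<ominus> \<one>) = \<one>" using xc yc by algebra
      ultimately show False using J.one_imp_carrier * by auto
    qed
  qed
qed

lemma PS_const_hom: "ring_hom_ring R (fg.S n) (PS_const R)"
proof (rule ring_hom_ringI[OF ring_axioms fg.S.ring_axioms])
  show c: "PS_const R x \<in> carrier (fg.S n)" if "x \<in> carrier R" for x
    using fg_subalgebra_covering[OF that] fg.const_closed by blast
  show "PS_const R (x \<otimes> y) = PS_const R x \<otimes>\<^bsub>fg.S n\<^esub> PS_const R y"
    if "x \<in> carrier R" "y \<in> carrier R" for x y
    using that c[OF that(2)] by (auto simp: fun_eq_iff fg.const_mult) (auto simp: PS_const_eval)
  show "PS_const R (x \<oplus> y) = PS_const R x \<oplus>\<^bsub>fg.S n\<^esub> PS_const R y"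
    if "x \<in> carrier R" "y \<in> carrier R" for x y
    using that c by (auto simp: fun_eq_iff fg.S_add) (auto simp: PS_const_eval)
  show "PS_const R \<one> = \<one>\<^bsub>fg.S n\<^esub>" by (simp add: fg.S_ops PS_one)
qed

text \<open>Induction on \<open>F\<close>: the coefficients belonging to one generator
  \<open>m\<close> are elements of \<open>B\<close> and assemble into one series \<open>g\<close>,
  so that \<open>f = m g + u\<close> with the coefficients of \<open>u\<close> in the span of the
  remaining generators.\<close>

lemma rspan_mem_extended:
  assumes "ideal M R" "A \<in> fg_subalgebras R B" "finite F" "F \<subseteq> A \<inter> M"
    "\<And>e. f e \<in> rspan R B F" "\<And>e. e \<notin> exps n \<Longrightarrow> f e = \<zero>"
  shows "f \<in> Idl\<^bsub>fg.S n\<^esub> (PS_const R ` M)"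
  using assms(3-)
proof (induction F arbitrary: f rule: finite_induct)
  interpret M: ideal M R by fact
  interpret h: ring_hom_ring R "fg.S n" "PS_const R" by (rule PS_const_hom)
  have Mc: "PS_const R ` M \<subseteq> carrier (fg.S n)" using M.Icarr by auto
  interpret I: ideal "Idl\<^bsub>fg.S n\<^esub> (PS_const R ` M)" "fg.S n" by (rule fg.S.genideal_ideal[OF Mc])
  note A = fg_subalgebra_props[OF assms(2)]
  note Asub = subringE[OF A(1)]
  {
    case empty
    have "rspan R B {} \<subseteq> {\<zero>}"
      by (rule rspan_subset) (use B_closed(1) in \<open>auto simp: submodule_over_def\<close>)
    then have "f = \<zero>\<^bsub>fg.S n\<^esub>" using empty by (auto simp: fg.S_ops fun_eq_iff)
    then show ?case using additive_subgroup.zero_closed[OF I.is_additive_subgroup] by simp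
  next
    case (insert m F)
    have Fc: "insert m F \<subseteq> carrier R" using insert.prems(1) Asub(1) by auto
    have "\<exists>b w. b \<in> B \<and> w \<in> rspan R B F \<and> f e = b \<otimes> m \<oplus> w" for e
      using rspan_insertE[OF insert.prems(2) Fc] by blast
    then obtain b w where bw: "\<And>e. b e \<in> B" "\<And>e. w e \<in> rspan R B F" "\<And>e. f e = b e \<otimes> m \<oplus> w e"
      by metis
    \<comment> \<open>The choices \<open>b\<close> and \<open>w\<close> are uncontrolled outside
      \<open>exps n\<close>, so both series are reset to zero there.\<close>
    define g where "g = (\<lambda>e. if e \<in> exps n then b e else \<zero>)"
    define u where "u = (\<lambda>e. if e \<in> exps n then w e else \<zero>)"
    have g: "g \<in> carrier (fg.S n)"
    proof (rule fg.S_memI[OF assms(2)])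
      show "g e \<in> A" for e using subsetD[OF A(2) bw(1)[of e]] Asub(2) by (simp add: g_def)
    qed (simp add: g_def)
    have "submodule_over R B A" using Asub A(2) by (auto simp: submodule_over_def)
    then have "rspan R B F \<subseteq> A" using insert.prems(1) by (intro rspan_subset) auto
    then have u: "u \<in> carrier (fg.S n)"
    proof (intro fg.S_memI[OF assms(2)])
      assume *: "rspan R B F \<subseteq> A"
      show "u e \<in> A" for e using subsetD[OF * bw(2)[of e]] Asub(2) by (simp add: u_def)
    qed (simp_all add: u_def)
    have uI: "u \<in> Idl\<^bsub>fg.S n\<^esub> (PS_const R ` M)"
      using insert.prems(1) bw(2) by (intro insert.IH) (auto simp: u_def rspan.zero)
    have mM: "m \<in> M" "m \<in> carrier R" using insert.prems(1) M.Icarr by auto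
    have "PS_const R m \<in> Idl\<^bsub>fg.S n\<^esub> (PS_const R ` M)"
      using fg.S.genideal_self[OF Mc] mM(1) by blast
    then have mg: "PS_const R m \<otimes>\<^bsub>fg.S n\<^esub> g \<in> Idl\<^bsub>fg.S n\<^esub> (PS_const R ` M)"
      using g by (rule I.I_r_closed)
    have mgc: "PS_const R m \<otimes>\<^bsub>fg.S n\<^esub> g \<in> carrier (fg.S n)" by (rule I.Icarr[OF mg])
    have "f = PS_const R m \<otimes>\<^bsub>fg.S n\<^esub> g \<oplus>\<^bsub>fg.S n\<^esub> u"
    proof
      fix e
      have "b e \<in> carrier R" using bw(1) B_closed(1) by auto
      then show "f e = (PS_const R m \<otimes>\<^bsub>fg.S n\<^esub> g \<oplus>\<^bsub>fg.S n\<^esub> u) e"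
        unfolding fg.S_add[OF mgc u] fg.const_mult[OF mM(2) g]
        using insert.prems(3)[of e] mM(2) bw(3)[of e] m_comm[of "b e" m] by (auto simp: g_def u_def)
    qed
    then show ?case using mg uI by simp
  }
qed

end

locale mod_prime = integral_over_artinian + M: primeideal M R for M + fixes n :: nat
begin

abbreviation "K \<equiv> R Quot M"

definition "\<L> = (\<lambda>A. (+>) M ` A) ` fg_subalgebras R B"

lemma K_field: "field K"
  using maximalideal.quotient_is_field[OF primeideal_maximal[OF M.primeideal]] cring_axioms .

sublocale p: ring_hom_cring R K "(+>) M"
  by (rule M.rcos_ring_hom_cring)



lemma proj_zero_iff: "x \<in> carrier R \<Longrightarrow> M +> x = \<zero>\<^bsub>K\<^esub> \<longleftrightarrow> x \<in> M"
proof -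
  assume x: "x \<in> carrier R"
  show ?thesis
    unfolding FactRing_components(1) using M.a_rcos_const[of x] M.a_rcos_self[OF x] by metis
qed

lemma proj_surj: "(+>) M ` carrier R = carrier K"
  unfolding FactRing_components(2) by blast

sublocale D: directed_subfields K \<L> n
proof (intro directed_subfields.intro directed_subrings.intro directed_subrings_axioms.intro
    directed_subfields_axioms.intro K_field)
  show "cring K" by (rule domain.axioms(1)[OF field.axioms(1)[OF K_field]])
  show "\<L> \<noteq> {}" using fg.nonempty by (simp add: \<L>_def)
  show "subring L K" if "L \<in> \<L>" for L
    using that fg.subring ring_hom_ring.img_is_subring[OF M.rcos_ring_hom_ring] by (auto simp: \<L>_def)
  show "\<exists>C\<in>\<L>. L \<union> L' \<subseteq> C" if LL: "L \<in> \<L>" "L' \<in> \<L>" for L L'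
  proof -
    obtain A A' where "A \<in> fg_subalgebras R B" "A' \<in> fg_subalgebras R B" "L = (+>) M ` A" "L' = (+>) M ` A'"
      using LL by (auto simp: \<L>_def)
    moreover from this obtain C where "C \<in> fg_subalgebras R B" "A \<union> A' \<subseteq> C" using fg.directed by blast
    ultimately show ?thesis unfolding \<L>_def by (intro bexI[of _ "(+>) M ` C"]) auto
  qed
  show "\<exists>L\<in>\<L>. x \<in> L" if x: "x \<in> carrier K" for x
  proof -
    obtain r where "r \<in> carrier R" "x = M +> r" using x unfolding proj_surj[symmetric] by (elim imageE) (rule that)
    then show ?thesis using fg_subalgebra_covering[of r] by (auto simp: \<L>_def)
  qed
  show "inv\<^bsub>K\<^esub> x \<in> L" if L: "L \<in> \<L>" and x: "x \<in> L" "x \<noteq> \<zero>\<^bsub>K\<^esub>" for L x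
  proof -
    interpret K: field K by (rule K_field)
    obtain A r where A: "A \<in> fg_subalgebras R B" "L = (+>) M ` A" and r: "r \<in> A" "x = M +> r"
      using L x by (auto simp: \<L>_def)
    note Asub = fg_subalgebra_props[OF A(1)]
    have rc: "r \<in> carrier R" using r(1) subringE(1)[OF Asub(1)] by auto
    have "r \<notin> M" using x(2) proj_zero_iff[OF rc] r(2) by simp
    then obtain y where y: "y \<in> A" "r \<otimes> y \<ominus> \<one> \<in> M"
      using inverse_mod_prime[OF M.primeideal Asub r(1)] by blast
    have yc: "y \<in> carrier R" using y(1) subringE(1)[OF Asub(1)] by auto
    define d where "d = r \<otimes> y \<ominus> \<one>"
    have dc: "d \<in> carrier R" using rc yc by (simp add: d_def)
    have d0: "M +> d = \<zero>\<^bsub>K\<^esub>" using y(2) dc by (simp add: proj_zero_iff d_def)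
    have "r \<otimes> y = d \<oplus> \<one>" unfolding d_def using rc yc by algebra
    then have "M +> (r \<otimes> y) = (M +> d) \<oplus>\<^bsub>K\<^esub> \<one>\<^bsub>K\<^esub>" using dc by simp
    then have "(M +> r) \<otimes>\<^bsub>K\<^esub> (M +> y) = \<one>\<^bsub>K\<^esub>" using rc yc d0 by simp
    then have "inv\<^bsub>K\<^esub> x = M +> y"
      using rc yc r(2) by (metis p.S.comm_inv_char p.hom_closed)
    then show ?thesis using y(1) A(2) by simp
  qed
qed

abbreviation "Sr \<equiv> union_PS R (fg_subalgebras R B) n"

definition red :: "((nat \<Rightarrow> nat) \<Rightarrow> 'a) \<Rightarrow> (nat \<Rightarrow> nat) \<Rightarrow> 'a set" where
  "red f = (\<lambda>e. M +> f e)"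

lemma red_hom: "ring_hom_ring Sr D.S red"
proof (rule ring_hom_ringI[OF fg.S.ring_axioms D.S.ring_axioms])
  show c: "red f \<in> carrier D.S" if f: "f \<in> carrier Sr" for f
  proof -
    obtain A where A: "A \<in> fg_subalgebras R B" "\<forall>e. f e \<in> A" using fg.S_memE[OF f] by blast
    show ?thesis
    proof (rule D.S_memI)
      show "(+>) M ` A \<in> \<L>" using A(1) by (simp add: \<L>_def)
      show "red f e \<in> (+>) M ` A" for e using A(2) by (simp add: red_def)
      show "red f e = \<zero>\<^bsub>K\<^esub>" if "e \<notin> exps n" for e
        using fg.S_outside[OF f that] by (simp add: red_def)
    qed
  qed
  show "red (f \<otimes>\<^bsub>Sr\<^esub> g) = red f \<otimes>\<^bsub>D.S\<^esub> red g" if "f \<in> carrier Sr" "g \<in> carrier Sr" for f g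
  proof
    fix e
    have fc: "f a \<in> carrier R" "g a \<in> carrier R" for a using that fg.S_closed by auto
    have "red (f \<otimes>\<^bsub>Sr\<^esub> g) e = (\<Oplus>\<^bsub>K\<^esub>q\<in>exp_pairs n e. M +> (f (fst q) \<otimes> g (snd q)))"
      unfolding red_def fg.S_mult using fc by (subst p.hom_finsum) (auto simp: comp_def)
    also have "\<dots> = (red f \<otimes>\<^bsub>D.S\<^esub> red g) e"
      unfolding D.S_mult red_def using fc by (intro p.S.finsum_cong') auto
    finally show "red (f \<otimes>\<^bsub>Sr\<^esub> g) e = (red f \<otimes>\<^bsub>D.S\<^esub> red g) e" .
  qed
  show "red (f \<oplus>\<^bsub>Sr\<^esub> g) = red f \<oplus>\<^bsub>D.S\<^esub> red g" if "f \<in> carrier Sr" "g \<in> carrier Sr" for f g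
  proof
    fix e
    show "red (f \<oplus>\<^bsub>Sr\<^esub> g) e = (red f \<oplus>\<^bsub>D.S\<^esub> red g) e"
      unfolding D.S_add[OF c[OF that(1)] c[OF that(2)]]
      using that by (simp add: red_def fg.S_add fg.S_closed)
  qed
  show "red \<one>\<^bsub>Sr\<^esub> = \<one>\<^bsub>D.S\<^esub>"
    unfolding fg.S_ops D.S_ops PS_one by (auto simp: fun_eq_iff red_def PS_const_eval)
qed

sublocale r: ring_hom_ring Sr D.S red
  by (rule red_hom)

text \<open>The coefficients of a series in \<open>D.S\<close> come from the image of one subalgebra
  \<open>A\<close>, so all of them can be lifted into the same \<open>A\<close>.\<close>

lemma red_surj: "red ` carrier Sr = carrier D.S"
proof
  show "red ` carrier Sr \<subseteq> carrier D.S" by auto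
  show "carrier D.S \<subseteq> red ` carrier Sr"
  proof
    fix d assume d: "d \<in> carrier D.S"
    obtain A where A: "A \<in> fg_subalgebras R B" "\<forall>e. d e \<in> (+>) M ` A"
      using D.S_memE[OF d] by (auto simp: \<L>_def)
    then have "\<forall>e. \<exists>x. x \<in> A \<and> d e = M +> x" by blast
    then obtain x where x: "\<And>e. x e \<in> A" "\<And>e. d e = M +> x e" by metis
    define f where "f = (\<lambda>e. if e \<in> exps n then x e else \<zero>)"
    have "f \<in> carrier Sr"
      using x(1) subringE(2)[OF fg.subring[OF A(1)]] by (intro fg.S_memI[OF A(1)]) (auto simp: f_def)
    moreover have "red f = d"
      using x(2) D.S_outside[OF d] by (auto simp: red_def f_def fun_eq_iff)
    ultimately show "d \<in> red ` carrier Sr" by blast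
  qed
qed

lemma red_zero_iff: "f \<in> carrier Sr \<Longrightarrow> red f = \<zero>\<^bsub>D.S\<^esub> \<longleftrightarrow> (\<forall>e. f e \<in> M)"
  using proj_zero_iff[OF fg.S_closed[of f]] by (auto simp: D.S_ops red_def fun_eq_iff)

lemma extended_eq: "Idl\<^bsub>Sr\<^esub> (PS_const R ` M) = {f \<in> carrier Sr. \<forall>e. f e \<in> M}"
proof
  interpret h: ring_hom_ring R Sr "PS_const R" by (rule PS_const_hom)
  have ker: "{f \<in> carrier Sr. \<forall>e. f e \<in> M} = {f \<in> carrier Sr. red f \<in> {\<zero>\<^bsub>D.S\<^esub>}}"
    using red_zero_iff by auto
  have "ideal {f \<in> carrier Sr. \<forall>e. f e \<in> M} Sr"
    unfolding ker by (rule r.ideal_vimage[OF D.S.zeroideal])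
  then show "Idl\<^bsub>Sr\<^esub> (PS_const R ` M) \<subseteq> {f \<in> carrier Sr. \<forall>e. f e \<in> M}"
  proof (rule fg.S.genideal_minimal)
    show "PS_const R ` M \<subseteq> {f \<in> carrier Sr. \<forall>e. f e \<in> M}"
      using M.Icarr additive_subgroup.zero_closed[OF M.is_additive_subgroup] by (auto simp: PS_const_eval)
  qed
  show "{f \<in> carrier Sr. \<forall>e. f e \<in> M} \<subseteq> Idl\<^bsub>Sr\<^esub> (PS_const R ` M)"
  proof
    fix f assume "f \<in> {f \<in> carrier Sr. \<forall>e. f e \<in> M}"
    then have f: "f \<in> carrier Sr" "\<And>e. f e \<in> M" by auto
    obtain A where A: "A \<in> fg_subalgebras R B" "\<forall>e. f e \<in> A" using fg.S_memE[OF f(1)] by blast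
    obtain F where F: "F \<subseteq> A \<inter> M" "finite F" "A \<inter> M \<subseteq> rspan R B F"
      using fg_subalgebra_Int_ideal[OF M.is_ideal A(1)] by blast
    show "f \<in> Idl\<^bsub>Sr\<^esub> (PS_const R ` M)"
      by (rule rspan_mem_extended[OF M.is_ideal A(1) F(2,1)])
        (use F(3) f A(2) fg.S_outside[OF f(1)] in auto)
  qed
qed

lemma extended_eq_vimage: "Idl\<^bsub>Sr\<^esub> (PS_const R ` M) = {f \<in> carrier Sr. red f \<in> {\<zero>\<^bsub>D.S\<^esub>}}"
  unfolding extended_eq using red_zero_iff by auto

lemma extended_prime: "primeideal (Idl\<^bsub>Sr\<^esub> (PS_const R ` M)) Sr"
proof -
  \<comment> \<open>With no variables removed, the primality of coordinate ideals says that
    \<open>D.S\<close> is a domain.\<close>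
  have "D.coord_ideal 0 = {\<zero>\<^bsub>D.S\<^esub>}" by (auto simp: D.coord_ideal_def D.S_ops(4) fun_eq_iff D.S.zero_closed[unfolded D.S_ops(4)])
  then have "primeideal {\<zero>\<^bsub>D.S\<^esub>} D.S" using D.coord_ideal_prime[of 0] by simp
  then show ?thesis
    unfolding extended_eq_vimage by (rule r.primeideal_vimage[OF fg.S_cring])
qed

lemma extended_quotient_iso:
  "ring_iso_pair (Sr Quot Idl\<^bsub>Sr\<^esub> (PS_const R ` M)) D.S (\<lambda>X. the_elem (red ` X))
    (inv_into (carrier (Sr Quot Idl\<^bsub>Sr\<^esub> (PS_const R ` M))) (\<lambda>X. the_elem (red ` X)))"
proof (rule ring_iso_pairI)
  show "cring (Sr Quot Idl\<^bsub>Sr\<^esub> (PS_const R ` M))"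
    by (rule ideal.quotient_is_cring[OF primeideal.axioms(1)[OF extended_prime] fg.S_cring])
  show "cring D.S" by (rule D.S_cring)
  have "a_kernel Sr D.S red = Idl\<^bsub>Sr\<^esub> (PS_const R ` M)"
    unfolding extended_eq_vimage a_kernel_def' singleton_iff ..
  then show "(\<lambda>X. the_elem (red ` X)) \<in> ring_iso (Sr Quot Idl\<^bsub>Sr\<^esub> (PS_const R ` M)) D.S"
    using r.FactRing_iso_set[OF red_surj] by simp
qed

lemma extended_quotient_regular: "regular_local_ring (Sr Quot Idl\<^bsub>Sr\<^esub> (PS_const R ` M))"
  by (rule ring_iso_pair.regular_local_A[OF extended_quotient_iso D.S_regular_local])

lemma extended_quotient_dim: "krull_dim (Sr Quot Idl\<^bsub>Sr\<^esub> (PS_const R ` M)) = enat n"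
  using ring_iso_pair.krull_dim_A[OF extended_quotient_iso] D.krull_dim_S by simp

end

section \<open>Primes and dimension of the ring of Artinian power series\<close>

context integral_over_artinian
begin

lemma contraction_prime:
  assumes "primeideal Q (fg.S n)"
  shows "primeideal {x \<in> carrier R. PS_const R x \<in> Q} R"
  by (rule ring_hom_ring.primeideal_vimage[OF PS_const_hom cring_axioms assms])

text \<open>A prime \<open>Q\<close> inside the extension of \<open>M\<close> contracts to a prime
  inside \<open>M\<close>, as constant terms show. Contractions are maximal, so the contraction
  equals \<open>M\<close> and \<open>Q\<close> contains the extension.\<close>

lemma extended_minimal_prime:
  assumes "primeideal M R"
  shows "minimal_prime (Idl\<^bsub>fg.S n\<^esub> (PS_const R ` M)) (fg.S n)"
proof -
  interpret M: primeideal M R by fact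
  interpret mod_prime R B M n by unfold_locales
  show ?thesis
    unfolding minimal_prime_def
  proof (intro conjI allI impI)
    show "primeideal (Idl\<^bsub>Sr\<^esub> (PS_const R ` M)) Sr" by (rule extended_prime)
    fix Q assume Q: "primeideal Q Sr \<and> Q \<subseteq> Idl\<^bsub>Sr\<^esub> (PS_const R ` M)"
    define N where "N = {x \<in> carrier R. PS_const R x \<in> Q}"
    have N: "maximalideal N R"
      unfolding N_def using Q by (intro primeideal_maximal contraction_prime[of Q n]) simp
    have "N \<subseteq> M"
    proof
      fix x assume "x \<in> N"
      then have "PS_const R x \<in> {f \<in> carrier Sr. \<forall>e. f e \<in> M}" using Q extended_eq by (auto simp: N_def)
      then have "PS_const R x 0 \<in> M" by blast
      then show "x \<in> M" by (simp add: PS_const_eval)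
    qed
    moreover have "M \<subseteq> carrier R" using M.Icarr by blast
    ultimately have "M = N" using maximalideal.I_maximal[OF N M.is_ideal] M.I_notcarr by simp
    then have "PS_const R ` M \<subseteq> Q" unfolding N_def by blast
    moreover have "ideal Q Sr" using Q primeideal.axioms(1) by blast
    ultimately have "Idl\<^bsub>Sr\<^esub> (PS_const R ` M) \<subseteq> Q" by (intro fg.S.genideal_minimal)
    then show "Q = Idl\<^bsub>Sr\<^esub> (PS_const R ` M)" using Q by blast
  qed
qed

text \<open>All members of the chain contain the extension of the contraction \<open>M\<close> of
  the smallest one, which is the kernel of the reduction modulo \<open>M\<close>. The chain
  therefore descends to a strict chain in \<open>D.S\<close>.\<close>

lemma prime_chain_le:
  assumes "prime_chain (fg.S n) k"
  shows "k \<le> n"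
proof -
  obtain Q :: "nat \<Rightarrow> ((nat \<Rightarrow> nat) \<Rightarrow> 'a) set"
    where Q: "\<And>i. i \<le> k \<Longrightarrow> primeideal (Q i) (fg.S n)" "\<And>i. i < k \<Longrightarrow> Q i \<subset> Q (Suc i)"
    using assms unfolding prime_chain_def by auto
  define M where "M = {x \<in> carrier R. PS_const R x \<in> Q 0}"
  interpret M: primeideal M R unfolding M_def by (rule contraction_prime[OF Q(1)]) simp
  interpret mod_prime R B M n by unfold_locales
  have "Q 0 \<subseteq> Q i" if "i \<le> k" for i
    using that Q(2) by (induction i) (auto dest: Suc_le_lessD)
  then have sub0: "Q 0 \<subseteq> Q i" if "i \<le> k" for i using that by blast
  have sub: "Idl\<^bsub>Sr\<^esub> (PS_const R ` M) \<subseteq> Q i" if "i \<le> k" for i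
  proof (rule fg.S.genideal_minimal)
    show "ideal (Q i) Sr" by (rule primeideal.axioms(1)[OF Q(1)[OF that]])
    show "PS_const R ` M \<subseteq> Q i" using sub0[OF that] unfolding M_def by blast
  qed
  have ker: "x \<in> Q i" if "i \<le> k" "x \<in> carrier Sr" "red x = \<zero>\<^bsub>D.S\<^esub>" for x i
    using sub[OF that(1)] that(2,3) unfolding extended_eq_vimage by blast
  have img1: "primeideal (red ` Q i) D.S" if "i \<le> k" for i
    by (rule r.primeideal_image(1)[OF D.S_cring red_surj Q(1)[OF that] ker[OF that]])
  have img2: "{r \<in> carrier Sr. red r \<in> red ` Q i} = Q i" if "i \<le> k" for i
    by (rule r.primeideal_image(2)[OF D.S_cring red_surj Q(1)[OF that] ker[OF that]])
  have "prime_chain D.S k"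
    unfolding prime_chain_def
  proof (intro exI[of _ "\<lambda>i. red ` Q i"] conjI allI impI)
    show "primeideal (red ` Q i) D.S" if "i \<le> k" for i
      by (rule img1[OF that])
    show "red ` Q i \<subset> red ` Q (Suc i)" if i: "i < k" for i
    proof -
      have "red ` Q i \<noteq> red ` Q (Suc i)"
      proof
        assume eq: "red ` Q i = red ` Q (Suc i)"
        have "Q i = Q (Suc i)" using img2[of i] img2[of "Suc i"] i unfolding eq by simp
        then show False using Q(2)[OF i] by simp
      qed
      then show ?thesis using Q(2)[OF i] by blast
    qed
  qed
  then show ?thesis by (rule D.prime_chain_S_le)
qed

lemma ex_prime: "\<exists>M. primeideal M R"
proof -
  obtain M where "maximalideal M R"
    using ex_maximalideal[OF zeroideal] one_not_zero by auto
  then show ?thesis using maximalideal_prime by blast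
qed

lemma krull_dim_eq: "krull_dim (fg.S n) = enat n"
proof -
  obtain M where M: "primeideal M R" using ex_prime by blast
  interpret M: primeideal M R by fact
  interpret mod_prime R B M n by unfold_locales
  have "prime_chain Sr n"
    by (rule r.prime_chain_vimage[OF fg.S_cring red_surj D.prime_chain_S])
  then show ?thesis
    unfolding krull_dim_def using prime_chain_le
    by (intro antisym Sup_least Sup_upper) auto
qed

end

theorem theorem4p6:
  fixes R :: "('a, 'b) ring_scheme" and R0 :: "'a set" and n :: nat
  defines "S \<equiv> artinian_PS R R0 n"
  assumes "cring R"
    and "\<one>\<^bsub>R\<^esub> \<noteq> \<zero>\<^bsub>R\<^esub>"
    and "krull_dim R = 0"
    and "subring R0 R"
    and "artinian_ring (R\<lparr>carrier := R0\<rparr>)"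
    and "integral_over R R0"
  shows "krull_dim S = enat n \<and>
    (\<forall>M. primeideal M R \<longrightarrow>
       (let MS = Idl\<^bsub>S\<^esub> (PS_const R ` M) in
          minimal_prime MS S \<and> regular_local_ring (S Quot MS) \<and> krull_dim (S Quot MS) = enat n))"
proof -
  interpret cring R by fact
  interpret integral_over_artinian R R0
    by (intro integral_over_artinian.intro integral_over_artinian_axioms.intro cring_subring.intro
        cring_subring_axioms.intro) (rule assms)+
  have S: "S = fg.S n" unfolding S_def by (rule artinian_PS_eq)
  have "minimal_prime (Idl\<^bsub>S\<^esub> (PS_const R ` M)) S \<and> regular_local_ring (S Quot (Idl\<^bsub>S\<^esub> (PS_const R ` M))) \<and>
    krull_dim (S Quot (Idl\<^bsub>S\<^esub> (PS_const R ` M))) = enat n" if "primeideal M R" for M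
  proof -
    interpret M: primeideal M R by fact
    interpret mod_prime R R0 M n by unfold_locales
    show ?thesis
      unfolding S using extended_minimal_prime[OF that] extended_quotient_regular extended_quotient_dim by blast
  qed
  then show ?thesis unfolding Let_def using krull_dim_eq S by blast
qed

end
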